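(* Let $d\in\mathbb{N}$ and let $\mathbf{w}=(w_1,\dots,w_d)$ with $w_i\ge0$ and $\sum_i w_i=1$. For any compactly supported Ahlfors regular absolutely decaying measure $\mu$ on $\mathbb{R}^d$, we have $\mathbf{Bad}(\mathbf{w})\cap\operatorname{supp}\mu\ne\varnothing$.
   Context: $\mathbf{Bad}(\mathbf{w})$ is the set of $\mathbf{x}\in\mathbb{R}^d$ for which there exists $c>0$ such that for every $q\in\mathbb{N}$ and $\mathbf{p}\in\mathbb{Z}^d$ there is $1\le i\le d$ with $|x_i-p_i/q|\ge c/q^{1+w_i}$. A Borel measure $\mu$ on $\mathbb{R}^d$ is Ahlfors regular if for some $\alpha>0$ there exist $A,\rho_0>0$ with $A^{-1}r^\alpha\le\mu(B(\mathbf{x},r))\le Ar^\alpha$ for all $\mathbf{x}\in\operatorname{supp}\mu$ and $0<r\le\rho_0$ (closed Euclidean balls). It is absolutely decaying if there exist $D,\delta,r_0>0$ such that for every $\mathbf{x}\in\operatorname{supp}\mu$, $0<r\le r_0$, every hyperplane $H\subseteq\mathbb{R}^d$ and $r'>0$: $\mu(B(H,r')\cap B(\mathbf{x},r))\le D(r'/r)^\delta\mu(B(\mathbf{x},r))$, where $B(H,r')$ is the closed $r'$-neighbourhood of $H$. *)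

theory Defs
  imports "HOL-Analysis.Analysis"
begin

definition Bad :: "real ^ 'd \<Rightarrow> (real ^ 'd) set" where
  "Bad w = {x. \<exists>c>0. \<forall>(q::nat) (p :: int ^ 'd). q \<ge> 1 \<longrightarrow>
     (\<exists>i. \<bar>x $ i - real_of_int (p $ i) / real q\<bar> \<ge> c / real q powr (1 + w $ i))}"

definition msupp :: "'a::topological_space measure \<Rightarrow> 'a set" where
  "msupp \<mu> = {x. \<forall>U. open U \<longrightarrow> x \<in> U \<longrightarrow> emeasure \<mu> U > 0}"

(* Measures are taken with values in the extended nonnegative reals: the upper bound below
   contains the finiteness of the balls, which the real-valued "measure" would lose. *)
definition ahlfors_regular :: "'a::euclidean_space measure \<Rightarrow> bool" where
  "ahlfors_regular \<mu> \<longleftrightarrow> (\<exists>\<alpha>>0. \<exists>A>0. \<exists>\<rho>\<^sub>0>0. \<forall>x\<in>msupp \<mu>. \<forall>r. 0 < r \<and> r \<le> \<rho>\<^sub>0 \<longrightarrow>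
     ennreal (inverse A * r powr \<alpha>) \<le> emeasure \<mu> (cball x r) \<and>
     emeasure \<mu> (cball x r) \<le> ennreal (A * r powr \<alpha>))"

definition hyperplane :: "'a::euclidean_space set \<Rightarrow> bool" where
  "hyperplane H \<longleftrightarrow> (\<exists>a b. a \<noteq> 0 \<and> H = {x. a \<bullet> x = b})"

definition closed_nbhd :: "'a::metric_space set \<Rightarrow> real \<Rightarrow> 'a set" where
  "closed_nbhd S r = {x. infdist x S \<le> r}"

definition absolutely_decaying :: "'a::euclidean_space measure \<Rightarrow> bool" where
  "absolutely_decaying \<mu> \<longleftrightarrow> (\<exists>D>0. \<exists>\<delta>>0. \<exists>r\<^sub>0>0. \<forall>x\<in>msupp \<mu>. \<forall>r. 0 < r \<and> r \<le> r\<^sub>0 \<longrightarrow>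
     (\<forall>H r'. hyperplane H \<and> r' > 0 \<longrightarrow>
        emeasure \<mu> (closed_nbhd H r' \<inter> cball x r)
          \<le> ennreal (D * (r' / r) powr \<delta>) * emeasure \<mu> (cball x r)))"

end

(* Bad(w) is attacked through integer affine forms a0 + a.x with |a_i| of size Q^(w_i): it suffices
   that at every time Q = q^n each nonzero form is bounded below at x by a constant times 1/Q, and the
   pigeonhole principle turns this into the statement about rational points.

   Instead of single forms, all primitive sublattices of Z^(d+1) are controlled on a nested family of
   balls B_m of radius R^-m centred in the support of the measure. At time n a sublattice of rank j has
   a volume (of the linear parts a) and a slope (how large its forms get on B_m relative to their linear
   parts). The requirement is: if the volume is below R^(-gamma_j x), where x is n - m up to a shift,
   then the forms are large somewhere on B_m. The volume does not depend on the point and decreases in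
   time, while volume times slope increases, so each sublattice is critical only once. Submodularity of
   Gram determinants, applied to the join and meet of two sublattices of the same rank that are both
   about to violate the requirement, contradicts the requirement for the join or the meet, because
   gamma is concave with gamma_0 = gamma_(d+1) = 0; when the join has full rank one gains from the
   direction of the largest weight, in which a ball is R^(n-m) times larger than the natural box of
   time n. Hence for each rank and time a ball has a single dangerous sublattice, the points to be avoided h
   levels later lie in a bounded number of slabs of relative width R^(-c h), and absolute decay makes their
   proportion so small that some branch of the tree of balls survives. *)

theory Submission
  imports "Jordan_Normal_Form.Determinant" Defs
begin

section \<open>Gram determinants\<close>

text \<open>On one ball infinitely many times \<open>n\<close> have to be watched, so a fixed
  lookback would charge unboundedly many slabs to one ancestor. The lookback is therefore
  \<open>h = x div K + 1\<close>, proportional to \<open>x = n + L - m\<close>: each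
  \<open>h\<close> then serves at most \<open>K\<close> times, and between the ancestor and the
  failing ball the forms differ by a factor \<open>R^(\<kappa> h / 8)\<close>, which makes decay
  summable over \<open>h\<close>. The price is that smallness on the failing ball reaches the
  ancestor with a loss \<open>R^(h + 2)\<close>. In the uniqueness argument the drop
  \<open>\<nu>\<close> of \<open>\<theta>\<close> per rank absorbs this loss for the meet and the
  curvature \<open>g\<close> of \<open>\<gamma>\<close> absorbs it for the join;
  \<open>4 \<le> \<nu> K\<close> keeps \<open>h\<close> below these margins. Times down to
  \<open>m - lf\<close> are kept because at the last of them the forms vary on the ball only by
  \<open>R^-lf\<close> relative to their linear parts, so that control somewhere on the ball becomes
  a bound at each of its points. The constants are fixed in the order \<open>\<kappa>\<close>,
  \<open>g\<close>, \<open>\<nu>\<close>, \<open>K\<close>, \<open>L\<close>, \<open>lf\<close>,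
  \<open>R\<close>, and only \<open>R\<close> depends on the measure.\<close>

no_notation Matrix.vec_index (infixl "$" 100)
no_notation Matrix.scalar_prod (infix "\<bullet>" 70)

definition gram_mat :: "'a::real_inner list \<Rightarrow> real mat" where
  "gram_mat vs = Matrix.mat (length vs) (length vs) (\<lambda>(i, j). vs ! i \<bullet> vs ! j)"

definition gram :: "'a::real_inner list \<Rightarrow> real" where
  "gram vs = Determinant.det (gram_mat vs)"

lemma gram_mat_carrier [simp]: "gram_mat vs \<in> carrier_mat (length vs) (length vs)"
  by (simp add: gram_mat_def)

lemma gram_Nil [simp]: "gram [] = 1"
  by (simp add: gram_def gram_mat_def)

text \<open>The Gram matrix transforms by congruence, so the determinant of the coefficients enters
  squared. Coefficients are indexed by position, hence the lists may have repeated entries.\<close>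

lemma gram_change:
  fixes us vs :: "'a::real_inner list"
  assumes len: "length us = length vs"
    and us: "\<And>i. i < length us \<Longrightarrow> us ! i = (\<Sum>k<length vs. M i k *\<^sub>R vs ! k)"
  shows "gram us = (Determinant.det (Matrix.mat (length vs) (length vs) (\<lambda>(i, k). M i k)))\<^sup>2 * gram vs"
proof -
  let ?n = "length vs"
  let ?M = "Matrix.mat ?n ?n (\<lambda>(i, k). M i k)"
  have M: "?M \<in> carrier_mat ?n ?n" by simp
  have "gram_mat us = ?M * gram_mat vs * transpose_mat ?M"
  proof (rule eq_matI)
    fix i j assume "i < dim_row (?M * gram_mat vs * transpose_mat ?M)"
      and "j < dim_col (?M * gram_mat vs * transpose_mat ?M)"
    then have i: "i < ?n" and j: "j < ?n" by auto
    have "gram_mat us $$ (i, j) = us ! i \<bullet> us ! j"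
      using i j len by (simp add: gram_mat_def)
    also have "\<dots> = (\<Sum>k<?n. M i k *\<^sub>R vs ! k) \<bullet> (\<Sum>l<?n. M j l *\<^sub>R vs ! l)"
      using us i j len by simp
    also have "\<dots> = (\<Sum>l<?n. (\<Sum>k<?n. M i k * (vs ! k \<bullet> vs ! l)) * M j l)"
      unfolding inner_sum_left inner_sum_right inner_scaleR_left inner_scaleR_right
      by (simp add: sum_distrib_right sum_distrib_left mult_ac)
    also have "\<dots> = (?M * gram_mat vs * transpose_mat ?M) $$ (i, j)"
      using i j
      by (simp add: gram_mat_def scalar_prod_def lessThan_atLeast0 row_def col_def)
    finally show "gram_mat us $$ (i, j) = (?M * gram_mat vs * transpose_mat ?M) $$ (i, j)" .
  qed (use len in \<open>auto simp: gram_mat_def\<close>)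
  then have "gram us = Determinant.det (?M * gram_mat vs) * Determinant.det (transpose_mat ?M)"
    unfolding gram_def by (metis M gram_mat_carrier det_mult mult_carrier_mat transpose_carrier_mat)
  also have "\<dots> = Determinant.det ?M * gram vs * Determinant.det ?M"
    unfolding gram_def by (simp add: det_mult[OF M gram_mat_carrier] Determinant.det_transpose[OF M])
  finally show ?thesis by (simp add: power2_eq_square mult_ac)
qed

lemma gram_snoc_orthogonal:
  fixes vs :: "'a::real_inner list"
  assumes "\<And>v. v \<in> set vs \<Longrightarrow> v \<bullet> z = 0"
  shows "gram (vs @ [z]) = gram vs * (z \<bullet> z)"
proof -
  let ?n = "length vs"
  let ?D = "Matrix.mat 1 1 (\<lambda>_. z \<bullet> z)"
  have nth: "vs ! i \<bullet> z = 0" "z \<bullet> vs ! i = 0" if "i < ?n" for i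
    using assms[of "vs ! i"] that by (auto simp: inner_commute)
  have "gram_mat (vs @ [z]) = four_block_mat (gram_mat vs) (0\<^sub>m ?n 1) (0\<^sub>m 1 ?n) ?D"
    by (rule eq_matI) (auto simp: gram_mat_def nth_append nth less_Suc_eq)
  then have "gram (vs @ [z]) = gram vs * Determinant.det ?D"
    unfolding gram_def by (simp only:) (rule det_four_block_mat_upper_right_zero, auto)
  then show ?thesis by (simp add: det_single)
qed

lemma span_list_coeffs:
  assumes "v \<in> span (set vs)"
  shows "\<exists>c::nat \<Rightarrow> real. v = (\<Sum>i<length vs. c i *\<^sub>R vs ! i)"
  using assms
proof (induction vs arbitrary: v rule: rev_induct)
  case (snoc u vs)
  then obtain k where "v - k *\<^sub>R u \<in> span (set vs)"
    using span_breakdown_eq[of v u "set vs"] by auto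
  with snoc.IH obtain c where c: "v - k *\<^sub>R u = (\<Sum>i<length vs. c i *\<^sub>R vs ! i)" by blast
  have "v = (\<Sum>i<length (vs @ [u]). (c(length vs := k)) i *\<^sub>R (vs @ [u]) ! i)"
    using c by (simp add: nth_append algebra_simps)
  then show ?case by blast
qed simp

lemma sum_list_in_span: "(\<Sum>i<length vs. c i *\<^sub>R vs ! i) \<in> span (set vs)"
  by (intro span_sum span_scale span_base) simp

text \<open>The coefficient matrix is lower triangular with unit diagonal, so its determinant is
  1.\<close>

lemma gram_snoc_shear:
  assumes "y \<in> span (set vs)"
  shows "gram (vs @ [y + z]) = gram (vs @ [z])"
proof -
  let ?n = "length vs"
  obtain c where c: "y = (\<Sum>i<?n. c i *\<^sub>R vs ! i)" using span_list_coeffs[OF assms] by blast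
  define M where "M i k = (if i = k then 1 else if i = ?n then c k else (0::real))" for i k
  have "gram (vs @ [y + z]) = (Determinant.det (Matrix.mat (length (vs @ [z])) (length (vs @ [z])) (\<lambda>(i, k). M i k)))\<^sup>2 * gram (vs @ [z])"
  proof (rule gram_change)
    fix i assume "i < length (vs @ [y + z])"
    then consider "i < ?n" | "i = ?n" by force
    then show "(vs @ [y + z]) ! i = (\<Sum>k<length (vs @ [z]). M i k *\<^sub>R (vs @ [z]) ! k)"
    proof cases
      case 1
      have "(\<Sum>k<?n. M i k *\<^sub>R (vs @ [z]) ! k) = (\<Sum>k<?n. if k = i then vs ! k else 0)"
        using 1 by (intro sum.cong) (auto simp: M_def nth_append)
      then show ?thesis using 1 by (simp add: M_def nth_append)
    next
      case 2
      have "(\<Sum>k<?n. M i k *\<^sub>R (vs @ [z]) ! k) = y"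
        unfolding c using 2 by (intro sum.cong) (auto simp: M_def nth_append)
      then show ?thesis using 2 by (simp add: M_def nth_append)
    qed
  qed simp
  moreover have "Determinant.det (Matrix.mat (length (vs @ [z])) (length (vs @ [z])) (\<lambda>(i, k). M i k)) = 1"
    by (subst det_lower_triangular[where n = "Suc ?n"])
      (auto simp: M_def prod_list_diag_prod intro!: prod.neutral)
  ultimately show ?thesis by simp
qed

text \<open>Base times height, for squared volumes. This recursion takes the place of exterior
  powers: the volume inequalities below append one vector at a time and compare heights.\<close>

lemma gram_snoc:
  fixes vs :: "'a::euclidean_space list"
  shows "gram (vs @ [u]) = gram vs * (infdist u (span (set vs)))\<^sup>2"
proof -
  obtain y z where yz: "y \<in> span (set vs)" "\<And>w. w \<in> span (set vs) \<Longrightarrow> z \<bullet> w = 0" "u = y + z"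
    using orthogonal_subspace_decomp_exists[of "set vs" u] unfolding real_inner_class.orthogonal_def by metis
  have "infdist u (span (set vs)) = norm z"
  proof (rule antisym)
    show "infdist u (span (set vs)) \<le> norm z"
      using infdist_le[OF yz(1), of u] yz(3) by (simp add: dist_norm)
    have "norm z \<le> dist u w" if "w \<in> span (set vs)" for w
    proof -
      have "(norm (u - w))\<^sup>2 = (norm (y - w))\<^sup>2 + (norm z)\<^sup>2"
        using yz(2)[OF span_diff[OF yz(1) that]]
        by (simp add: yz(3) power2_norm_eq_inner algebra_simps inner_commute)
      then show ?thesis
        by (smt (verit) dist_norm norm_ge_zero power2_le_imp_le zero_le_power2)
    qed
    then show "norm z \<le> infdist u (span (set vs))"
      using yz(1) by (subst infdist_notempty) (auto intro!: cINF_greatest)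
  qed
  moreover have "gram (vs @ [z]) = gram vs * (z \<bullet> z)"
    using yz(2) by (intro gram_snoc_orthogonal) (metis inner_commute span_base)
  ultimately show ?thesis
    using gram_snoc_shear[OF yz(1), of z] yz(3) by (simp add: power2_norm_eq_inner)
qed

lemma gram_singleton: "gram [z :: 'a::euclidean_space] = (norm z)\<^sup>2"
  using gram_snoc[of "[]" z] by simp

lemma gram_nonneg: "0 \<le> gram (vs :: 'a::euclidean_space list)"
  by (induction vs rule: rev_induct) (auto simp: gram_snoc)

lemma infdist_span_pos_iff:
  fixes u :: "'a::euclidean_space"
  shows "0 < infdist u (span S) \<longleftrightarrow> u \<notin> span S"
  using in_closed_iff_infdist_zero[OF closed_span[of S], of u] infdist_nonneg[of u "span S"]
  by (metis empty_iff less_le span_zero)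

lemma gram_snoc_pos_iff:
  fixes vs :: "'a::euclidean_space list"
  shows "0 < gram (vs @ [u]) \<longleftrightarrow> 0 < gram vs \<and> u \<notin> span (set vs)"
  using gram_nonneg[of vs] infdist_nonneg[of u "span (set vs)"] infdist_span_pos_iff[of u "set vs"]
  by (auto simp: gram_snoc zero_less_mult_iff less_le)

lemma gram_pos_iff:
  fixes vs :: "'a::euclidean_space list"
  shows "0 < gram vs \<longleftrightarrow> distinct vs \<and> independent (set vs)"
proof (induction vs rule: rev_induct)
  case (snoc u vs)
  then show ?case
    by (auto simp: gram_snoc_pos_iff independent_insert dest: span_base)
qed (simp add: independent_empty)

lemma le_infdist:
  assumes "\<And>y. y \<in> A \<Longrightarrow> a \<le> C * dist x y" "A \<noteq> {}" "0 \<le> (C::real)"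
  shows "a \<le> C * infdist x A"
proof (cases "C = 0")
  case False
  then have "a / C \<le> dist x y" if "y \<in> A" for y
    using assms(1)[OF that] assms(3) by (simp add: field_simps)
  then have "a / C \<le> infdist x A"
    using assms(2) by (subst infdist_notempty) (auto intro!: cINF_greatest)
  then show ?thesis using False assms(3) by (simp add: field_simps)
qed (use assms in auto)

text \<open>Every candidate \<open>g w\<close> for the distance on the right gives the candidate
  \<open>f w\<close> on the left, and the hypothesis is applied to \<open>u - w\<close>.\<close>

lemma infdist_span_image_le:
  assumes f: "linear f" and g: "linear g" and C: "0 \<le> C"
    and le: "\<And>w. w \<in> span (insert u S) \<Longrightarrow> norm (f w) \<le> C * norm (g w)"
  shows "infdist (f u) (span (f ` S)) \<le> C * infdist (g u) (span (g ` S))"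
proof (rule le_infdist[OF _ _ C])
  fix y assume "y \<in> span (g ` S)"
  then obtain w where w: "w \<in> span S" "y = g w"
    using linear_span_image[OF g, of S] by auto
  have "u - w \<in> span (insert u S)"
    using w(1) by (meson insertI1 span_base span_diff span_mono subsetD subset_insertI)
  then have "norm (f (u - w)) \<le> C * norm (g (u - w))" by (rule le)
  moreover have "f w \<in> span (f ` S)" using w(1) linear_span_image[OF f, of S] by auto
  ultimately show "infdist (f u) (span (f ` S)) \<le> C * dist (g u) y"
    using infdist_le[of "f w" "span (f ` S)" "f u"]
    by (simp add: dist_norm w(2) linear_diff[OF f] linear_diff[OF g])
qed (use span_zero in blast)

lemma gram_map_le:
  fixes vs :: "'a::euclidean_space list" and f :: "'a \<Rightarrow> 'b::euclidean_space"
    and g :: "'a \<Rightarrow> 'c::euclidean_space"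
  assumes f: "linear f" and g: "linear g" and C: "0 \<le> C"
    and le: "\<And>w. w \<in> span (set vs) \<Longrightarrow> norm (f w) \<le> C * norm (g w)"
  shows "gram (map f vs) \<le> C ^ (2 * length vs) * gram (map g vs)"
  using le
proof (induction vs rule: rev_induct)
  case (snoc u vs)
  have *: "span (set vs) \<subseteq> span (set (vs @ [u]))" by (intro span_mono) auto
  have "infdist (f u) (span (f ` set vs)) \<le> C * infdist (g u) (span (g ` set vs))"
    using snoc.prems by (intro infdist_span_image_le f g C) auto
  then have "(infdist (f u) (span (f ` set vs)))\<^sup>2 \<le> (C * infdist (g u) (span (g ` set vs)))\<^sup>2"
    by (intro power_mono infdist_nonneg)
  moreover have "gram (map f vs) \<le> C ^ (2 * length vs) * gram (map g vs)"
    using snoc * by blast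
  ultimately have "gram (map f vs) * (infdist (f u) (span (f ` set vs)))\<^sup>2
      \<le> (C ^ (2 * length vs) * gram (map g vs)) * (C * infdist (g u) (span (g ` set vs)))\<^sup>2"
    by (intro mult_mono) (auto simp: gram_nonneg C)
  then show ?case by (simp add: gram_snoc power_mult_distrib power2_eq_square algebra_simps)
qed simp

text \<open>With \<open>v\<close> in front, the bases contribute the quotient of the norms at
  \<open>v\<close>, and every later height is at least as large for \<open>f\<close> as for
  \<open>g\<close>.\<close>

lemma gram_Cons_ratio:
  fixes qs :: "'a::euclidean_space list" and f :: "'a \<Rightarrow> 'b::euclidean_space"
    and g :: "'a \<Rightarrow> 'c::euclidean_space"
  assumes f: "linear f" and g: "linear g"
    and le: "\<And>w. norm (g w) \<le> norm (f w)"
  shows "gram (map g (v # qs)) * (norm (f v))\<^sup>2 \<le> gram (map f (v # qs)) * (norm (g v))\<^sup>2"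
proof (induction qs rule: rev_induct)
  case Nil
  then show ?case by (simp add: gram_singleton)
next
  case (snoc u qs)
  have "infdist (g u) (span (g ` set (v # qs))) \<le> 1 * infdist (f u) (span (f ` set (v # qs)))"
    using le by (intro infdist_span_image_le f g) auto
  then have "(infdist (g u) (span (g ` set (v # qs))))\<^sup>2 \<le> (infdist (f u) (span (f ` set (v # qs))))\<^sup>2"
    by (intro power_mono infdist_nonneg) simp
  from mult_mono[OF snoc this] show ?case
    using gram_snoc[of "map g (v # qs)" "g u"] gram_snoc[of "map f (v # qs)" "f u"]
    by (simp add: gram_nonneg mult_ac)
qed

text \<open>Since \<open>g e = 0\<close>, putting \<open>e\<close> in front does not change the
  spans on the side of \<open>g\<close>, so the heights still compare, while \<open>e\<close>
  contributes its full length under \<open>f\<close>. Applied to \<open>e0\<close>, which has no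
  linear part.\<close>

lemma gram_Cons_kernel:
  fixes qs :: "'a::euclidean_space list" and f :: "'a \<Rightarrow> 'b::euclidean_space"
    and g :: "'a \<Rightarrow> 'c::euclidean_space"
  assumes f: "linear f" and g: "linear g" and e: "g e = 0"
    and le: "\<And>w. norm (g w) \<le> norm (f w)"
  shows "(norm (f e))\<^sup>2 * gram (map g qs) \<le> gram (map f (e # qs))"
proof (induction qs rule: rev_induct)
  case Nil
  then show ?case by (simp add: gram_singleton)
next
  case (snoc u qs)
  have "infdist (g u) (span (g ` set (e # qs))) \<le> 1 * infdist (f u) (span (f ` set (e # qs)))"
    using le by (intro infdist_span_image_le f g) auto
  then have "(infdist (g u) (span (g ` set qs)))\<^sup>2 \<le> (infdist (f u) (span (f ` set (e # qs))))\<^sup>2"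
    by (intro power_mono infdist_nonneg) (simp add: e)
  from mult_mono[OF snoc this] show ?case
    using gram_snoc[of "map g qs" "g u"] gram_snoc[of "map f (e # qs)" "f u"]
    by (simp add: gram_nonneg mult_ac)
qed

text \<open>The height of a vector over a larger span is smaller; this is applied to the entries of
  \<open>cs\<close> one after the other.\<close>

lemma gram_submodular:
  fixes as bs cs :: "'a::euclidean_space list"
  shows "gram (as @ bs @ cs) * gram as \<le> gram (as @ bs) * gram (as @ cs)"
proof (induction cs rule: rev_induct)
  case (snoc c cs)
  have "infdist c (span (set (as @ bs @ cs))) \<le> infdist c (span (set (as @ cs)))"
    by (intro infdist_mono span_mono) (use span_zero in auto)
  then have "(infdist c (span (set (as @ bs @ cs))))\<^sup>2 \<le> (infdist c (span (set (as @ cs))))\<^sup>2"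
    by (intro power_mono infdist_nonneg)
  from mult_mono[OF snoc this] show ?case
    using gram_snoc[of "as @ bs @ cs" c] gram_snoc[of "as @ cs" c]
    by (simp add: gram_nonneg mult_ac)
qed (simp add: mult.commute)

lemma gram_map_pos:
  fixes vs :: "'a::euclidean_space list" and f :: "'a \<Rightarrow> 'b::euclidean_space"
  assumes f: "linear f" and inj: "\<And>v. v \<in> span (set vs) \<Longrightarrow> f v = 0 \<Longrightarrow> v = 0" and "0 < gram vs"
  shows "0 < gram (map f vs)"
  using assms(2,3)
proof (induction vs rule: rev_induct)
  case (snoc u vs)
  have u: "u \<notin> span (set vs)" and vs: "0 < gram vs" using snoc.prems(2) by (auto simp: gram_snoc_pos_iff)
  have sub: "span (set vs) \<subseteq> span (set (vs @ [u]))" by (intro span_mono) auto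
  have "f u \<notin> span (f ` set vs)"
  proof
    assume "f u \<in> span (f ` set vs)"
    then obtain w where w: "w \<in> span (set vs)" "f u = f w"
      using linear_span_image[OF f, of "set vs"] by auto
    have "u - w \<in> span (set (vs @ [u]))"
      using w(1) sub by (intro span_diff) (auto intro: span_base)
    then have "u = w" using snoc.prems(1)[of "u - w"] w(2) by (simp add: linear_diff[OF f])
    then show False using u w(1) by simp
  qed
  moreover have "0 < gram (map f vs)" using snoc vs sub by blast
  ultimately show ?case by (simp add: gram_snoc_pos_iff)
qed simp

lemma gram_map_change:
  fixes us vs :: "'a::real_inner list" and f :: "'a \<Rightarrow> 'b::real_inner"
  assumes "length us = length vs" and f: "linear f"
    and us: "\<And>i. i < length us \<Longrightarrow> us ! i = (\<Sum>k<length vs. M i k *\<^sub>R vs ! k)"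
  shows "gram (map f us) =
    (Determinant.det (Matrix.mat (length vs) (length vs) (\<lambda>(i, k). M i k)))\<^sup>2 * gram (map f vs)"
proof -
  have "gram (map f us) = (Determinant.det (Matrix.mat (length (map f vs)) (length (map f vs)) (\<lambda>(i, k). M i k)))\<^sup>2
      * gram (map f vs)"
  proof (rule gram_change)
    fix i assume "i < length (map f us)"
    then show "map f us ! i = (\<Sum>k<length (map f vs). M i k *\<^sub>R map f vs ! k)"
      using us[of i] by (simp add: linear_sum[OF f] linear_scale[OF f] assms(1))
  qed (simp add: assms)
  then show ?thesis by simp
qed

text \<open>Steinitz exchange, for a list that may be dependent.\<close>

lemma span_exchange_Cons:
  fixes v :: "'a::real_vector"
  assumes "v \<in> span (set ps)" "v \<noteq> 0"
  shows "\<exists>qs. Suc (length qs) = length ps \<and> set ps \<subseteq> span (set (v # qs))"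
  using assms
proof (induction ps)
  case (Cons p ps)
  show ?case
  proof (cases "v \<in> span (set ps)")
    case True
    with Cons obtain qs where "Suc (length qs) = length ps" "set ps \<subseteq> span (set (v # qs))" by blast
    moreover have "span (set (v # qs)) \<subseteq> span (set (v # p # qs))" by (intro span_mono) auto
    moreover have "p \<in> span (set (v # p # qs))" by (intro span_base) auto
    ultimately show ?thesis by (intro exI[of _ "p # qs"]) auto
  next
    case False
    then have "p \<in> span (insert v (set ps))"
      using in_span_insert[of v p "set ps"] Cons.prems(1) by simp
    moreover have "set ps \<subseteq> span (insert v (set ps))" by (meson span_superset subset_insertI subset_trans)
    ultimately show ?thesis by (intro exI[of _ ps]) auto
  qed
qed simp

text \<open>A single vector that is much longer under \<open>f\<close> than under \<open>g\<close>
  forces the whole volume to be larger in the same ratio. The list is rewritten in terms of one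
  starting with \<open>v\<close>; both volumes then carry the same squared determinant.\<close>

lemma gram_ratio:
  fixes ps :: "'a::euclidean_space list" and f :: "'a \<Rightarrow> 'b::euclidean_space"
    and g :: "'a \<Rightarrow> 'c::euclidean_space"
  assumes f: "linear f" and g: "linear g" and le: "\<And>w. norm (g w) \<le> norm (f w)"
    and v: "v \<in> span (set ps)"
  shows "gram (map g ps) * (norm (f v))\<^sup>2 \<le> gram (map f ps) * (norm (g v))\<^sup>2"
proof (cases "v = 0")
  case False
  then obtain qs where qs: "Suc (length qs) = length ps" "set ps \<subseteq> span (set (v # qs))"
    using span_exchange_Cons[OF v] by blast
  have "\<forall>i<length ps. \<exists>c::nat \<Rightarrow> real. ps ! i = (\<Sum>k<length (v # qs). c k *\<^sub>R (v # qs) ! k)"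
  proof (intro allI impI)
    fix i assume "i < length ps"
    then have "ps ! i \<in> span (set (v # qs))" using qs(2) nth_mem by blast
    then show "\<exists>c::nat \<Rightarrow> real. ps ! i = (\<Sum>k<length (v # qs). c k *\<^sub>R (v # qs) ! k)"
      by (rule span_list_coeffs)
  qed
  then obtain M where M: "\<And>i. i < length ps \<Longrightarrow> ps ! i = (\<Sum>k<length (v # qs). M i k *\<^sub>R (v # qs) ! k)"
    by metis
  have len: "length ps = length (v # qs)" using qs by simp
  define D where "D = (Determinant.det (Matrix.mat (length (v # qs)) (length (v # qs)) (\<lambda>(i, k). M i k)))\<^sup>2"
  have "gram (map f ps) = D * gram (map f (v # qs))" "gram (map g ps) = D * gram (map g (v # qs))"
    unfolding D_def using gram_map_change[OF len f M] gram_map_change[OF len g M] by blast+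
  moreover have "0 \<le> D" by (simp add: D_def)
  from mult_left_mono[OF gram_Cons_ratio[OF f g le, of v qs] this]
  have "D * gram (map g (v # qs)) * (norm (f v))\<^sup>2 \<le> D * gram (map f (v # qs)) * (norm (g v))\<^sup>2"
    by (simp only: mult.assoc)
  ultimately show ?thesis by (simp only:)
qed (simp add: linear_0[OF f] linear_0[OF g])

lemma det_Ints:
  assumes A: "A \<in> carrier_mat n n" and "\<And>i j. i < n \<Longrightarrow> j < n \<Longrightarrow> A $$ (i, j) \<in> \<int>"
  shows "Determinant.det (A :: real mat) \<in> \<int>"
proof -
  have prod: "(\<Prod>i = 0..<n. A $$ (i, p i)) \<in> \<int>" if p: "p permutes {0..<n}" for p
  proof (rule Ints_prod)
    fix i assume i: "i \<in> {0..<n}"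
    then have "p i \<in> {0..<n}" using permutes_in_image[OF p] by blast
    then show "A $$ (i, p i) \<in> \<int>" using assms(2) i by simp
  qed
  have "Determinant.det A = (\<Sum>p | p permutes {0..<n}. signof p * (\<Prod>i = 0..<n. A $$ (i, p i)))"
    by (rule det_def'[OF A])
  also have "\<dots> \<in> \<int>" using prod by (intro Ints_sum Ints_mult) auto
  finally show ?thesis .
qed

lemma gram_Ints:
  assumes "\<And>u v. u \<in> set vs \<Longrightarrow> v \<in> set vs \<Longrightarrow> u \<bullet> v \<in> \<int>"
  shows "gram vs \<in> \<int>"
  unfolding gram_def
  by (rule det_Ints[OF gram_mat_carrier]) (simp add: gram_mat_def assms)

lemma gram_pos_length:
  fixes vs :: "'a::euclidean_space list"
  assumes "0 < gram vs"
  shows "length vs = dim (set vs)"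
  using assms by (simp add: gram_pos_iff dim_eq_card_independent distinct_card)

lemma gram_snoc_scale:
  fixes vs :: "'a::euclidean_space list"
  shows "gram (vs @ [s *\<^sub>R b]) = s\<^sup>2 * gram (vs @ [b])"
proof -
  obtain y z where yz: "y \<in> span (set vs)" "\<And>w. w \<in> span (set vs) \<Longrightarrow> z \<bullet> w = 0" "b = y + z"
    using orthogonal_subspace_decomp_exists[of "set vs" b] unfolding real_inner_class.orthogonal_def by metis
  have 1: "gram (vs @ [t *\<^sub>R z]) = gram vs * (t *\<^sub>R z \<bullet> t *\<^sub>R z)" for t
    using yz(2) by (intro gram_snoc_orthogonal) (simp add: inner_commute span_base)
  have "gram (vs @ [t *\<^sub>R b]) = gram (vs @ [t *\<^sub>R z])" for t
    using gram_snoc_shear[OF span_scale[OF yz(1), of t], of "t *\<^sub>R z"] by (simp add: yz(3) scaleR_add_right)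
  from this[of s] this[of 1] show ?thesis using 1[of s] 1[of 1] by (simp add: power2_eq_square)
qed

lemma gram_axes:
  assumes "distinct is"
  shows "gram (map (\<lambda>i. c i *\<^sub>R (axis i 1 :: real ^ 'd)) is) = (\<Prod>i\<in>set is. (c i)\<^sup>2)"
  using assms
proof (induction "is" rule: rev_induct)
  case (snoc i js)
  have "gram (map (\<lambda>i. c i *\<^sub>R (axis i 1 :: real ^ 'd)) js @ [c i *\<^sub>R axis i 1])
      = gram (map (\<lambda>i. c i *\<^sub>R (axis i 1 :: real ^ 'd)) js) * ((c i *\<^sub>R (axis i 1 :: real ^ 'd)) \<bullet> (c i *\<^sub>R axis i 1))"
    using snoc.prems by (intro gram_snoc_orthogonal) (auto simp: inner_axis_axis split: if_splits)
  then show ?case using snoc by (simp add: inner_axis_axis power2_eq_square)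
qed simp

section \<open>Diagonal maps on coordinate subspaces\<close>

definition diag_map :: "('d::finite \<Rightarrow> real) \<Rightarrow> real ^ 'd \<Rightarrow> real ^ 'd" where
  "diag_map g v = (\<chi> i. g i * v $ i)"

lemma linear_diag_map: "linear (diag_map g)"
  by (auto simp: linear_iff diag_map_def vec_eq_iff algebra_simps)

lemma norm_diag_map_le:
  assumes "\<And>i. v $ i \<noteq> 0 \<Longrightarrow> \<bar>g i\<bar> \<le> C" "0 \<le> C"
  shows "norm (diag_map g v) \<le> C * norm v"
proof -
  have "norm (diag_map g v) \<le> norm (C *\<^sub>R v)"
  proof (rule norm_le_componentwise_cart)
    fix i show "norm (diag_map g v $ i) \<le> norm ((C *\<^sub>R v) $ i)"
      using assms mult_right_mono[of "\<bar>g i\<bar>" C "\<bar>v $ i\<bar>"]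
      by (cases "v $ i = 0") (auto simp: diag_map_def abs_mult)
  qed
  then show ?thesis using assms(2) by simp
qed

lemma mem_span_axes:
  fixes u :: "real ^ 'd"
  assumes "\<And>i. i \<notin> I \<Longrightarrow> u $ i = 0"
  shows "u \<in> span ((\<lambda>i. axis i 1) ` I)"
proof -
  have "u = (\<Sum>i\<in>UNIV. u $ i *\<^sub>R axis i 1)"
    using basis_expansion[of u] by (simp add: scalar_mult_eq_scaleR)
  also have "\<dots> = (\<Sum>i\<in>I. u $ i *\<^sub>R axis i 1)" using assms by (intro sum.mono_neutral_right) auto
  also have "\<dots> \<in> span ((\<lambda>i. axis i 1) ` I)" by (intro span_sum span_scale span_base) auto
  finally show ?thesis .
qed

lemma dim_axes: "dim ((\<lambda>i. axis i (1::real)) ` I :: (real ^ 'd) set) = card I"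
proof -
  obtain js where js: "set js = I" "distinct js" using finite_distinct_list[of I] by auto
  have "0 < gram (map (\<lambda>i. 1 *\<^sub>R (axis i 1 :: real ^ 'd)) js)" unfolding gram_axes[OF js(2)] by simp
  from gram_pos_length[OF this] show ?thesis using js distinct_card[OF js(2)] by simp
qed

lemma gram_pos_length_le_card:
  fixes us :: "(real ^ 'd) list"
  assumes "\<And>u i. u \<in> set us \<Longrightarrow> i \<notin> I \<Longrightarrow> u $ i = 0" "0 < gram us"
  shows "length us \<le> card I"
proof -
  have "dim (set us) \<le> dim ((\<lambda>i. axis i (1::real)) ` I :: (real ^ 'd) set)"
    using assms(1) mem_span_axes by (intro dim_mono) blast
  then show ?thesis using assms(2) by (simp add: dim_axes gram_pos_length)
qed

text \<open>Complete the list by orthonormal vectors to a basis of the coordinate subspace of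
  \<open>I\<close>. In full rank the distortion is exactly the product of the entries, and each
  added vector multiplies the Gram determinant of the image by at most \<open>G^2\<close>; hence the
  induction on the missing rank.\<close>

lemma gram_diag_map_ge:
  fixes us :: "(real ^ 'd) list"
  assumes "\<And>u i. u \<in> set us \<Longrightarrow> i \<notin> I \<Longrightarrow> u $ i = 0" and g: "\<And>i. i \<in> I \<Longrightarrow> 0 < g i \<and> g i \<le> G"
    and "0 < gram us" and G: "0 \<le> G"
  shows "gram us * (\<Prod>i\<in>I. g i)\<^sup>2 \<le> gram (map (diag_map g) us) * G ^ (2 * (card I - length us))"
  using assms(1,3)
proof (induction "card I - length us" arbitrary: us)
  let ?T = "(\<lambda>i. axis i (1::real)) ` I :: (real ^ 'd) set"
  note mem = mem_span_axes[of I] and dimT = dim_axes[of I]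
  {
    case 0
    have len: "length us = card I" using 0 gram_pos_length_le_card[of us I] by simp
    obtain js where js: "set js = I" "distinct js" using finite_distinct_list[of I] by auto
    let ?ax = "map (\<lambda>i. axis i (1::real)) js :: (real ^ 'd) list"
    have len': "length us = length ?ax" using len js distinct_card by fastforce
    have M: "us ! i = (\<Sum>k<length ?ax. (us ! i $ (js ! k)) *\<^sub>R ?ax ! k)" if "i < length us" for i
    proof -
      have "us ! i = (\<Sum>i'\<in>UNIV. us ! i $ i' *\<^sub>R axis i' 1)"
        using basis_expansion[of "us ! i"] by (simp add: scalar_mult_eq_scaleR)
      also have "\<dots> = (\<Sum>i'\<in>set js. us ! i $ i' *\<^sub>R axis i' 1)"
        using 0(2)[OF nth_mem[OF that]] js by (intro sum.mono_neutral_right) auto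
      also have "\<dots> = (\<Sum>k<length js. us ! i $ (js ! k) *\<^sub>R axis (js ! k) 1)"
        using js(2) by (simp add: sum.distinct_set_conv_list sum_list_sum_nth atLeast0LessThan)
      finally show ?thesis by simp
    qed
    have ax: "gram ?ax = 1" using gram_axes[OF js(2), of "\<lambda>_. 1"] by simp
    have "map (diag_map g) ?ax = map (\<lambda>i. g i *\<^sub>R axis i 1) js"
      by (auto simp: diag_map_def vec_eq_iff axis_def)
    then have "gram (map (diag_map g) ?ax) = (\<Prod>i\<in>I. (g i)\<^sup>2)"
      using gram_axes[OF js(2), of g] js by (simp only:)
    then show ?case
      using gram_change[OF len' M] gram_map_change[OF len' linear_diag_map[of g] M] ax len
      by (simp add: prod_power_distrib)
  next
    case (Suc n)
    have "dim (set us) < dim ?T" using Suc dimT gram_pos_length[of us] by simp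
    moreover have sub: "set us \<subseteq> span ?T" using Suc.prems mem by auto
    ultimately have "span (set us) \<subset> span ?T" by (metis dim_span less_irrefl psubsetI span_minimal subspace_span)
    then obtain c where c: "c \<noteq> 0" "c \<in> span ?T" "\<And>y. y \<in> span (set us) \<Longrightarrow> y \<bullet> c = 0"
      using orthogonal_to_subspace_exists_gen[of "set us" ?T] unfolding real_inner_class.orthogonal_def
      by (metis inner_commute)
    define b where "b = c /\<^sub>R norm c"
    have b: "norm b = 1" "b \<in> span ?T" "\<And>y. y \<in> span (set us) \<Longrightarrow> y \<bullet> b = 0"
      using c by (auto simp: b_def span_scale)
    have "subspace {x :: real ^ 'd. \<forall>i. i \<notin> I \<longrightarrow> x $ i = 0}" by (auto simp: subspace_def)
    then have "span ?T \<subseteq> {x. \<forall>i. i \<notin> I \<longrightarrow> x $ i = 0}" by (intro span_minimal) (auto simp: axis_def)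
    then have bI: "b $ i = 0" if "i \<notin> I" for i using b(2) that by auto
    have gr: "gram (us @ [b]) = gram us" using b by (simp add: gram_snoc_orthogonal span_base power2_norm_eq_inner[symmetric])
    have "gram (us @ [b]) * (\<Prod>i\<in>I. g i)\<^sup>2 \<le> gram (map (diag_map g) (us @ [b])) * G ^ (2 * (card I - length (us @ [b])))"
      using Suc bI gr by (intro Suc(1)) auto
    moreover have "gram (map (diag_map g) (us @ [b])) \<le> gram (map (diag_map g) us) * G\<^sup>2"
    proof -
      have "infdist (diag_map g b) (span (set (map (diag_map g) us))) \<le> norm (diag_map g b)"
        using infdist_le[OF span_zero, of "diag_map g b"] by simp
      also have "\<dots> \<le> G * norm b" using g bI G by (intro norm_diag_map_le) (metis abs_of_pos, simp)
      finally have "(infdist (diag_map g b) (span (set (map (diag_map g) us))))\<^sup>2 \<le> G\<^sup>2"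
        using b(1) by (intro power_mono infdist_nonneg) simp
      then show ?thesis using gram_nonneg[of "map (diag_map g) us"]
        by (simp add: gram_snoc mult_left_mono)
    qed
    ultimately have "gram us * (\<Prod>i\<in>I. g i)\<^sup>2 \<le> gram (map (diag_map g) us) * G\<^sup>2 * G ^ (2 * (card I - length (us @ [b])))"
      using gr mult_right_mono[of "gram (map (diag_map g) (us @ [b]))" _ "G ^ (2 * (card I - length (us @ [b])))"] G
      by fastforce
    moreover have "card I - length us = Suc (card I - length (us @ [b]))" using Suc(2) by simp
    ultimately show ?case by (simp add: mult.assoc power_add[symmetric])
  }
qed

section \<open>Primitive sublattices\<close>

text \<open>Integral inner products encode discreteness: Gram determinants of lattice vectors are
  integers, so a positive one is at least 1 and minimal ones exist.\<close>

locale int_lattice =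
  fixes Z :: "'a::euclidean_space set"
  assumes zero_mem: "0 \<in> Z"
    and diff_mem: "\<And>u v. u \<in> Z \<Longrightarrow> v \<in> Z \<Longrightarrow> u - v \<in> Z"
    and inner_Ints: "\<And>u v. u \<in> Z \<Longrightarrow> v \<in> Z \<Longrightarrow> u \<bullet> v \<in> \<int>"
begin

lemma uminus_mem: "u \<in> Z \<Longrightarrow> - u \<in> Z"
  using diff_mem[OF zero_mem] by simp

lemma add_mem: "u \<in> Z \<Longrightarrow> v \<in> Z \<Longrightarrow> u + v \<in> Z"
  using diff_mem[OF _ uminus_mem] by simp

lemma scale_nat_mem: "u \<in> Z \<Longrightarrow> real n *\<^sub>R u \<in> Z"
  by (induction n) (auto simp: zero_mem add_mem scaleR_add_left)

lemma scale_int_mem: "u \<in> Z \<Longrightarrow> real_of_int k *\<^sub>R u \<in> Z"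
  by (cases k rule: int_cases2) (auto simp: scale_nat_mem uminus_mem)

lemma sum_mem: "(\<And>i. i \<in> A \<Longrightarrow> f i \<in> Z) \<Longrightarrow> sum f A \<in> Z"
  by (induction A rule: infinite_finite_induct) (auto simp: zero_mem add_mem)

lemma int_comb_mem: "set vs \<subseteq> Z \<Longrightarrow> (\<Sum>i<length vs. real_of_int (c i) *\<^sub>R vs ! i) \<in> Z"
  by (intro sum_mem scale_int_mem) auto

lemma gram_ge_1:
  assumes "set vs \<subseteq> Z" "0 < gram vs"
  shows "1 \<le> gram vs"
proof -
  have "gram vs \<in> \<int>" using assms(1) by (intro gram_Ints) (auto intro: inner_Ints)
  then obtain k where "gram vs = of_int k" by (elim Ints_cases)
  then show ?thesis using assms(2) by simp
qed

lemma norm_diff_ge_1: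
  assumes "u \<in> Z" "v \<in> Z" "u \<noteq> v"
  shows "1 \<le> norm (u - v)"
proof -
  have "1 \<le> gram [u - v]"
    using assms by (intro gram_ge_1) (auto simp: diff_mem gram_singleton)
  then show ?thesis using abs_square_less_1[of "norm (u - v)"] by (simp add: gram_singleton not_less[symmetric])
qed

lemma finite_bounded: "finite {u \<in> Z. norm u \<le> B}"
proof (rule ccontr)
  let ?S = "{u \<in> Z. norm u \<le> B}"
  assume "infinite ?S"
  moreover have "bounded ?S" by (auto simp: bounded_iff)
  ultimately obtain l where "l islimpt ?S" using bounded_infinite_imp_islimpt by blast
  then have "infinite (?S \<inter> ball l (1/2))" by (simp add: islimpt_eq_infinite_ball)
  then obtain u where u: "u \<in> ?S \<inter> ball l (1/2)" by (metis ex_in_conv finite.emptyI)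
  have "infinite (?S \<inter> ball l (1/2) - {u})" using \<open>infinite (?S \<inter> ball l (1/2))\<close> by simp
  then obtain v where "v \<in> ?S \<inter> ball l (1/2) - {u}" by (metis ex_in_conv finite.emptyI)
  with u have "u \<in> ?S \<inter> ball l (1/2)" "v \<in> ?S \<inter> ball l (1/2)" "u \<noteq> v" by auto
  then show False using norm_diff_ge_1[of u v] dist_triangle_half_r[of l u 1 v]
    by (auto simp: dist_norm norm_minus_commute)
qed

text \<open>A primitive sublattice is represented by one of its ordered integer bases. Two bases of
  the same sublattice are recognised by their real span and have equal volumes
  (\<open>prim_gram_eq\<close>).\<close>

definition prim :: "'a list \<Rightarrow> bool" where
  "prim vs \<longleftrightarrow> set vs \<subseteq> Z \<and> 0 < gram vs \<and>
     (\<forall>v\<in>Z \<inter> span (set vs). \<exists>c::nat \<Rightarrow> int. v = (\<Sum>i<length vs. real_of_int (c i) *\<^sub>R vs ! i))"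

lemma prim_Nil: "prim []" by (simp add: prim_def)

text \<open>Take \<open>b\<close> of least positive height among the lattice vectors of the larger
  span. A nonzero fractional coefficient along \<open>b\<close> would produce a lattice vector of
  smaller positive height.\<close>

lemma prim_extend:
  assumes as: "prim as" and v: "v \<in> Z" "v \<notin> span (set as)"
  shows "\<exists>b. prim (as @ [b]) \<and> span (set (as @ [b])) = span (insert v (set as))"
proof -
  let ?C = "\<lambda>b. b \<in> Z \<and> b \<in> span (insert v (set as)) \<and> b \<notin> span (set as)"
  have int: "gram (as @ [b]) = real (nat \<lfloor>gram (as @ [b])\<rfloor>)" if "?C b" for b
  proof -
    have "gram (as @ [b]) \<in> \<int>"
      using as that by (intro gram_Ints) (auto intro!: inner_Ints simp: prim_def)
    then show ?thesis using gram_nonneg[of "as @ [b]"] by (auto elim: Ints_cases)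
  qed
  have "?C v" using v by (auto intro: span_base)
  then obtain b where b: "?C b" and least: "\<And>b'. ?C b' \<Longrightarrow> nat \<lfloor>gram (as @ [b])\<rfloor> \<le> nat \<lfloor>gram (as @ [b'])\<rfloor>"
    using ex_has_least_nat[of ?C v "\<lambda>b. nat \<lfloor>gram (as @ [b])\<rfloor>"] by blast
  have min: "gram (as @ [b]) \<le> gram (as @ [b'])" if "?C b'" for b'
    using least[OF that] int[OF b] int[OF that] by linarith
  have span: "span (insert b (set as)) = span (insert v (set as))"
  proof (rule subset_antisym)
    show "span (insert b (set as)) \<subseteq> span (insert v (set as))"
      using b by (intro span_minimal) (auto intro: span_base)
    have "v \<in> span (insert b (set as))" using b in_span_insert[of b v "set as"] by simp
    then show "span (insert v (set as)) \<subseteq> span (insert b (set as))"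
      by (intro span_minimal) (auto intro: span_base)
  qed
  have pos: "0 < gram (as @ [b])" using as b by (simp add: gram_snoc_pos_iff prim_def)
  have "\<exists>c::nat \<Rightarrow> int. u = (\<Sum>i<length (as @ [b]). real_of_int (c i) *\<^sub>R (as @ [b]) ! i)"
    if u: "u \<in> Z" "u \<in> span (insert b (set as))" for u
  proof -
    obtain t where t: "u - t *\<^sub>R b \<in> span (set as)" using u(2) span_breakdown_eq by blast
    define u' where "u' = u - real_of_int \<lfloor>t\<rfloor> *\<^sub>R b"
    have u': "u' \<in> Z" using u(1) b by (simp add: u'_def diff_mem scale_int_mem)
    have eq: "u' = (u - t *\<^sub>R b) + frac t *\<^sub>R b" by (simp add: u'_def frac_def algebra_simps)
    have "frac t = 0"
    proof (rule ccontr)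
      assume t0: "frac t \<noteq> 0"
      have "u' \<notin> span (set as)"
      proof
        assume "u' \<in> span (set as)"
        then have "frac t *\<^sub>R b \<in> span (set as)" using t eq by (metis span_diff add_diff_cancel_left')
        then have "inverse (frac t) *\<^sub>R frac t *\<^sub>R b \<in> span (set as)" by (rule span_scale)
        then show False using t0 b by simp
      qed
      moreover have "u' \<in> span (insert v (set as))"
        unfolding u'_def span[symmetric] using u(2) by (intro span_diff span_scale) (auto intro: span_base)
      ultimately have "gram (as @ [b]) \<le> gram (as @ [u'])" using u' by (intro min) auto
      also have "\<dots> = (frac t)\<^sup>2 * gram (as @ [b])"
        unfolding eq gram_snoc_shear[OF t] by (rule gram_snoc_scale)
      finally have "1 \<le> (frac t)\<^sup>2" using pos by simp
      moreover have "(frac t)\<^sup>2 < 1" using frac_lt_1[of t] by (simp add: abs_square_less_1)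
      ultimately show False by simp
    qed
    then have "u' = u - t *\<^sub>R b" using eq by (metis add.right_neutral scale_zero_left)
    then have "u' \<in> Z \<inter> span (set as)" using u' t by simp
    then obtain c where c: "u' = (\<Sum>i<length as. real_of_int (c i) *\<^sub>R as ! i)"
      using as unfolding prim_def by blast
    have "u = (\<Sum>i<length (as @ [b]). real_of_int ((c(length as := \<lfloor>t\<rfloor>)) i) *\<^sub>R (as @ [b]) ! i)"
      using c by (simp add: nth_append u'_def algebra_simps)
    then show ?thesis by blast
  qed
  then have "prim (as @ [b])" using as b pos by (auto simp: prim_def)
  then show ?thesis using span by auto
qed

lemma prim_span_extend:
  assumes "prim cs" "set us \<subseteq> Z"
  shows "\<exists>bs. prim (cs @ bs) \<and> span (set (cs @ bs)) = span (set cs \<union> set us)"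
  using assms(2)
proof (induction us rule: rev_induct)
  case (snoc u us)
  then obtain bs where bs: "prim (cs @ bs)" "span (set (cs @ bs)) = span (set cs \<union> set us)" by auto
  have ins: "span (insert u (set (cs @ bs))) = span (set cs \<union> set (us @ [u]))"
    using bs(2) span_Un[of "{u}" "set (cs @ bs)"] span_Un[of "{u}" "set cs \<union> set us"] by simp
  show ?case
  proof (cases "u \<in> span (set (cs @ bs))")
    case True
    then show ?thesis using bs ins by (metis span_redundant)
  next
    case False
    then obtain b where "prim ((cs @ bs) @ [b])" "span (set ((cs @ bs) @ [b])) = span (insert u (set (cs @ bs)))"
      using prim_extend[OF bs(1), of u] snoc.prems by auto
    then show ?thesis using ins by (intro exI[of _ "bs @ [b]"]) auto
  qed
qed (use assms in \<open>auto intro: exI[of _ "[]"]\<close>)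

text \<open>The other list is obtained from \<open>as\<close> by an integer matrix with nonzero
  determinant, whose square is at least 1.\<close>

lemma prim_gram_le:
  fixes f :: "'a \<Rightarrow> 'b::euclidean_space"
  assumes as: "prim as" and vs: "set vs \<subseteq> Z" "0 < gram vs" "span (set vs) = span (set as)"
    and f: "linear f"
  shows "gram (map f as) \<le> gram (map f vs)"
proof -
  have len: "length vs = length as"
    using gram_pos_length[of vs] gram_pos_length[of as] as vs by (metis dim_span prim_def)
  have "\<forall>i<length vs. \<exists>c::nat \<Rightarrow> int. vs ! i = (\<Sum>k<length as. real_of_int (c k) *\<^sub>R as ! k)"
  proof (intro allI impI)
    fix i assume "i < length vs"
    then have "vs ! i \<in> Z \<inter> span (set as)" using vs by (metis IntI nth_mem span_base subsetD)
    then show "\<exists>c::nat \<Rightarrow> int. vs ! i = (\<Sum>k<length as. real_of_int (c k) *\<^sub>R as ! k)"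
      using as unfolding prim_def by blast
  qed
  then obtain c where c: "\<And>i. i < length vs \<Longrightarrow> vs ! i = (\<Sum>k<length as. real_of_int (c i k) *\<^sub>R as ! k)"
    by metis
  define D where "D = Determinant.det (Matrix.mat (length as) (length as) (\<lambda>(i, k). real_of_int (c i k)))"
  have D: "gram vs = D\<^sup>2 * gram as" "gram (map f vs) = D\<^sup>2 * gram (map f as)"
    unfolding D_def using gram_change[OF len c] gram_map_change[OF len f c] by auto
  have "D \<in> \<int>" unfolding D_def by (rule det_Ints) auto
  moreover have "D \<noteq> 0" using D(1) vs(2) by auto
  ultimately have "1 \<le> D\<^sup>2" by (auto elim!: Ints_cases simp: power2_eq_square) (metis of_int_1_le_iff of_int_mult int_one_le_iff_zero_less not_square_less_zero mult_eq_0_iff linorder_neqE zero_less_mult_iff)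
  then show ?thesis using D(2) gram_nonneg[of "map f as"] mult_right_mono[of 1 "D\<^sup>2" "gram (map f as)"] by simp
qed

lemma prim_gram_eq:
  fixes f :: "'a \<Rightarrow> 'b::euclidean_space"
  assumes "prim as" "prim bs" "span (set as) = span (set bs)" "linear f"
  shows "gram (map f as) = gram (map f bs)"
  using assms by (intro antisym prim_gram_le) (auto simp: prim_def)

text \<open>Dirichlet's pigeonhole: the multiples of \<open>v\<close>, reduced by integer
  combinations of the list, are lattice vectors in a bounded set, so two of them coincide.\<close>

lemma span_int_multiple:
  assumes vs: "set vs \<subseteq> Z" and v: "v \<in> Z" "v \<in> span (set vs)"
  shows "\<exists>N>0. \<exists>c::nat \<Rightarrow> int. real N *\<^sub>R v = (\<Sum>i<length vs. real_of_int (c i) *\<^sub>R vs ! i)"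
proof -
  obtain t where t: "v = (\<Sum>i<length vs. t i *\<^sub>R vs ! i)" using span_list_coeffs[OF v(2)] by blast
  define g where "g N = real N *\<^sub>R v - (\<Sum>i<length vs. real_of_int \<lfloor>real N * t i\<rfloor> *\<^sub>R vs ! i)" for N :: nat
  have g: "g N = (\<Sum>i<length vs. frac (real N * t i) *\<^sub>R vs ! i)" for N
    unfolding g_def t by (simp add: frac_def scaleR_sum_right sum_subtractf algebra_simps)
  have "norm (g N) \<le> (\<Sum>i<length vs. norm (vs ! i))" for N
    unfolding g
  proof (rule order_trans[OF norm_sum sum_mono])
    fix i show "norm (frac (real N * t i) *\<^sub>R vs ! i) \<le> norm (vs ! i)"
      using frac_lt_1[of "real N * t i"] mult_right_mono[of "frac (real N * t i)" 1 "norm (vs ! i)"] by simp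
  qed
  moreover have "g N \<in> Z" for N
    unfolding g_def by (intro diff_mem scale_nat_mem v int_comb_mem vs)
  ultimately have "range g \<subseteq> {u \<in> Z. norm u \<le> (\<Sum>i<length vs. norm (vs ! i))}" by auto
  then have "finite (range g)" using finite_bounded finite_subset by blast
  then have "\<not> inj g" using finite_imageD infinite_UNIV_nat by blast
  then obtain M N where "g M = g N" "M < N" unfolding inj_def by (metis linorder_neqE_nat)
  then have "real (N - M) *\<^sub>R v = (\<Sum>i<length vs. real_of_int (\<lfloor>real N * t i\<rfloor> - \<lfloor>real M * t i\<rfloor>) *\<^sub>R vs ! i)"
    unfolding g_def by (simp add: of_nat_diff scaleR_diff_left sum_subtractf algebra_simps)
  then show ?thesis using \<open>M < N\<close> by (intro exI[of _ "N - M"]) (auto intro!: exI[of _ "\<lambda>i. \<lfloor>real N * t i\<rfloor> - \<lfloor>real M * t i\<rfloor>"])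
qed

text \<open>The meet \<open>cs\<close> is a longest primitive list inside both spans and is extended
  to bases \<open>cs @ es\<close> and \<open>cs @ fs\<close>. The volume inequality is then
  \<open>gram_submodular\<close>; the work lies in the independence of \<open>cs @ es @ fs\<close>,
  that is, in showing that the real spans intersect no further than the lattices do.\<close>

lemma prim_meet_join:
  assumes as: "prim as" and bs: "prim bs"
  shows "\<exists>cs ps. prim cs \<and> prim ps \<and> set cs \<subseteq> span (set as) \<inter> span (set bs) \<and>
    set as \<union> set bs \<subseteq> span (set ps) \<and> length cs + length ps = length as + length bs \<and>
    (length cs = length as \<and> length cs = length bs \<longrightarrow> span (set as) = span (set bs)) \<and>
    (\<forall>f :: 'a \<Rightarrow> 'b::euclidean_space. linear f \<longrightarrow>
      gram (map f ps) * gram (map f cs) \<le> gram (map f as) * gram (map f bs))"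
proof -
  let ?E = "span (set as)" and ?F = "span (set bs)"
  let ?C = "\<lambda>cs. prim cs \<and> set cs \<subseteq> ?E \<inter> ?F"
  have "\<forall>cs. ?C cs \<longrightarrow> length cs < Suc (DIM('a))"
    using gram_pos_length dim_subset_UNIV by (metis less_Suc_eq_le prim_def)
  then obtain cs where cs: "?C cs" and max: "\<And>cs'. ?C cs' \<Longrightarrow> length cs' \<le> length cs"
    using ex_has_greatest_nat[of ?C "[]" length "Suc (DIM('a))"] prim_Nil by auto
  have full: "v \<in> span (set cs)" if v: "v \<in> Z" "v \<in> ?E" "v \<in> ?F" for v
  proof (rule ccontr)
    assume "v \<notin> span (set cs)"
    then obtain b where b: "prim (cs @ [b])" "span (set (cs @ [b])) = span (insert v (set cs))"
      using prim_extend[of cs v] cs v(1) by blast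
    have "span (insert v (set cs)) \<subseteq> ?E" "span (insert v (set cs)) \<subseteq> ?F"
      using v cs by (intro span_minimal; auto)+
    then have "?C (cs @ [b])" using b span_superset[of "set (cs @ [b])"] by auto
    from max[OF this] show False by simp
  qed
  have "span (set cs \<union> set as) = ?E" "span (set cs \<union> set bs) = ?F"
    using cs by (intro subset_antisym span_minimal span_mono; auto intro: span_base)+
  moreover have "set as \<subseteq> Z" "set bs \<subseteq> Z" using as bs by (auto simp: prim_def)
  ultimately obtain es fs where es: "prim (cs @ es)" "span (set (cs @ es)) = ?E"
    and fs: "prim (cs @ fs)" "span (set (cs @ fs)) = ?F"
    using prim_span_extend[of cs as] prim_span_extend[of cs bs] cs by auto
  have fsF: "set fs \<subseteq> Z \<inter> ?F" using fs span_superset[of "set (cs @ fs)"] by (auto simp: prim_def)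
  have Z: "set (cs @ es) \<subseteq> Z" using es(1) by (simp add: prim_def)
  have "0 < gram (cs @ fs) \<Longrightarrow> set fs \<subseteq> Z \<inter> ?F \<Longrightarrow> 0 < gram (cs @ es @ fs)"
  proof (induction fs rule: rev_induct)
    case Nil
    then show ?case using es(1) by (simp add: prim_def)
  next
    case (snoc c fs)
    have c: "0 < gram (cs @ fs)" "c \<notin> span (set (cs @ fs))" "c \<in> Z" "c \<in> ?F"
      using snoc.prems gram_snoc_pos_iff[of "cs @ fs" c] by auto
    have "c \<notin> span (set (cs @ es @ fs))"
    proof
      let ?v = "cs @ es @ fs" and ?w = "cs @ es"
      \<comment> \<open>An integer multiple of \<open>c\<close> splits into a lattice vector
        \<open>z\<close> from \<open>cs @ es\<close> and a part \<open>y\<close> from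
        \<open>fs\<close>. Then \<open>z\<close> lies in both spans, hence by maximality in the span
        of \<open>cs\<close>, and \<open>c\<close> would depend on \<open>cs @ fs\<close>.\<close>
      assume "c \<in> span (set ?v)"
      then obtain N k where N: "N > 0" and k: "real N *\<^sub>R c = (\<Sum>i<length ?v. real_of_int (k i) *\<^sub>R ?v ! i)"
        using span_int_multiple[of ?v c] Z snoc.prems(2) c(3) by auto
      define z where "z = (\<Sum>i<length ?w. real_of_int (k i) *\<^sub>R ?w ! i)"
      define y where "y = (\<Sum>i<length fs. real_of_int (k (length ?w + i)) *\<^sub>R fs ! i)"
      have split: "{..<length ?v} = {..<length ?w} \<union> {length ?w..<length ?w + length fs}" by auto
      have "real N *\<^sub>R c = (\<Sum>i<length ?w. real_of_int (k i) *\<^sub>R ?v ! i)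
         + (\<Sum>i=length ?w..<length ?w + length fs. real_of_int (k i) *\<^sub>R ?v ! i)"
        unfolding k split by (rule sum.union_disjoint) auto
      also have "(\<Sum>i<length ?w. real_of_int (k i) *\<^sub>R ?v ! i) = z"
        unfolding z_def by (intro sum.cong) (auto simp: nth_append)
      also have "(\<Sum>i=length ?w..<length ?w + length fs. real_of_int (k i) *\<^sub>R ?v ! i) = y"
        unfolding y_def
        by (rule sum.reindex_bij_witness[of _ "\<lambda>i. length ?w + i" "\<lambda>i. i - length ?w"]) (auto simp: nth_append)
      finally have zy: "real N *\<^sub>R c = z + y" .
      have y: "y \<in> span (set fs)" unfolding y_def by (rule sum_list_in_span)
      moreover have "span (set fs) \<subseteq> ?F" using snoc.prems(2) by (intro span_minimal) auto
      ultimately have "z \<in> ?F" using zy c(4) by (metis add_diff_cancel_right' span_diff span_scale subsetD)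
      moreover have "z \<in> ?E" unfolding z_def es(2)[symmetric] by (rule sum_list_in_span)
      moreover have "z \<in> Z" unfolding z_def by (intro int_comb_mem Z)
      ultimately have "z \<in> span (set cs)" by (intro full)
      then have "z \<in> span (set (cs @ fs))" "y \<in> span (set (cs @ fs))"
        using y span_mono[of "set cs" "set (cs @ fs)"] span_mono[of "set fs" "set (cs @ fs)"] by auto
      then have "inverse (real N) *\<^sub>R (z + y) \<in> span (set (cs @ fs))" by (intro span_scale span_add)
      then show False using c(2) N zy[symmetric] by simp
    qed
    then show ?case using gram_snoc_pos_iff[of "cs @ es @ fs" c] snoc c(1) by auto
  qed
  then have pos: "0 < gram (cs @ es @ fs)" using fs(1) fsF by (simp add: prim_def)
  have ZZ: "set (cs @ es @ fs) \<subseteq> Z" using Z fsF by auto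
  obtain ps where ps: "prim ps" "span (set ps) = span (set (cs @ es @ fs))"
    using prim_span_extend[OF prim_Nil ZZ] by auto
  have len: "length (cs @ es) = length as" "length (cs @ fs) = length bs" "length ps = length (cs @ es @ fs)"
    using gram_pos_length es fs as bs ps pos by (metis dim_span prim_def)+
  have "gram (map f ps) * gram (map f cs) \<le> gram (map f as) * gram (map f bs)"
    if f: "linear f" for f :: "'a \<Rightarrow> 'b"
  proof -
    have "gram (map f ps) \<le> gram (map f (cs @ es @ fs))"
      using ps(2) by (intro prim_gram_le ps ZZ pos f) simp
    then have "gram (map f ps) * gram (map f cs) \<le> gram (map f (cs @ es @ fs)) * gram (map f cs)"
      by (intro mult_right_mono gram_nonneg)
    also have "\<dots> \<le> gram (map f (cs @ es)) * gram (map f (cs @ fs))"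
      using gram_submodular[of "map f cs" "map f es" "map f fs"] by simp
    also have "\<dots> = gram (map f as) * gram (map f bs)"
      using prim_gram_eq[OF es(1) as es(2) f] prim_gram_eq[OF fs(1) bs fs(2) f] by simp
    finally show ?thesis .
  qed
  moreover have "set as \<union> set bs \<subseteq> span (set ps)"
  proof -
    have "?E \<subseteq> span (set ps)" "?F \<subseteq> span (set ps)"
      unfolding ps(2) es(2)[symmetric] fs(2)[symmetric] by (intro span_mono; auto)+
    then show ?thesis using span_superset[of "set as"] span_superset[of "set bs"] by blast
  qed
  moreover have "?E = ?F" if "length cs = length as" "length cs = length bs"
    using that len(1,2) es(2) fs(2) by simp
  ultimately show ?thesis using cs ps(1) len by (intro exI[of _ cs] exI[of _ ps]) auto
qed

end

section \<open>Surviving branches of a tree\<close>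

text \<open>Nodes are whole histories with the newest entry first, so that the ancestor
  \<open>h\<close> levels up is obtained by \<open>drop h\<close>.\<close>

primrec survivors :: "('b list \<Rightarrow> 'b set) \<Rightarrow> ('b list \<Rightarrow> bool) \<Rightarrow> 'b \<Rightarrow> nat \<Rightarrow> 'b list set" where
  "survivors Ch good x 0 = {[x]}"
| "survivors Ch good x (Suc m) = {y # xs | xs y. xs \<in> survivors Ch good x m \<and> y \<in> Ch xs \<and> good (y # xs)}"

lemma length_survivors: "xs \<in> survivors Ch good x m \<Longrightarrow> length xs = Suc m"
  by (induction m arbitrary: xs) auto

lemma drop_survivors: "xs \<in> survivors Ch good x (m + h) \<Longrightarrow> drop h xs \<in> survivors Ch good x m"
  by (induction h arbitrary: xs) auto

lemma drop_Cons_survivors: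
  assumes "xs \<in> survivors Ch good x m" "1 \<le> h" "h \<le> Suc m"
  shows "drop h (y # xs) \<in> survivors Ch good x (Suc m - h)"
proof -
  have "xs \<in> survivors Ch good x ((Suc m - h) + (h - 1))" using assms by simp
  from drop_survivors[OF this] show ?thesis using assms(2) by (cases h) auto
qed

text \<open>Each bad child is charged to an ancestor \<open>h\<close> levels up, and an ancestor
  carries at most \<open>(N / 8)^h\<close> charges of that kind. If the number of survivors has
  grown by a factor \<open>N / 2\<close> at every earlier level, the ancestors are so few that the
  charges use up at most half of the children, and the growth continues.\<close>

lemma survivors_nonempty:
  fixes X :: "nat \<Rightarrow> 'b list \<Rightarrow> 'b list set"
  assumes Ch: "\<And>m xs. xs \<in> survivors Ch good x m \<Longrightarrow> finite (Ch xs) \<and> card (Ch xs) = N" and N: "0 < N"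
    and charged: "\<And>m xs y. \<lbrakk>xs \<in> survivors Ch good x m; y \<in> Ch xs; \<not> good (y # xs)\<rbrakk> \<Longrightarrow>
      \<exists>h\<in>{1..Suc m}. y # xs \<in> X h (drop h (y # xs))"
    and X: "\<And>m xs h. \<lbrakk>xs \<in> survivors Ch good x m; 1 \<le> h\<rbrakk> \<Longrightarrow>
      finite (X h xs) \<and> real (card (X h xs)) * 8 ^ h \<le> real N ^ h"
  shows "survivors Ch good x m \<noteq> {}"
proof -
  let ?S = "survivors Ch good x"
  define a where "a m = real (card (?S m))" for m
  have fin: "finite (?S m)" for m
  proof (induction m)
    case (Suc m)
    have "?S (Suc m) \<subseteq> (\<Union>xs\<in>?S m. (\<lambda>y. y # xs) ` Ch xs)" by auto
    then show ?case by (rule finite_subset) (use Suc Ch in auto)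
  qed simp
  have step: "real N * a m \<le> a (Suc m) + (\<Sum>h\<in>{1..Suc m}. a (Suc m - h) * (real N ^ h / 8 ^ h))" for m
  proof -
    let ?A = "\<Union>xs\<in>?S m. (\<lambda>y. y # xs) ` Ch xs"
    let ?U = "\<Union>h\<in>{1..Suc m}. \<Union>ys\<in>?S (Suc m - h). X h ys"
    have "card ?A = (\<Sum>xs\<in>?S m. card ((\<lambda>y. y # xs) ` Ch xs))"
      by (rule card_UN_disjoint) (use fin Ch in auto)
    also have "\<dots> = (\<Sum>xs\<in>?S m. N)"
      using Ch by (intro sum.cong refl) (subst card_image, auto simp: inj_on_def)
    finally have A: "real (card ?A) = real N * a m" by (simp add: a_def)
    have "?A \<subseteq> ?S (Suc m) \<union> ?U"
    proof
      fix zs assume "zs \<in> ?A"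
      then obtain xs y where xs: "xs \<in> ?S m" "y \<in> Ch xs" "zs = y # xs" by auto
      show "zs \<in> ?S (Suc m) \<union> ?U"
      proof (cases "good zs")
        case False
        then obtain h where "h \<in> {1..Suc m}" "zs \<in> X h (drop h zs)" using charged xs by blast
        moreover from this have "drop h zs \<in> ?S (Suc m - h)" using drop_Cons_survivors xs by auto
        ultimately show ?thesis by blast
      qed (use xs in auto)
    qed
    moreover have finX: "finite (X h ys)" if "h \<in> {1..Suc m}" "ys \<in> ?S (Suc m - h)" for h ys
      using X that by auto
    have "finite ?U" using fin finX by blast
    ultimately have "card ?A \<le> card (?S (Suc m) \<union> ?U)" using fin[of "Suc m"] by (intro card_mono finite_UnI)
    also have "\<dots> \<le> card (?S (Suc m)) + card ?U" by (rule card_Un_le)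
    finally have "real (card ?A) \<le> a (Suc m) + real (card ?U)" unfolding a_def by linarith
    then have "real N * a m \<le> a (Suc m) + real (card ?U)" unfolding A .
    also have "real (card ?U) \<le> (\<Sum>h\<in>{1..Suc m}. real (card (\<Union>ys\<in>?S (Suc m - h). X h ys)))"
      using card_UN_le[of "{1..Suc m}" "\<lambda>h. \<Union>ys\<in>?S (Suc m - h). X h ys"]
      by (simp flip: of_nat_sum)
    also have "\<dots> \<le> (\<Sum>h\<in>{1..Suc m}. a (Suc m - h) * (real N ^ h / 8 ^ h))"
    proof (rule sum_mono)
      fix h assume h: "h \<in> {1..Suc m}"
      have "real (card (\<Union>ys\<in>?S (Suc m - h). X h ys)) \<le> (\<Sum>ys\<in>?S (Suc m - h). real (card (X h ys)))"
        using card_UN_le[of "?S (Suc m - h)" "X h"] fin[of "Suc m - h"] by (simp flip: of_nat_sum)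
      also have "\<dots> \<le> (\<Sum>ys\<in>?S (Suc m - h). real N ^ h / 8 ^ h)"
        using X h by (intro sum_mono) (auto simp: field_simps)
      also have "\<dots> = a (Suc m - h) * (real N ^ h / 8 ^ h)" by (simp add: a_def)
      finally show "real (card (\<Union>ys\<in>?S (Suc m - h). X h ys)) \<le> a (Suc m - h) * (real N ^ h / 8 ^ h)" .
    qed
    finally show ?thesis by simp
  qed
  have a0: "0 \<le> a m" for m by (simp add: a_def)
  have grow: "real N * a m \<le> 2 * a (Suc m)" for m
  proof (induction m rule: less_induct)
    case (less m)
    have chain: "a (m - j) * real N ^ j \<le> 2 ^ j * a m" if "j \<le> m" for j
      using that
    proof (induction j)
      case (Suc j)
      have "real N * a (m - Suc j) \<le> 2 * a (m - j)"
        using less[of "m - Suc j"] Suc.prems by (simp add: Suc_diff_Suc)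
      then have "(real N * a (m - Suc j)) * real N ^ j \<le> (2 * a (m - j)) * real N ^ j"
        by (intro mult_right_mono) auto
      also have "\<dots> \<le> 2 * (2 ^ j * a m)" using Suc by simp
      finally show ?case by (simp add: mult_ac)
    qed simp
    \<comment> \<open>The loss \<open>2^(h - 1)\<close> in comparing with earlier levels against the
      gain \<open>8^h\<close> leaves \<open>(1/4)^h / 2\<close>, a geometric series.\<close>
    have "(\<Sum>h\<in>{1..Suc m}. a (Suc m - h) * (real N ^ h / 8 ^ h))
        \<le> (\<Sum>h\<in>{1..Suc m}. (real N * a m / 2) * (1/4) ^ h)"
    proof (rule sum_mono)
      fix h assume "h \<in> {1..Suc m}"
      then obtain j where j: "h = Suc j" "j \<le> m" by (cases h) auto
      have "a (m - j) * real N ^ j * real N \<le> 2 ^ j * a m * real N"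
        using chain[OF j(2)] by (intro mult_right_mono) auto
      then have "a (m - j) * real N ^ j * real N / 8 ^ h \<le> 2 ^ j * a m * real N / 8 ^ h"
        by (intro divide_right_mono) auto
      also have "\<dots> = (real N * a m / 2) * (1/4) ^ h"
        by (simp add: j(1) power_divide field_simps flip: power_mult_distrib)
      finally show "a (Suc m - h) * (real N ^ h / 8 ^ h) \<le> (real N * a m / 2) * (1/4) ^ h"
        by (simp add: j(1) mult_ac)
    qed
    also have "\<dots> = (real N * a m / 2) * (\<Sum>h\<in>{1..Suc m}. (1/4) ^ h)" by (rule sum_distrib_left[symmetric])
    also have "\<dots> \<le> (real N * a m / 2) * 1"
    proof (rule mult_left_mono)
      have "(\<Sum>h\<in>{1..n}. (1/4::real) ^ h) = (1 - (1/4) ^ n) / 3" for n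
      proof (induction n)
        case (Suc n)
        have "(1/4::real) ^ Suc n = (1/4) ^ n / 4" by simp
        moreover have "(\<Sum>h\<in>{1..Suc n}. (1/4::real) ^ h) = (\<Sum>h\<in>{1..n}. (1/4) ^ h) + (1/4) ^ Suc n"
          by (subst sum.cl_ivl_Suc) auto
        moreover have "(1 - x) / 3 + x / 4 = (1 - x / 4) / 3" for x :: real by (simp add: field_simps)
        ultimately show ?case using Suc.IH by (simp only:)
      qed simp
      moreover have "(1 - z) / 3 \<le> 1" if "0 \<le> z" for z :: real using that by simp
      ultimately show "(\<Sum>h\<in>{1..Suc m}. (1/4::real) ^ h) \<le> 1"
        by (metis zero_le_divide_1_iff zero_le_numeral zero_le_power)
    qed (use a0 in simp)
    finally have "2 * (\<Sum>h\<in>{1..Suc m}. a (Suc m - h) * (real N ^ h / 8 ^ h)) \<le> real N * a m"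
      by (simp only: mult_1_right)
    moreover have "x \<le> 2 * s" if "2 * t \<le> x" "x \<le> s + t" for x s t :: real using that by linarith
    ultimately show ?case using step[of m] by blast
  qed
  have "0 < a m"
  proof (induction m)
    case (Suc m)
    then have "0 < real N * a m" using N by simp
    then show ?case using grow[of m] by simp
  qed (simp add: a_def)
  then show ?thesis unfolding a_def by auto
qed

section \<open>Regular decaying measures\<close>

text \<open>By second countability the complement is a countable union of null basic open
  sets.\<close>

lemma emeasure_compl_msupp:
  fixes \<mu> :: "'a::euclidean_space measure"
  assumes "sets \<mu> = sets borel"
  shows "emeasure \<mu> (- msupp \<mu>) = 0"
proof -
  obtain B :: "'a set set" where B: "countable B" "topological_basis B"
    using ex_countable_basis by blast
  let ?N = "{b \<in> B. emeasure \<mu> b = 0}"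
  have op: "open b" if "b \<in> B" for b using that B(2) topological_basis_open by blast
  have "- msupp \<mu> = \<Union>?N"
  proof (intro subset_antisym subsetI)
    fix x assume "x \<in> - msupp \<mu>"
    then obtain U where U: "open U" "x \<in> U" "emeasure \<mu> U = 0" by (auto simp: msupp_def)
    then obtain b where b: "b \<in> B" "x \<in> b" "b \<subseteq> U" using B(2) by (meson topological_basisE)
    have "emeasure \<mu> b \<le> emeasure \<mu> U" using U b assms by (intro emeasure_mono) auto
    then show "x \<in> \<Union>?N" using U b by auto
  next
    fix x assume "x \<in> \<Union>?N"
    then obtain b where "b \<in> B" "emeasure \<mu> b = 0" "x \<in> b" by auto
    then show "x \<in> - msupp \<mu>" using op[of b] by (auto simp: msupp_def)
  qed
  moreover have "emeasure \<mu> (\<Union>?N) = 0"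
  proof -
    have "(\<Union>b\<in>?N. b) \<in> null_sets \<mu>"
      using B(1) op assms by (intro null_sets_UN') (auto intro!: null_setsI)
    then show ?thesis by (simp add: null_sets_def)
  qed
  ultimately show ?thesis by simp
qed

lemma msupp_nonempty:
  fixes \<mu> :: "'a::euclidean_space measure"
  assumes "sets \<mu> = sets borel" "emeasure \<mu> UNIV \<noteq> 0"
  shows "msupp \<mu> \<noteq> {}"
  using emeasure_compl_msupp[OF assms(1)] assms(2) by (auto simp: Compl_eq_Diff_UNIV)

locale regular_measure =
  fixes \<mu> :: "'a::euclidean_space measure" and \<alpha> A \<rho> :: real
  assumes borel: "sets \<mu> = sets borel" and pos: "0 < \<alpha>" "0 < A" "0 < \<rho>"
    and lower: "\<And>x r. \<lbrakk>x \<in> msupp \<mu>; 0 < r; r \<le> \<rho>\<rbrakk> \<Longrightarrow> ennreal (inverse A * r powr \<alpha>) \<le> emeasure \<mu> (cball x r)"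
    and upper: "\<And>x r. \<lbrakk>x \<in> msupp \<mu>; 0 < r; r \<le> \<rho>\<rbrakk> \<Longrightarrow> emeasure \<mu> (cball x r) \<le> ennreal (A * r powr \<alpha>)"
begin

lemma emeasure_Un_sum_le:
  assumes "finite T" "T \<subseteq> msupp \<mu>" "0 < s" "s \<le> \<rho>"
  shows "emeasure \<mu> (\<Union>y\<in>T. cball y s) \<le> ennreal (real (card T) * (A * s powr \<alpha>))"
proof -
  have "emeasure \<mu> (\<Union>y\<in>T. cball y s) \<le> (\<Sum>y\<in>T. emeasure \<mu> (cball y s))"
    by (rule emeasure_subadditive_finite) (use assms borel in auto)
  also have "\<dots> \<le> (\<Sum>y\<in>T. ennreal (A * s powr \<alpha>))"
    using assms by (intro sum_mono upper) auto
  also have "\<dots> = ennreal (real (card T) * (A * s powr \<alpha>))"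
    using pos by (simp add: ennreal_mult ennreal_of_nat_eq_real_of_nat)
  finally show ?thesis .
qed

text \<open>Greedy choice: as long as too few points are chosen, the two regularity bounds show that
  their \<open>s\<close>-balls cannot cover the part of the support in the ball.\<close>

lemma separated_points:
  assumes x: "x \<in> msupp \<mu>" and r: "0 < r" "r \<le> \<rho>" and s: "0 < s" "s \<le> \<rho>"
    and n: "real n \<le> inverse (A\<^sup>2) * (r / s) powr \<alpha>"
  shows "\<exists>T. finite T \<and> card T = n \<and> T \<subseteq> msupp \<mu> \<inter> cball x r \<and> (\<forall>y\<in>T. \<forall>z\<in>T. y \<noteq> z \<longrightarrow> s < dist y z)"
  using n
proof (induction n)
  case (Suc k)
  then obtain T where T: "finite T" "card T = k" "T \<subseteq> msupp \<mu> \<inter> cball x r"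
    "\<And>y z. y \<in> T \<Longrightarrow> z \<in> T \<Longrightarrow> y \<noteq> z \<Longrightarrow> s < dist y z" by auto
  have "\<not> msupp \<mu> \<inter> cball x r \<subseteq> (\<Union>y\<in>T. cball y s)"
  proof
    assume sub: "msupp \<mu> \<inter> cball x r \<subseteq> (\<Union>y\<in>T. cball y s)"
    have cl: "- msupp \<mu> \<in> null_sets \<mu>"
    proof -
      have "open (- msupp \<mu>)"
      proof (subst open_subopen, intro ballI)
        fix x assume "x \<in> - msupp \<mu>"
        then obtain U where U: "open U" "x \<in> U" "\<not> 0 < emeasure \<mu> U" unfolding msupp_def by blast
        then have "U \<subseteq> - msupp \<mu>" unfolding msupp_def by blast
        then show "\<exists>T. open T \<and> x \<in> T \<and> T \<subseteq> - msupp \<mu>" using U by blast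
      qed
      then have "- msupp \<mu> \<in> sets \<mu>" unfolding borel by (rule borel_open)
      then show ?thesis using emeasure_compl_msupp[OF borel] by (rule null_setsI[rotated])
    qed
    have Un: "(\<Union>y\<in>T. cball y s) \<in> sets \<mu>" unfolding borel using T(1) by (intro sets.finite_UN) auto
    have "ennreal (inverse A * r powr \<alpha>) \<le> emeasure \<mu> (cball x r)" using lower x r by blast
    also have "\<dots> \<le> emeasure \<mu> ((\<Union>y\<in>T. cball y s) \<union> - msupp \<mu>)"
      using sub by (intro emeasure_mono sets.Un Un null_setsD2[OF cl]) blast
    also have "\<dots> = emeasure \<mu> (\<Union>y\<in>T. cball y s)"
      by (rule emeasure_Un_null_set[OF Un cl])
    also have "\<dots> \<le> ennreal (real k * (A * s powr \<alpha>))"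
      using emeasure_Un_sum_le[of T s] T s by auto
    finally have "inverse A * r powr \<alpha> \<le> real k * (A * s powr \<alpha>)"
      using pos by (subst (asm) ennreal_le_iff) auto
    then have "inverse (A\<^sup>2) * (r / s) powr \<alpha> \<le> real k"
      using pos s r by (simp add: powr_divide field_simps power2_eq_square)
    then show False using Suc.prems by simp
  qed
  then obtain z where z: "z \<in> msupp \<mu>" "z \<in> cball x r" "\<And>y. y \<in> T \<Longrightarrow> s < dist y z" by force
  then have "z \<notin> T" using s(1) by (metis dist_self not_less_iff_gr_or_eq)
  then show ?case using T z
    by (intro exI[of _ "insert z T"]) (auto simp: dist_commute)
qed auto

lemma card_disjoint_balls_le:
  assumes T: "finite T" "T \<subseteq> msupp \<mu>" and s: "0 < s" "s \<le> \<rho>"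
    and sep: "\<And>y z. \<lbrakk>y \<in> T; z \<in> T; y \<noteq> z\<rbrakk> \<Longrightarrow> cball y s \<inter> cball z s = {}"
    and W: "W \<in> sets borel" "\<And>y. y \<in> T \<Longrightarrow> cball y s \<subseteq> W" "emeasure \<mu> W \<le> ennreal v" "0 \<le> v"
  shows "real (card T) * (inverse A * s powr \<alpha>) \<le> v"
proof -
  have "ennreal (real (card T) * (inverse A * s powr \<alpha>)) = (\<Sum>y\<in>T. ennreal (inverse A * s powr \<alpha>))"
    using pos by (simp add: ennreal_mult ennreal_of_nat_eq_real_of_nat)
  also have "\<dots> \<le> (\<Sum>y\<in>T. emeasure \<mu> (cball y s))"
    using T s by (intro sum_mono lower) auto
  also have "\<dots> = emeasure \<mu> (\<Union>y\<in>T. cball y s)"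
    using T sep borel by (intro sum_emeasure) (auto simp: disjoint_family_on_def)
  also have "\<dots> \<le> emeasure \<mu> W" using W T borel by (intro emeasure_mono) auto
  also have "\<dots> \<le> ennreal v" by (rule W)
  finally show ?thesis using W(4) pos by (subst (asm) ennreal_le_iff) auto
qed

end

locale regular_decaying_measure = regular_measure +
  fixes D \<delta> :: real
  assumes D\<delta>: "0 < D" "0 < \<delta>"
    and decay: "\<And>x r H r'. \<lbrakk>x \<in> msupp \<mu>; 0 < r; r \<le> \<rho>; hyperplane H; 0 < r'\<rbrakk> \<Longrightarrow>
      emeasure \<mu> (closed_nbhd H r' \<inter> cball x r) \<le> ennreal (D * (r' / r) powr \<delta>) * emeasure \<mu> (cball x r)"
begin

text \<open>If the slab meets the ball at all, the point \<open>y\<close> shows that the function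
  varies by at least \<open>M \<tau> / 2\<close> across the ball. This bounds \<open>norm a\<close>
  from below and the Euclidean half-width \<open>\<tau> / norm a\<close> by
  \<open>4 r / M\<close>.\<close>

lemma emeasure_slab_le:
  assumes x: "x \<in> msupp \<mu>" and r: "0 < r" "r \<le> \<rho>" and a: "a \<noteq> 0" and \<tau>: "0 < \<tau>" and M: "2 \<le> M"
    and y: "y \<in> cball x r" "M * \<tau> \<le> \<bar>a \<bullet> y - b\<bar>"
  shows "emeasure \<mu> ({z. \<bar>a \<bullet> z - b\<bar> \<le> \<tau>} \<inter> cball x r) \<le> ennreal (D * (4 / M) powr \<delta> * (A * r powr \<alpha>))"
proof (cases "{z. \<bar>a \<bullet> z - b\<bar> \<le> \<tau>} \<inter> cball x r = {}")
  case False
  then obtain z where z: "\<bar>a \<bullet> z - b\<bar> \<le> \<tau>" "z \<in> cball x r" by blast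
  have "dist y z \<le> 2 * r" using y(1) z(2) dist_triangle3[of y z x] by simp
  then have "\<bar>a \<bullet> (y - z)\<bar> \<le> norm a * (2 * r)"
    using Cauchy_Schwarz_ineq2[of a "y - z"] mult_left_mono[of "norm (y - z)" "2 * r" "norm a"] by (simp add: dist_norm)
  moreover have "\<bar>a \<bullet> y - b\<bar> \<le> \<bar>a \<bullet> (y - z)\<bar> + \<bar>a \<bullet> z - b\<bar>" by (simp add: inner_diff_right)
  ultimately have "M * \<tau> - \<tau> \<le> norm a * (2 * r)" using y(2) z(1) by linarith
  moreover have "2 * \<tau> \<le> M * \<tau>" using M \<tau> by (intro mult_right_mono) auto
  then have "(M / 2) * \<tau> \<le> M * \<tau> - \<tau>" by simp
  ultimately have "(M / 2) * \<tau> \<le> norm a * (2 * r)" by linarith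
  then have ratio: "\<tau> / norm a / r \<le> 4 / M" using a r M by (simp add: field_simps)
  let ?H = "{z. a \<bullet> z = b}"
  have "infdist z ?H \<le> \<tau> / norm a" if "\<bar>a \<bullet> z - b\<bar> \<le> \<tau>" for z
  proof -
    define p where "p = z - ((a \<bullet> z - b) / (a \<bullet> a)) *\<^sub>R a"
    have "p \<in> ?H" using a by (simp add: p_def inner_diff_right)
    then have "infdist z ?H \<le> dist z p" by (rule infdist_le)
    also have "\<dots> = \<bar>a \<bullet> z - b\<bar> / norm a"
      using a by (simp add: p_def dist_norm power2_norm_eq_inner[symmetric] power2_eq_square)
    finally show ?thesis using that a by (meson divide_right_mono norm_ge_zero order_trans)
  qed
  then have "emeasure \<mu> ({z. \<bar>a \<bullet> z - b\<bar> \<le> \<tau>} \<inter> cball x r) \<le> emeasure \<mu> (closed_nbhd ?H (\<tau> / norm a) \<inter> cball x r)"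
  proof (intro emeasure_mono)
    have "closed (closed_nbhd ?H (\<tau> / norm a))"
      unfolding closed_nbhd_def by (intro closed_Collect_le continuous_intros)
    then show "closed_nbhd ?H (\<tau> / norm a) \<inter> cball x r \<in> sets \<mu>" using borel by auto
  qed (auto simp: closed_nbhd_def)
  also have "\<dots> \<le> ennreal (D * (\<tau> / norm a / r) powr \<delta>) * emeasure \<mu> (cball x r)"
    using a \<tau> x r by (intro decay) (auto simp: hyperplane_def)
  also have "\<dots> \<le> ennreal (D * (4 / M) powr \<delta>) * ennreal (A * r powr \<alpha>)"
    using ratio D\<delta> r x \<tau> a by (intro mult_mono upper ennreal_leI mult_left_mono powr_mono2) auto
  also have "\<dots> = ennreal (D * (4 / M) powr \<delta> * (A * r powr \<alpha>))"
    using D\<delta> pos by (simp add: ennreal_mult)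
  finally show ?thesis .
qed simp

end

section \<open>The weighted flow\<close>

text \<open>Vectors \<open>(a, a\<^sub>0)\<close> stand for the affine forms \<open>a\<^sub>0 + a \<bullet> x\<close>;
  coordinates of weight \<open>0\<close> are not used.\<close>

locale weighted_flow =
  fixes w :: "real ^ 'd" and R :: real
  assumes w_nonneg: "\<And>i. 0 \<le> w $ i" and w_sum: "(\<Sum>i\<in>UNIV. w $ i) = 1" and R1: "1 < R"
begin

definition "supp = {i. 0 < w $ i}"
definition "wmax = Max (range (($) w))"
definition "wmin = Min (($) w ` supp)"
definition "imax = (SOME i. w $ i = wmax)"
text \<open>Chosen so that \<open>q^(1 + wmax) = R\<close>: the box of time \<open>n\<close>, with
  sides \<open>q^(-n (1 + w_i))\<close>, has shortest side \<open>R^-n\<close>, the radius of a ball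
  of level \<open>n\<close>.\<close>

definition "q = R powr (1 / (1 + wmax))"
text \<open>Here \<open>R^\<kappa> = q^wmin\<close>, the least contraction of a linear part in one
  step of time.\<close>

definition "\<kappa> = wmin / (1 + wmax)"

definition lat :: "((real ^ 'd) \<times> real) set" where
  "lat = {v. (\<forall>i. fst v $ i \<in> \<int> \<and> (w $ i = 0 \<longrightarrow> fst v $ i = 0)) \<and> snd v \<in> \<int>}"

definition e0 :: "(real ^ 'd) \<times> real" where "e0 = (0, 1)"

definition lin :: "nat \<Rightarrow> (real ^ 'd) \<times> real \<Rightarrow> real ^ 'd" where
  "lin n v = diag_map (\<lambda>i. q powr - (real n * w $ i)) (fst v)"

definition form :: "nat \<Rightarrow> real ^ 'd \<Rightarrow> (real ^ 'd) \<times> real \<Rightarrow> real" where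
  "form n x v = q powr real n * (snd v + fst v \<bullet> x)"

text \<open>Only linear parts enter. A sublattice containing \<open>e0\<close> loses a dimension
  under \<open>lin\<close> and gets volume 0; such lattices are kept apart by the condition on
  \<open>e0\<close> and reappear only as joins.\<close>

definition vol :: "nat \<Rightarrow> ((real ^ 'd) \<times> real) list \<Rightarrow> real" where
  "vol n as = sqrt (gram (map (lin n) as))"

lemma supp_nonempty: "supp \<noteq> {}"
proof
  assume "supp = {}"
  then have "w $ i = 0" for i using w_nonneg[of i] unfolding supp_def by (metis (mono_tags) empty_Collect_eq less_eq_real_def)
  then show False using w_sum by simp
qed

lemma sum_supp: "(\<Sum>i\<in>supp. w $ i) = 1"
proof -
  have "(\<Sum>i\<in>supp. w $ i) = (\<Sum>i\<in>UNIV. w $ i)"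
    using w_nonneg by (intro sum.mono_neutral_left) (auto simp: supp_def less_le)
  then show ?thesis using w_sum by simp
qed

lemma card_supp: "1 \<le> card supp"
  using supp_nonempty by (simp add: Suc_le_eq card_gt_0_iff)

lemma le_wmax: "w $ i \<le> wmax"
  unfolding wmax_def by (intro Max_ge) auto

lemma w_imax: "w $ imax = wmax"
proof -
  have "wmax \<in> range (($) w)" unfolding wmax_def by (intro Max_in) auto
  then have "\<exists>i. w $ i = wmax" by auto
  then show ?thesis unfolding imax_def by (rule someI_ex)
qed

lemma wmin_le: "i \<in> supp \<Longrightarrow> wmin \<le> w $ i"
  unfolding wmin_def by (intro Min_le) auto

lemma wmin_pos: "0 < wmin"
proof -
  have "wmin \<in> ($) w ` supp" unfolding wmin_def using supp_nonempty by (intro Min_in) auto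
  then show ?thesis by (auto simp: supp_def)
qed

lemma wmin_le_wmax: "wmin \<le> wmax"
  using supp_nonempty wmin_le le_wmax by (metis ex_in_conv order_trans)

lemma imax_supp: "imax \<in> supp"
  using w_imax wmin_pos wmin_le_wmax by (simp add: supp_def)

lemma w_le_1: "w $ i \<le> 1"
  using member_le_sum[of i UNIV "($) w"] w_nonneg w_sum by simp

lemma wmax_le_1: "wmax \<le> 1" using w_le_1[of imax] w_imax by simp

lemma q1: "1 < q"
  unfolding q_def using R1 wmin_pos wmin_le_wmax by (intro gr_one_powr) auto

lemma q_powr: "q powr y = R powr (y / (1 + wmax))"
  by (simp add: q_def powr_powr)

lemma q_powr_1_wmax: "q powr ((1 + wmax) * y) = R powr y"
  using wmin_pos wmin_le_wmax by (simp add: q_powr)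

lemma \<kappa>_pos: "0 < \<kappa>" using wmin_pos wmin_le_wmax by (simp add: \<kappa>_def)

lemma \<kappa>_le: "\<kappa> \<le> 1/2"
  using wmin_pos wmin_le_wmax wmax_le_1 by (simp add: \<kappa>_def field_simps)

lemma q_le_R: "q \<le> R"
  using R1 wmin_pos wmin_le_wmax powr_mono[of "1 / (1 + wmax)" 1 R] by (simp add: q_def)

lemma linear_lin: "linear (lin n)"
proof -
  have "lin n = diag_map (\<lambda>i. q powr - (real n * w $ i)) \<circ> fst" by (auto simp: lin_def)
  then show ?thesis by (simp add: linear_compose linear_diag_map linear_fst)
qed

lemma linear_form: "linear (form n x)"
  by (auto simp: linear_iff form_def inner_add_left algebra_simps)

lemma lin_0: "lin 0 v = fst v"
  using q1 by (simp add: lin_def diag_map_def)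

lemma lin_nth: "lin n v $ i = q powr - (real n * w $ i) * fst v $ i"
  by (simp add: lin_def diag_map_def)

lemma lin_add: "lin (n + p) v = diag_map (\<lambda>i. q powr - (real p * w $ i)) (lin n v)"
  by (simp add: vec_eq_iff lin_nth diag_map_def powr_add[symmetric] algebra_simps)

lemma form_add: "form (n + p) x v = q powr real p * form n x v"
  by (simp add: form_def powr_add)

lemma lin_eq_0_iff: "lin n v = 0 \<longleftrightarrow> fst v = 0"
  using q1 by (auto simp: vec_eq_iff lin_nth)

sublocale int_lattice lat
proof
  show "0 \<in> lat" by (simp add: lat_def)
  show "u - v \<in> lat" if "u \<in> lat" "v \<in> lat" for u v using that by (auto simp: lat_def)
  show "u \<bullet> v \<in> \<int>" if "u \<in> lat" "v \<in> lat" for u v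
    using that by (auto simp: lat_def inner_prod_def inner_vec_def intro!: Ints_add Ints_sum Ints_mult)
qed

lemma supported:
  assumes "v \<in> span (set as)" "set as \<subseteq> lat" "i \<notin> supp"
  shows "fst v $ i = 0"
proof -
  have "subspace {v :: (real ^ 'd) \<times> real. fst v $ i = 0}" by (auto simp: subspace_def)
  moreover have "set as \<subseteq> {v. fst v $ i = 0}"
    using assms w_nonneg[of i] by (auto simp: lat_def supp_def not_less)
  ultimately show ?thesis using span_minimal assms(1) by blast
qed

lemma norm_lin_add_le:
  assumes "\<And>i. i \<notin> supp \<Longrightarrow> fst v $ i = 0"
  shows "norm (lin (n + p) v) \<le> q powr - (real p * wmin) * norm (lin n v)"
  unfolding lin_add
proof (rule norm_diag_map_le)
  fix i assume "lin n v $ i \<noteq> 0"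
  then have "i \<in> supp" using assms by (auto simp: lin_nth)
  then show "\<bar>q powr - (real p * w $ i)\<bar> \<le> q powr - (real p * wmin)"
    using q1 wmin_le by (simp add: mult_left_mono)
qed simp

lemma norm_lin_le_add: "norm (lin n v) \<le> q powr (real p * wmax) * norm (lin (n + p) v)"
proof -
  have "lin n v = diag_map (\<lambda>i. q powr (real p * w $ i)) (lin (n + p) v)"
    using q1 by (simp add: lin_add vec_eq_iff diag_map_def powr_minus field_simps)
  moreover have "norm \<dots> \<le> q powr (real p * wmax) * norm (lin (n + p) v)"
    using q1 le_wmax by (intro norm_diag_map_le) (auto simp: mult_left_mono)
  ultimately show ?thesis by simp
qed

lemma vol_nonneg: "0 \<le> vol n as" by (simp add: vol_def gram_nonneg)

lemma vol_sq: "(vol n as)\<^sup>2 = gram (map (lin n) as)" by (simp add: vol_def gram_nonneg)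

lemma span_lin_0:
  assumes "e0 \<notin> span S" "v \<in> span S" "lin n v = 0"
  shows "v = 0"
proof (rule ccontr)
  assume "v \<noteq> 0"
  moreover have v: "v = snd v *\<^sub>R e0" using assms(3) by (simp add: lin_eq_0_iff e0_def prod_eq_iff)
  ultimately have "snd v \<noteq> 0" by auto
  then have "e0 = inverse (snd v) *\<^sub>R v" by (subst v) simp
  then show False using assms(1,2) span_scale by metis
qed

lemma vol_pos:
  assumes "prim as" "e0 \<notin> span (set as)"
  shows "0 < vol n as"
proof -
  have "0 < gram (map (lin n) as)"
    using assms span_lin_0 by (intro gram_map_pos linear_lin) (auto simp: prim_def)
  then show ?thesis by (simp add: vol_def)
qed

text \<open>Every vector of the basis contributes one contraction; a single factor is retained,
  which makes the rate independent of the rank.\<close>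

lemma vol_add_le:
  assumes as: "prim as" "as \<noteq> []"
  shows "vol (n + p) as \<le> R powr - (real p * \<kappa>) * vol n as"
proof -
  let ?C = "q powr - (real p * wmin)"
  have C: "?C \<le> 1" "0 \<le> ?C" using q1 wmin_pos powr_mono[of "- (real p * wmin)" 0 q] by auto
  have "gram (map (lin (n + p)) as) \<le> ?C ^ (2 * length as) * gram (map (lin n) as)"
    using as supported[of _ as] by (intro gram_map_le linear_lin norm_lin_add_le) (auto simp: prim_def)
  also have "\<dots> \<le> ?C\<^sup>2 * gram (map (lin n) as)"
    using as(2) C by (intro mult_right_mono power_decreasing gram_nonneg) (auto simp: Suc_le_eq)
  finally have "vol (n + p) as \<le> sqrt (?C\<^sup>2 * gram (map (lin n) as))" by (simp add: vol_def)
  also have "\<dots> = ?C * vol n as" by (simp add: real_sqrt_mult vol_def)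
  finally show ?thesis by (simp add: q_powr \<kappa>_def)
qed

text \<open>The weights sum to 1, so the flow has determinant \<open>q^-p\<close> on the full
  coordinate space, and completing a sublattice to full rank costs nothing because all entries are
  at most 1.\<close>

lemma vol_le_add:
  assumes as: "prim as" "e0 \<notin> span (set as)"
  shows "vol n as \<le> q powr real p * vol (n + p) as"
proof -
  let ?g = "\<lambda>i. q powr - (real p * w $ i)"
  have "gram (map (lin n) as) * (\<Prod>i\<in>supp. ?g i)\<^sup>2 \<le> gram (map (diag_map ?g) (map (lin n) as)) * 1 ^ (2 * (card supp - length (map (lin n) as)))"
  proof (rule gram_diag_map_ge)
    show "u $ i = 0" if "u \<in> set (map (lin n) as)" "i \<notin> supp" for u i
    proof -
      have "u \<in> lin n ` set as" using that(1) by simp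
      then obtain v where "v \<in> set as" "u = lin n v" by blast
      then show ?thesis using supported[OF span_base, of v as i] that(2) as(1) by (simp add: lin_nth prim_def)
    qed
    show "0 < gram (map (lin n) as)" using vol_pos[OF as, of n] by (simp add: vol_def)
    show "0 < ?g i \<and> ?g i \<le> 1" for i
      using q1 w_nonneg[of i] powr_mono[of "- (real p * w $ i)" 0 q] by auto
  qed simp
  also have "map (diag_map ?g) (map (lin n) as) = map (lin (n + p)) as" by (simp add: lin_add)
  also have "(\<Prod>i\<in>supp. ?g i) = q powr (\<Sum>i\<in>supp. - (real p * w $ i))" using q1 by (simp add: powr_sum)
  also have "(\<Sum>i\<in>supp. - (real p * w $ i)) = - real p"
    using sum_supp by (simp add: sum_negf sum_distrib_left[symmetric])
  finally have "(vol n as)\<^sup>2 * (q powr - real p)\<^sup>2 \<le> (vol (n + p) as)\<^sup>2" by (simp add: vol_sq)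
  then have "vol n as * q powr - real p \<le> vol (n + p) as"
    using vol_nonneg by (metis power2_le_imp_le power_mult_distrib)
  then show ?thesis using q1 by (simp add: powr_minus field_simps)
qed

text \<open>Cauchy-Schwarz after moving the flow from the linear part to the displacement, which is
  stretched by at most \<open>q^(n wmax)\<close>; together with the factor \<open>q^n\<close> of the
  form this is \<open>R^n\<close>.\<close>

lemma form_diff_le:
  assumes "dist x y \<le> r"
  shows "\<bar>form n x v - form n y v\<bar> \<le> R powr real n * r * norm (lin n v)"
proof -
  define z where "z = (\<chi> i. q powr (real n * w $ i) * (x - y) $ i)"
  have "fst v \<bullet> (x - y) = lin n v \<bullet> z"
    unfolding inner_vec_def z_def using q1 by (intro sum.cong) (auto simp: lin_nth powr_minus field_simps)
  then have "form n x v - form n y v = q powr real n * (lin n v \<bullet> z)"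
    by (simp add: form_def inner_diff_right algebra_simps)
  moreover have "norm z \<le> q powr (real n * wmax) * norm (x - y)"
  proof -
    have "z = diag_map (\<lambda>i. q powr (real n * w $ i)) (x - y)" by (simp add: z_def diag_map_def)
    then show ?thesis using q1 le_wmax by (simp only:) (intro norm_diag_map_le; auto simp: mult_left_mono)
  qed
  then have "\<bar>lin n v \<bullet> z\<bar> \<le> norm (lin n v) * (q powr (real n * wmax) * r)"
    using assms Cauchy_Schwarz_ineq2[of "lin n v" z]
    by (smt (verit) dist_norm mult_left_mono norm_ge_zero powr_ge_zero)
  ultimately have "\<bar>form n x v - form n y v\<bar> \<le> q powr real n * (norm (lin n v) * (q powr (real n * wmax) * r))"
    using mult_left_mono[of "\<bar>lin n v \<bullet> z\<bar>" _ "q powr real n"] by (simp add: abs_mult)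
  also have "\<dots> = q powr ((1 + wmax) * real n) * r * norm (lin n v)"
    by (simp add: powr_add algebra_simps)
  finally show ?thesis by (simp only: q_powr_1_wmax)
qed

text \<open>Transference from one linear form to simultaneous approximation. For a point
  \<open>p / N\<close> the pigeonhole on the residues of \<open>a . p\<close> modulo
  \<open>N\<close> yields a short integer vector \<open>y\<close> with \<open>N\<close> dividing
  \<open>y . p\<close>. The affine form with linear part \<open>y\<close> that vanishes at
  \<open>p / N\<close> has integer coefficients, and it is small at \<open>x\<close> if
  \<open>p / N\<close> is too close to \<open>x\<close>.\<close>

lemma Bad_if_forms_bounded_below:
  assumes c1: "0 < c1" and x: "\<And>n v. v \<in> lat \<Longrightarrow> v \<noteq> 0 \<Longrightarrow> c1 \<le> norm (lin n v) \<or> c1 \<le> \<bar>form n x v\<bar>"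
  shows "x \<in> Bad w"
proof -
  let ?k = "real CARD('d)"
  \<comment> \<open>So small that all coordinates of size \<open>b\<close> together stay below
    \<open>c1\<close>.\<close>
  define b where "b = min (1/2) (c1 / (2 * ?k))"
  have b: "0 < b" "b < 1" "?k * b < c1"
  proof -
    show "0 < b" "b < 1" using c1 by (auto simp: b_def)
    have "?k * b \<le> ?k * (c1 / (2 * ?k))" by (intro mult_left_mono) (auto simp: b_def)
    also have "\<dots> < c1" using c1 by (simp add: field_simps)
    finally show "?k * b < c1" .
  qed
  \<comment> \<open>Bounds the overshoot \<open>q^n / N\<close> at the least admissible time
    \<open>n\<close>. As \<open>1 + w $ i\<close> is at most 2, the constant
    \<open>inverse (E^2)\<close> compensates it in every coordinate.\<close>
  define E where "E = q / b ^ card supp"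
  have E: "1 \<le> E" using b q1 power_le_one[of b "card supp"] by (simp add: E_def field_simps)
  have "\<exists>i. inverse (E\<^sup>2) / real N powr (1 + w $ i) \<le> \<bar>x $ i - real_of_int (p $ i) / real N\<bar>"
    if N: "1 \<le> N" for N :: nat and p :: "int ^ 'd"
  proof (rule ccontr)
    assume "\<not> ?thesis"
    then have close: "\<bar>x $ i - real_of_int (p $ i) / real N\<bar> < inverse (E\<^sup>2) / real N powr (1 + w $ i)" for i
      by (simp add: not_le)
    \<comment> \<open>The condition that a box with sides \<open>b q^(n w_i)\<close> holds more than
      \<open>N\<close> integer points.\<close>
    define P where "P n \<longleftrightarrow> real N < b ^ card supp * q ^ n" for n
    obtain n' where "real N / b ^ card supp < q ^ n'"
      using real_arch_pow[OF q1, of "real N / b ^ card supp"] by blast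
    then have "P n'" using b by (simp add: P_def pos_divide_less_eq mult.commute)
    define n where "n = (LEAST n. P n)"
    have n: "real N < b ^ card supp * q ^ n"
      using LeastI[of P, OF \<open>P n'\<close>] by (simp add: n_def P_def)
    have least: "b ^ card supp * q ^ m \<le> real N" if "m < n" for m
      using not_less_Least[of m P] that by (simp add: n_def P_def)
    have "n \<noteq> 0"
    proof
      assume "n = 0"
      then have "real N < b ^ card supp" using n by simp
      also have "\<dots> \<le> 1" using b by (intro power_le_one) auto
      finally show False using N by simp
    qed
    then have "b ^ card supp * q ^ (n - 1) \<le> real N" using least by simp
    then have "q * (b ^ card supp * q ^ (n - 1)) \<le> q * real N" using q1 by simp
    then have qn: "q ^ n \<le> E * real N"
      using \<open>n \<noteq> 0\<close> b by (cases n) (auto simp: E_def field_simps)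
    define u where "u i = b * q powr (real n * w $ i)" for i
    have u0: "0 < u i" for i using b q1 by (simp add: u_def)
    define S where "S = (\<Pi>\<^sub>E i\<in>supp. {0..\<lfloor>u i\<rfloor>})"
    have "real N < (\<Prod>i\<in>supp. u i)"
    proof -
      have "(\<Prod>i\<in>supp. u i) = b ^ card supp * q powr (\<Sum>i\<in>supp. real n * w $ i)"
        using q1 by (simp add: u_def prod.distrib powr_sum)
      also have "(\<Sum>i\<in>supp. real n * w $ i) = real n" using sum_supp by (simp add: sum_distrib_left[symmetric])
      finally show ?thesis using n q1 by (simp add: powr_realpow)
    qed
    also have "\<dots> \<le> (\<Prod>i\<in>supp. real (card {0..\<lfloor>u i\<rfloor>}))"
      using u0 by (intro prod_mono) (auto simp: less_imp_le)
    also have "\<dots> = real (card S)" by (simp add: S_def card_PiE)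
    finally have card: "N < card S" by simp
    define F where "F a = (\<Sum>i\<in>supp. a i * p $ i) mod int N" for a :: "'d \<Rightarrow> int"
    have "\<not> inj_on F S"
    proof
      assume "inj_on F S"
      moreover have "F ` S \<subseteq> {0..<int N}" using N by (auto simp: F_def)
      ultimately have "card S \<le> card {0..<int N}" by (intro card_inj_on_le) auto
      then show False using card by simp
    qed
    then obtain a a' where a: "a \<in> S" "a' \<in> S" "a \<noteq> a'" "F a = F a'" by (auto simp: inj_on_def)
    define y where "y = (\<chi> i. if i \<in> supp then real_of_int (a i - a' i) else 0)"
    have "int N dvd (\<Sum>i\<in>supp. a i * p $ i) - (\<Sum>i\<in>supp. a' i * p $ i)"
      using a(4) unfolding F_def by (simp add: mod_eq_dvd_iff)
    then obtain k where k: "(\<Sum>i\<in>supp. a i * p $ i) - (\<Sum>i\<in>supp. a' i * p $ i) = int N * k" by auto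
    have yp: "(\<Sum>i\<in>UNIV. y $ i * real_of_int (p $ i)) = real N * of_int k"
    proof -
      have "(\<Sum>i\<in>UNIV. y $ i * real_of_int (p $ i)) = (\<Sum>i\<in>supp. y $ i * real_of_int (p $ i))"
        by (intro sum.mono_neutral_right) (auto simp: y_def)
      also have "\<dots> = real_of_int ((\<Sum>i\<in>supp. a i * p $ i) - (\<Sum>i\<in>supp. a' i * p $ i))"
        by (simp add: y_def sum_subtractf[symmetric] algebra_simps)
      also have "\<dots> = real N * of_int k" unfolding k by simp
      finally show ?thesis .
    qed
    have yb: "\<bar>y $ i\<bar> \<le> u i" for i
    proof (cases "i \<in> supp")
      case True
      then have "a i \<in> {0..\<lfloor>u i\<rfloor>}" "a' i \<in> {0..\<lfloor>u i\<rfloor>}" using a by (auto simp: S_def PiE_iff)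
      then have "\<bar>a i - a' i\<bar> \<le> \<lfloor>u i\<rfloor>" by auto
      then have "real_of_int \<bar>a i - a' i\<bar> \<le> u i" by (simp add: le_floor_iff)
      then show ?thesis using True by (simp add: y_def)
    qed (use u0 in \<open>auto simp: y_def less_imp_le\<close>)
    obtain i0 where i0: "a i0 \<noteq> a' i0" using a(3) by auto
    have "i0 \<in> supp"
    proof (rule ccontr)
      assume "i0 \<notin> supp"
      then have "a i0 = a' i0" using a(1,2) by (simp add: S_def PiE_iff extensional_def)
      then show False using i0 by simp
    qed
    then have y0: "y \<noteq> 0" using i0 by (auto simp: y_def vec_eq_iff)
    let ?v = "(y, - of_int k) :: (real ^ 'd) \<times> real"
    have "?v \<in> lat" by (auto simp: lat_def y_def supp_def)
    moreover have "?v \<noteq> 0" using y0 by (simp add: prod_eq_iff)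
    moreover have "norm (lin n ?v) < c1"
    proof -
      have "norm (lin n ?v) \<le> (\<Sum>i\<in>UNIV. \<bar>lin n ?v $ i\<bar>)" by (rule norm_le_l1_cart)
      also have "\<dots> \<le> (\<Sum>i\<in>(UNIV :: 'd set). b)"
      proof (rule sum_mono)
        fix i
        have "\<bar>lin n ?v $ i\<bar> \<le> q powr - (real n * w $ i) * u i"
          using yb[of i] by (simp add: lin_nth abs_mult mult_left_mono)
        also have "\<dots> = b" using q1 by (simp add: u_def powr_minus field_simps)
        finally show "\<bar>lin n ?v $ i\<bar> \<le> b" .
      qed
      finally show ?thesis using b by simp
    qed
    moreover have "\<bar>form n x ?v\<bar> < c1"
    proof -
      have N0: "0 < real N" using N by simp
      have "- real_of_int k + y \<bullet> x = (\<Sum>i\<in>UNIV. y $ i * (x $ i - real_of_int (p $ i) / real N))"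
      proof -
        have "(\<Sum>i\<in>UNIV. y $ i * (x $ i - real_of_int (p $ i) / real N))
            = y \<bullet> x - (\<Sum>i\<in>UNIV. y $ i * real_of_int (p $ i)) / real N"
          by (simp add: inner_vec_def sum_subtractf sum_divide_distrib algebra_simps)
        then show ?thesis using yp N0 by simp
      qed
      then have "\<bar>form n x ?v\<bar> = q ^ n * \<bar>\<Sum>i\<in>UNIV. y $ i * (x $ i - real_of_int (p $ i) / real N)\<bar>"
        using q1 by (simp add: form_def abs_mult powr_realpow)
      also have "\<dots> \<le> q ^ n * (\<Sum>i\<in>UNIV. \<bar>y $ i\<bar> * \<bar>x $ i - real_of_int (p $ i) / real N\<bar>)"
        using q1 sum_abs[of "\<lambda>i. y $ i * (x $ i - real_of_int (p $ i) / real N)" UNIV]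
        by (intro mult_left_mono) (auto simp: abs_mult)
      also have "\<dots> = (\<Sum>i\<in>UNIV. q ^ n * (\<bar>y $ i\<bar> * \<bar>x $ i - real_of_int (p $ i) / real N\<bar>))"
        by (rule sum_distrib_left)
      also have "\<dots> \<le> (\<Sum>i\<in>(UNIV :: 'd set). b)"
      proof (rule sum_mono)
        fix i
        have pw: "q powr (real n * (1 + w $ i)) \<le> (E * real N) powr (1 + w $ i)"
        proof -
          have "q powr (real n * (1 + w $ i)) = (q ^ n) powr (1 + w $ i)"
            using q1 by (simp add: powr_powr[symmetric] powr_realpow)
          also have "\<dots> \<le> (E * real N) powr (1 + w $ i)"
            using qn q1 w_nonneg[of i] by (intro powr_mono2) auto
          finally show ?thesis .
        qed
        have EE: "E powr (1 + w $ i) \<le> E\<^sup>2"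
          using E w_le_1[of i] powr_mono[of "1 + w $ i" 2 E] by simp
        have "q ^ n * (\<bar>y $ i\<bar> * \<bar>x $ i - real_of_int (p $ i) / real N\<bar>)
            \<le> q powr real n * (u i * (inverse (E\<^sup>2) / real N powr (1 + w $ i)))"
          using close[of i] yb[of i] u0[of i] q1
          by (intro mult_mono) (auto simp: powr_realpow less_imp_le)
        also have "\<dots> = b * (q powr (real n * (1 + w $ i)) * (inverse (E\<^sup>2) / real N powr (1 + w $ i)))"
          by (simp add: u_def powr_add algebra_simps)
        also have "\<dots> \<le> b * ((E * real N) powr (1 + w $ i) * (inverse (E\<^sup>2) / real N powr (1 + w $ i)))"
          using pw b by (intro mult_left_mono mult_right_mono) auto
        also have "\<dots> = b * (E powr (1 + w $ i) * inverse (E\<^sup>2))"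
          using E N0 by (simp add: powr_mult)
        also have "\<dots> \<le> b * 1"
          using EE E b by (intro mult_left_mono) (auto simp: field_simps)
        finally show "q ^ n * (\<bar>y $ i\<bar> * \<bar>x $ i - real_of_int (p $ i) / real N\<bar>) \<le> b" by simp
      qed
      finally show ?thesis using b by simp
    qed
    ultimately show False using x[of ?v n] by auto
  qed
  moreover have "0 < inverse (E\<^sup>2)" using E by simp
  ultimately show ?thesis unfolding Bad_def by blast
qed

text \<open>Volumes under this map also record the form, scaled by \<open>s\<close>, and the
  direction of largest weight, scaled by \<open>T\<close>. Both scalings are chosen in
  \<open>meet_join_bounds\<close> so that sublattices with small forms are hardly enlarged;
  submodularity then limits the stretched join.\<close>

definition stretch :: "nat \<Rightarrow> real ^ 'd \<Rightarrow> real \<Rightarrow> real \<Rightarrow> (real ^ 'd) \<times> real \<Rightarrow> (real ^ 'd) \<times> real" where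
  "stretch n x T s v = (diag_map (\<lambda>i. if i = imax then T else 1) (lin n v), s * form n x v)"

lemma linear_stretch: "linear (stretch n x T s)"
  using linear_lin[of n] linear_form[of n x] linear_diag_map[of "\<lambda>i. if i = imax then T else 1"]
  unfolding linear_iff stretch_def by (auto simp: algebra_simps)

lemma norm_diag_lin_ge:
  assumes "1 \<le> T"
  shows "norm (lin n v) \<le> norm (diag_map (\<lambda>i. if i = imax then T else 1) (lin n v))"
  using assms mult_right_mono[of 1 T]
  by (intro norm_le_componentwise_cart) (auto simp: diag_map_def abs_mult)

lemma norm_stretch_ge:
  shows "norm (diag_map (\<lambda>i. if i = imax then T else 1) (lin n v)) \<le> norm (stretch n x T s v)"
    and "\<bar>s * form n x v\<bar> \<le> norm (stretch n x T s v)"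
  unfolding stretch_def using norm_fst_le norm_snd_le by (metis, metis real_norm_def)

lemma norm_stretch_ge_lin: "1 \<le> T \<Longrightarrow> norm (lin n v) \<le> norm (stretch n x T s v)"
  using norm_diag_lin_ge norm_stretch_ge(1) order_trans by blast

lemma norm_stretch_le:
  assumes "0 \<le> T" "\<bar>T * lin n v $ imax\<bar> \<le> norm (lin n v)" "\<bar>s * form n x v\<bar> \<le> norm (lin n v)"
  shows "norm (stretch n x T s v) \<le> 3 * norm (lin n v)"
proof -
  let ?t = "diag_map (\<lambda>i. if i = imax then T else 1) (lin n v)"
  have "?t = (lin n v - axis imax (lin n v $ imax)) + axis imax (T * lin n v $ imax)"
    by (auto simp: diag_map_def vec_eq_iff axis_def)
  moreover have "norm (lin n v - axis imax (lin n v $ imax)) \<le> norm (lin n v)"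
    by (rule norm_le_componentwise_cart) (auto simp: axis_def)
  moreover have "norm (axis imax (T * lin n v $ imax) :: real ^ 'd) = \<bar>T * lin n v $ imax\<bar>"
    by (simp add: norm_eq_sqrt_inner inner_axis_axis)
  ultimately have "norm ?t \<le> 2 * norm (lin n v)"
    using assms(2) norm_triangle_ineq[of "lin n v - axis imax (lin n v $ imax)" "axis imax (T * lin n v $ imax)"]
    by simp
  moreover have "norm (stretch n x T s v) \<le> norm ?t + \<bar>s * form n x v\<bar>"
    unfolding stretch_def using norm_Pair_le by (metis real_norm_def)
  ultimately show ?thesis using assms(3) by linarith
qed

text \<open>A move from the centre to the boundary in the direction \<open>imax\<close> changes the
  form by \<open>R^n r\<close> times that coordinate, while both values of the form are
  small.\<close>

lemma lin_imax_le:
  assumes "0 < r" and bd: "\<And>x. x \<in> cball c r \<Longrightarrow> \<bar>form n x v\<bar> \<le> \<Delta> * norm (lin n v)"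
  shows "R powr real n * r * \<bar>lin n v $ imax\<bar> \<le> 2 * \<Delta> * norm (lin n v)"
proof -
  define c' where "c' = c + r *\<^sub>R axis imax 1"
  have "c' \<in> cball c r" using assms(1) by (simp add: c'_def dist_norm)
  moreover have "form n c' v - form n c v = q powr real n * (r * fst v $ imax)"
    by (simp add: form_def c'_def inner_add_right inner_axis algebra_simps)
  moreover have "q powr real n * fst v $ imax = R powr real n * lin n v $ imax"
  proof -
    have "R powr real n = q powr real n * q powr (real n * wmax)"
      by (simp add: powr_add[symmetric] q_powr_1_wmax[symmetric] algebra_simps)
    then show ?thesis using q1 by (simp add: lin_nth w_imax powr_minus field_simps)
  qed
  ultimately have "R powr real n * r * lin n v $ imax = form n c' v - form n c v"
    by (simp add: mult_ac)
  then have "\<bar>R powr real n * r * lin n v $ imax\<bar> \<le> 2 * (\<Delta> * norm (lin n v))"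
    using bd[of c'] bd[of c] \<open>c' \<in> cball c r\<close> assms(1) by auto
  then show ?thesis using assms(1) R1 by (simp add: abs_mult mult.assoc)
qed

lemma length_prim_le:
  assumes as: "prim as" "e0 \<notin> span (set as)"
  shows "length as \<le> card supp"
proof -
  have "length (map (lin 0) as) \<le> card supp"
  proof (rule gram_pos_length_le_card)
    fix u i assume "u \<in> set (map (lin 0) as)" "i \<notin> supp"
    then obtain v where "v \<in> set as" "u = lin 0 v" by force
    then show "u $ i = 0" using supported[OF span_base, of v as i] \<open>i \<notin> supp\<close> as(1) by (simp add: lin_nth prim_def)
  next
    show "0 < gram (map (lin 0) as)" using vol_pos[OF as, of 0] by (simp add: vol_def)
  qed
  then show ?thesis by simp
qed

lemma gram_fst_ge_1:
  assumes as: "set as \<subseteq> lat" "0 < gram as" "e0 \<notin> span (set as)"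
  shows "1 \<le> gram (map fst as)"
proof -
  have "0 < gram (map (lin 0) as)"
    using as span_lin_0 by (intro gram_map_pos linear_lin) auto
  then have "0 < gram (map fst as)" by (simp add: lin_0[abs_def] lin_0)
  moreover have "gram (map fst as) \<in> \<int>"
  proof (rule gram_Ints)
    fix u v assume "u \<in> set (map fst as)" "v \<in> set (map fst as)"
    then have "u $ i \<in> \<int>" "v $ i \<in> \<int>" for i using as(1) by (auto simp: lat_def)
    then show "u \<bullet> v \<in> \<int>" by (auto simp: inner_vec_def intro!: Ints_sum Ints_mult)
  qed
  ultimately show ?thesis by (auto elim!: Ints_cases)
qed

lemma vol_0_ge_1: "prim as \<Longrightarrow> e0 \<notin> span (set as) \<Longrightarrow> 1 \<le> vol 0 as"
  using gram_fst_ge_1[of as] by (simp add: vol_def prim_def lin_0[abs_def])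

lemma prod_flow: "(\<Prod>i\<in>supp. q powr - (real n * w $ i)) = q powr - real n"
proof -
  have "(\<Prod>i\<in>supp. q powr - (real n * w $ i)) = q powr (\<Sum>i\<in>supp. - (real n * w $ i))"
    using q1 by (simp add: powr_sum)
  also have "(\<Sum>i\<in>supp. - (real n * w $ i)) = - real n"
    using sum_supp by (simp add: sum_negf sum_distrib_left[symmetric])
  finally show ?thesis .
qed

lemma e0_lat: "e0 \<in> lat" by (simp add: e0_def lat_def)

lemma prim_e0: "prim [e0]"
  unfolding prim_def
proof (intro conjI ballI)
  show "set [e0] \<subseteq> lat" using e0_lat by simp
  show "0 < gram [e0]" by (simp add: gram_singleton e0_def)
  fix v assume v: "v \<in> lat \<inter> span (set [e0])"
  then obtain k where k: "v = k *\<^sub>R e0" by (auto simp: span_singleton)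
  then have "k \<in> \<int>" using v by (auto simp: lat_def e0_def)
  then obtain m where "k = of_int m" by (elim Ints_cases)
  then show "\<exists>c::nat \<Rightarrow> int. v = (\<Sum>i<length [e0]. real_of_int (c i) *\<^sub>R [e0] ! i)"
    using k by (intro exI[of _ "\<lambda>_. m"]) simp
qed

text \<open>The case split on the length reflects that the weights sum to \<open>1\<close>: the factor \<open>T\<close> is
  only needed when the lattice has full rank.\<close>

lemma gram_stretch_e0:
  assumes ps: "prim ps" "e0 \<in> span (set ps)" and T: "1 \<le> T" and s: "0 < s"
  shows "length ps \<le> Suc (card supp)"
    and "length ps \<le> card supp \<Longrightarrow> (s * R powr (\<kappa> * real n))\<^sup>2 \<le> gram (map (stretch n x T s) ps)"
    and "length ps = Suc (card supp) \<Longrightarrow> (s * T)\<^sup>2 \<le> gram (map (stretch n x T s) ps)"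
proof -
  let ?f = "stretch n x T s"
  \<comment> \<open>Change to a primitive basis starting with \<open>e0\<close>. The form gives
    \<open>e0\<close> the length \<open>s q^n\<close>, and the linear parts of the other vectors
    span an integral lattice of rank one less, of volume at least 1.\<close>
  obtain qs where qs: "prim (e0 # qs)" "span (set (e0 # qs)) = span (set ps)"
  proof -
    have "set ps \<subseteq> lat" using ps(1) by (simp add: prim_def)
    then obtain qs where "prim ([e0] @ qs)" "span (set ([e0] @ qs)) = span (set [e0] \<union> set ps)"
      using prim_span_extend[OF prim_e0] by blast
    moreover have "span (set [e0] \<union> set ps) = span (set ps)" using ps(2) by (simp add: span_redundant)
    ultimately show thesis using that by simp
  qed
  have "gram (e0 # qs) = gram (map id ps)"
    using prim_gram_eq[OF qs(1) ps(1) qs(2), of id] by (simp add: linear_id)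
  have "dim (set ps) = dim (set (e0 # qs))" using qs(2) by (metis dim_span)
  moreover have "length ps = dim (set ps)" "length (e0 # qs) = dim (set (e0 # qs))"
    using ps(1) qs(1) unfolding prim_def by (blast intro: gram_pos_length)+
  ultimately have len: "length ps = Suc (length qs)" by simp
  have q0: "0 < gram qs" "e0 \<notin> span (set qs)" "set qs \<subseteq> lat"
  proof -
    have "distinct (e0 # qs)" "independent (set (e0 # qs))" using qs(1) gram_pos_iff[of "e0 # qs"] by (auto simp: prim_def)
    then show "0 < gram qs" "e0 \<notin> span (set qs)" by (auto simp: gram_pos_iff independent_insert)
    show "set qs \<subseteq> lat" using qs(1) by (simp add: prim_def)
  qed
  have ge1: "1 \<le> gram (map fst qs)" using gram_fst_ge_1 q0 by blast
  have sup: "u $ i = 0" if "u \<in> set (map fst qs)" "i \<notin> supp" for u i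
  proof -
    have "u \<in> fst ` set qs" using that(1) by simp
    then obtain v where "v \<in> set qs" "u = fst v" by blast
    then show ?thesis using supported[OF span_base, of v qs i] that(2) q0(3) by simp
  qed
  have lq: "length qs \<le> card supp" using gram_pos_length_le_card[of "map fst qs" supp] sup ge1 by simp
  then show "length ps \<le> Suc (card supp)" using len by simp
  have eq: "gram (map ?f ps) = gram (map ?f (e0 # qs))"
    using prim_gram_eq[OF ps(1) qs(1) qs(2)[symmetric] linear_stretch] .
  have fe0: "s * q powr real n \<le> norm (?f e0)"
    using norm_stretch_ge(2)[of s n x e0 T] s by (simp add: form_def e0_def)
  have main: "(s * q powr real n)\<^sup>2 * gram (map g qs) \<le> gram (map ?f ps)"
    if g: "linear g" "g e0 = 0" "\<And>v. norm (g v) \<le> norm (?f v)" for g :: "(real ^ 'd) \<times> real \<Rightarrow> real ^ 'd"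
  proof -
    have "(s * q powr real n)\<^sup>2 * gram (map g qs) \<le> (norm (?f e0))\<^sup>2 * gram (map g qs)"
      using fe0 s by (intro mult_right_mono power_mono gram_nonneg) auto
    also have "\<dots> \<le> gram (map ?f (e0 # qs))"
      by (rule gram_Cons_kernel[OF linear_stretch g(1,2,3)])
    finally show ?thesis by (simp only: eq)
  qed
  have lin0: "lin n e0 = 0" by (simp add: e0_def lin_eq_0_iff)
  show "(s * R powr (\<kappa> * real n))\<^sup>2 \<le> gram (map ?f ps)" if "length ps \<le> card supp"
  proof -
    \<comment> \<open>The rank of \<open>qs\<close> is below \<open>card supp\<close>, so at least
      one missing direction is available in \<open>gram_diag_map_ge\<close>. It contributes the gain
      \<open>q^(n wmin) = R^(\<kappa> n)\<close>.\<close>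
    let ?k = "2 * (card supp - length (map fst qs))"
    let ?G = "q powr - (real n * wmin)"
    have "gram (map fst qs) * (\<Prod>i\<in>supp. q powr - (real n * w $ i))\<^sup>2
        \<le> gram (map (diag_map (\<lambda>i. q powr - (real n * w $ i))) (map fst qs)) * ?G ^ ?k"
      using ge1 q1 wmin_le by (intro gram_diag_map_ge sup) (auto simp: mult_left_mono)
    also have "map (diag_map (\<lambda>i. q powr - (real n * w $ i))) (map fst qs) = map (lin n) qs"
      by (simp add: lin_def)
    also have "gram (map (lin n) qs) * ?G ^ ?k \<le> gram (map (lin n) qs) * ?G\<^sup>2"
      using that len q1 wmin_pos powr_mono[of "- (real n * wmin)" 0 q]
      by (intro mult_left_mono power_decreasing gram_nonneg) auto
    finally have "gram (map fst qs) * (q powr - real n)\<^sup>2 \<le> gram (map (lin n) qs) * ?G\<^sup>2"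
      unfolding prod_flow .
    then have "1 * (q powr - real n)\<^sup>2 \<le> gram (map (lin n) qs) * ?G\<^sup>2"
      using mult_right_mono[OF ge1 zero_le_power2[of "q powr - real n"]] by linarith
    then have "(s * q powr real n)\<^sup>2 * (q powr - real n)\<^sup>2 * (q powr (real n * wmin))\<^sup>2
        \<le> (s * q powr real n)\<^sup>2 * (gram (map (lin n) qs) * ?G\<^sup>2) * (q powr (real n * wmin))\<^sup>2"
      by (intro mult_left_mono mult_right_mono) auto
    also have "\<dots> = (s * q powr real n)\<^sup>2 * gram (map (lin n) qs) * (?G * q powr (real n * wmin))\<^sup>2"
      by (simp add: power_mult_distrib mult_ac)
    also have "?G * q powr (real n * wmin) = 1" using q1 by (simp add: powr_minus)
    finally have "(s * q powr real n)\<^sup>2 * (q powr - real n)\<^sup>2 * (q powr (real n * wmin))\<^sup>2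
        \<le> (s * q powr real n)\<^sup>2 * gram (map (lin n) qs)" by simp
    moreover have "(s * q powr real n)\<^sup>2 * (q powr - real n)\<^sup>2 * (q powr (real n * wmin))\<^sup>2 = (s * R powr (\<kappa> * real n))\<^sup>2"
    proof -
      have "q powr (real n * wmin) = R powr (\<kappa> * real n)" by (simp add: q_powr \<kappa>_def mult.commute)
      moreover have "q powr real n * q powr - real n = 1" using q1 by (simp add: powr_minus)
      ultimately show ?thesis by (simp add: power_mult_distrib[symmetric] mult_ac)
    qed
    moreover have "(s * q powr real n)\<^sup>2 * gram (map (lin n) qs) \<le> gram (map ?f ps)"
      using lin0 norm_stretch_ge_lin[OF T] by (intro main linear_lin) auto
    ultimately show ?thesis by linarith
  qed
  show "(s * T)\<^sup>2 \<le> gram (map ?f ps)" if "length ps = Suc (card supp)"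
  proof -
    let ?t = "\<lambda>i. (if i = imax then T else 1) * q powr - (real n * w $ i)"
    let ?g = "\<lambda>v. diag_map (\<lambda>i. if i = imax then T else 1) (lin n v)"
    have comp: "?g = diag_map ?t \<circ> fst" by (auto simp: diag_map_def lin_def mult_ac)
    have tp: "0 < ?t i \<and> ?t i \<le> T" for i
      using T q1 w_nonneg[of i] powr_mono[of "- (real n * w $ i)" 0 q] mult_mono[of "if i = imax then T else 1" T "q powr - (real n * w $ i)" 1]
      by auto
    have "gram (map fst qs) * (\<Prod>i\<in>supp. ?t i)\<^sup>2
        \<le> gram (map (diag_map ?t) (map fst qs)) * T ^ (2 * (card supp - length (map fst qs)))"
      using ge1 T tp by (intro gram_diag_map_ge sup) auto
    then have "gram (map fst qs) * (\<Prod>i\<in>supp. ?t i)\<^sup>2 \<le> gram (map ?g qs)"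
      using that len by (simp add: comp)
    \<comment> \<open>In full rank no direction is missing and there is no such gain, but the
      determinant contains \<open>T\<close> exactly once.\<close>
    moreover have "(\<Prod>i\<in>supp. ?t i) = T * q powr - real n"
      using imax_supp by (simp add: prod.distrib prod_flow prod.delta)
    ultimately have "(T * q powr - real n)\<^sup>2 \<le> gram (map ?g qs)"
      using mult_right_mono[OF ge1, of "(T * q powr - real n)\<^sup>2"] by simp
    then have "(s * q powr real n)\<^sup>2 * (T * q powr - real n)\<^sup>2 \<le> (s * q powr real n)\<^sup>2 * gram (map ?g qs)"
      by (intro mult_left_mono) auto
    also have "\<dots> \<le> gram (map ?f ps)"
    proof (rule main)
      show "linear ?g" unfolding comp by (intro linear_compose linear_fst linear_diag_map)
      show "?g e0 = 0" by (simp add: lin0 linear_0[OF linear_diag_map])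
      show "norm (?g v) \<le> norm (?f v)" for v by (rule norm_stretch_ge)
    qed
    also have "(s * q powr real n)\<^sup>2 * (T * q powr - real n)\<^sup>2 = (s * T)\<^sup>2"
    proof -
      have "q powr real n * q powr - real n = 1" using q1 by (simp add: powr_minus)
      then have "(s * q powr real n) * (T * q powr - real n) = s * T" by (simp add: mult_ac)
      then show ?thesis by (simp only: power_mult_distrib[symmetric])
    qed
    finally show ?thesis .
  qed
qed

text \<open>Two sublattices of the same rank whose forms are all small on one ball: their join \<open>ps\<close> and
  meet \<open>cs\<close> violate one of the lower bounds that a good ball provides.\<close>

lemma meet_join_bounds:
  assumes as: "prim as" "e0 \<notin> span (set as)" "vol n as \<le> V"
    and bs: "prim bs" "e0 \<notin> span (set bs)" "vol n bs \<le> V"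
    and len: "length as = length bs" and ne: "span (set as) \<noteq> span (set bs)"
    and r: "0 < r" and \<Delta>: "0 < \<Delta>"
    and slope: "\<And>x v. x \<in> cball c r \<Longrightarrow> v \<in> span (set as) \<union> span (set bs) \<Longrightarrow> \<bar>form n x v\<bar> \<le> \<Delta> * norm (lin n v)"
  shows "\<exists>cs ps. prim cs \<and> prim ps \<and> set cs \<subseteq> span (set as) \<and> length cs + length ps = 2 * length as \<and>
    length cs < length as \<and>
    vol n cs * vol n ps \<le> 9 ^ length as * V\<^sup>2 \<and>
    (e0 \<notin> span (set ps) \<longrightarrow> (\<forall>x\<in>cball c r. \<forall>v\<in>span (set ps). \<forall>E. v \<noteq> 0 \<longrightarrow>
        E * norm (lin n v) \<le> vol n ps * \<bar>form n x v\<bar> \<longrightarrow> vol n cs * E \<le> 9 ^ length as * V\<^sup>2 * \<Delta>)) \<and>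
    (e0 \<in> span (set ps) \<longrightarrow> length ps \<le> Suc (card supp) \<and>
      (length ps \<le> card supp \<longrightarrow> vol n cs * R powr (\<kappa> * real n) \<le> 9 ^ length as * V\<^sup>2 * \<Delta>) \<and>
      (length ps = Suc (card supp) \<longrightarrow> vol n cs * (R powr real n * r) \<le> 2 * 9 ^ length as * V\<^sup>2 * \<Delta>\<^sup>2))"
proof -
  \<comment> \<open>Chosen so that vectors of both sublattices grow by at most a factor 3:
    \<open>s\<close> by the bound on the forms, \<open>T\<close> by the bound on the coordinate
    \<open>imax\<close> that \<open>lin_imax_le\<close> derives from it.\<close>
  define T where "T = max 1 (R powr real n * r / (2 * \<Delta>))"
  define s where "s = 1 / \<Delta>"
  have T: "1 \<le> T" and s: "0 < s" using \<Delta> by (auto simp: T_def s_def)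
  let ?f = "\<lambda>x. stretch n x T s"
  obtain cs ps where cp: "prim cs" "prim ps" "set cs \<subseteq> span (set as) \<inter> span (set bs)"
    "length cs + length ps = length as + length bs"
    "length cs = length as \<and> length cs = length bs \<longrightarrow> span (set as) = span (set bs)"
    and sub: "\<And>f :: (real ^ 'd) \<times> real \<Rightarrow> (real ^ 'd) \<times> real. linear f \<Longrightarrow>
       gram (map f ps) * gram (map f cs) \<le> gram (map f as) * gram (map f bs)"
    using prim_meet_join[OF as(1) bs(1)] by blast
  have lcs: "length cs \<le> length as"
  proof -
    have "dim (set cs) \<le> dim (set as)" using cp(3) by (intro dim_mono) auto
    then show ?thesis using gram_pos_length[of cs] gram_pos_length[of as] cp(1) as(1) by (simp add: prim_def)
  qed
  have small: "norm (?f x v) \<le> 3 * norm (lin n v)"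
    if "x \<in> cball c r" "v \<in> span (set as) \<union> span (set bs)" for x v
  proof (rule norm_stretch_le)
    show "0 \<le> T" using T by simp
    show "\<bar>s * form n x v\<bar> \<le> norm (lin n v)"
      using slope[OF that] \<Delta> by (simp add: s_def abs_mult field_simps)
    show "\<bar>T * lin n v $ imax\<bar> \<le> norm (lin n v)"
    proof (cases "T = 1")
      case True
      then show ?thesis using component_le_norm_cart[of "lin n v" imax] by simp
    next
      case False
      then have T': "T = R powr real n * r / (2 * \<Delta>)" by (simp add: T_def max_def split: if_splits)
      have "R powr real n * r * \<bar>lin n v $ imax\<bar> \<le> 2 * \<Delta> * norm (lin n v)"
        using r slope that(2) by (intro lin_imax_le[of r c]) auto
      then show ?thesis using \<Delta> r by (simp add: T' abs_mult field_simps)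
    qed
  qed
  have up: "gram (map (?f x) us) \<le> (3 ^ length as * V)\<^sup>2"
    if "x \<in> cball c r" "us = as \<or> us = bs" for x us
  proof -
    have "gram (map (?f x) us) \<le> 3 ^ (2 * length us) * gram (map (lin n) us)"
      using that small by (intro gram_map_le linear_stretch linear_lin) auto
    also have "\<dots> = (3 ^ length as * vol n us)\<^sup>2"
      using that len by (auto simp: power_mult_distrib vol_sq power_mult[symmetric] mult.commute)
    also have "\<dots> \<le> (3 ^ length as * V)\<^sup>2"
      using that as(3) bs(3) vol_nonneg[of n] by (intro power_mono mult_left_mono) auto
    finally show ?thesis .
  qed
  have low: "vol n us \<le> sqrt (gram (map (?f x) us))" for us x
    unfolding vol_def using norm_stretch_ge_lin[OF T]
      gram_map_le[OF linear_lin[of n] linear_stretch[of n x T s], of 1 us] by simp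
  have V0: "0 \<le> V" using vol_nonneg[of n as] as(3) by linarith
  \<comment> \<open>Each lower bound \<open>y\<close> for the stretched volume of the join limits
    \<open>vol n cs * y\<close>. The four claims come from four choices of \<open>y\<close>.\<close>
  have key: "vol n cs * y \<le> 9 ^ length as * V\<^sup>2"
    if "x \<in> cball c r" "0 \<le> y" "y \<le> sqrt (gram (map (?f x) ps))" for x y
  proof -
    have "vol n cs * y \<le> sqrt (gram (map (?f x) cs)) * sqrt (gram (map (?f x) ps))"
      using that low by (intro mult_mono) (auto simp: gram_nonneg)
    also have "\<dots> = sqrt (gram (map (?f x) ps) * gram (map (?f x) cs))" by (simp add: real_sqrt_mult)
    also have "\<dots> \<le> sqrt (gram (map (?f x) as) * gram (map (?f x) bs))"
      using sub[OF linear_stretch] by simp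
    also have "\<dots> \<le> sqrt ((3 ^ length as * V)\<^sup>2 * (3 ^ length as * V)\<^sup>2)"
      using up[OF that(1)] by (intro real_sqrt_le_mono mult_mono) (auto simp: gram_nonneg)
    also have "\<dots> = (3 ^ length as * V)\<^sup>2" using V0 by (simp add: real_sqrt_mult power2_eq_square)
    also have "\<dots> = 9 ^ length as * V\<^sup>2" by (simp add: power_mult_distrib power_mult[symmetric] mult.commute[of _ 2] power_mult[of 3 2])
    finally show ?thesis .
  qed
  have c: "c \<in> cball c r" using r by simp
  have keys: "vol n cs * y \<le> 9 ^ length as * V\<^sup>2 * \<Delta>"
    if "x \<in> cball c r" "0 \<le> y" "(s * y)\<^sup>2 \<le> gram (map (?f x) ps)" for x y
  proof -
    have "s * y \<le> sqrt (gram (map (?f x) ps))" using that(3) real_le_rsqrt by blast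
    then have "vol n cs * (s * y) \<le> 9 ^ length as * V\<^sup>2" using that s by (intro key) auto
    then show ?thesis using \<Delta> by (simp add: s_def field_simps)
  qed
  show ?thesis
  proof (intro exI conjI impI ballI allI)
    show "prim cs" "prim ps" "set cs \<subseteq> span (set as)" using cp by auto
    show "length cs + length ps = 2 * length as" using cp(4) len by simp
    show "length cs < length as" using cp(5) lcs len ne by force
    show "vol n cs * vol n ps \<le> 9 ^ length as * V\<^sup>2"
      using key[OF c vol_nonneg low] .
  next
    fix x v E assume x: "x \<in> cball c r" and v: "v \<in> span (set ps)" "v \<noteq> 0" and e: "e0 \<notin> span (set ps)"
      and E: "E * norm (lin n v) \<le> vol n ps * \<bar>form n x v\<bar>"
    show "vol n cs * E \<le> 9 ^ length as * V\<^sup>2 * \<Delta>"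
    proof (cases "0 \<le> E")
      case True
      have nv: "0 < norm (lin n v)" using span_lin_0[OF e v(1)] v(2) by auto
      have "(s * E)\<^sup>2 * (norm (lin n v))\<^sup>2 = s\<^sup>2 * (E * norm (lin n v))\<^sup>2" by (simp add: power_mult_distrib)
      also have "\<dots> \<le> s\<^sup>2 * (vol n ps * \<bar>form n x v\<bar>)\<^sup>2"
        using E True by (intro mult_left_mono power_mono) auto
      also have "\<dots> = gram (map (lin n) ps) * \<bar>s * form n x v\<bar>\<^sup>2"
        by (simp add: power_mult_distrib vol_sq)
      also have "\<dots> \<le> gram (map (lin n) ps) * (norm (?f x v))\<^sup>2"
        using norm_stretch_ge(2)[of s n x v T] by (intro mult_left_mono power_mono gram_nonneg) auto
      also have "\<dots> \<le> gram (map (?f x) ps) * (norm (lin n v))\<^sup>2"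
        using norm_stretch_ge_lin[OF T] v(1) by (intro gram_ratio linear_stretch linear_lin) auto
      finally have "(s * E)\<^sup>2 \<le> gram (map (?f x) ps)" using nv by simp
      then show ?thesis using keys x True by blast
    next
      case False
      then have "vol n cs * E \<le> 0" using vol_nonneg[of n cs] by (simp add: mult_le_0_iff)
      also have "0 \<le> 9 ^ length as * V\<^sup>2 * \<Delta>" using \<Delta> by simp
      finally show ?thesis .
    qed
  next
    assume e: "e0 \<in> span (set ps)"
    show "length ps \<le> Suc (card supp)" using gram_stretch_e0(1)[OF cp(2) e T s] .
    show "vol n cs * R powr (\<kappa> * real n) \<le> 9 ^ length as * V\<^sup>2 * \<Delta>" if "length ps \<le> card supp"
      using gram_stretch_e0(2)[OF cp(2) e T s that] keys[OF c] by auto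
    show "vol n cs * (R powr real n * r) \<le> 2 * 9 ^ length as * V\<^sup>2 * \<Delta>\<^sup>2" if "length ps = Suc (card supp)"
    proof -
      have "vol n cs * T \<le> 9 ^ length as * V\<^sup>2 * \<Delta>"
        using gram_stretch_e0(3)[OF cp(2) e T s that] keys[OF c, of T] T by auto
      moreover have "vol n cs * (R powr real n * r / (2 * \<Delta>)) \<le> vol n cs * T"
        by (intro mult_left_mono vol_nonneg) (simp add: T_def)
      ultimately have "vol n cs * (R powr real n * r / (2 * \<Delta>)) \<le> 9 ^ length as * V\<^sup>2 * \<Delta>" by linarith
      then show ?thesis using \<Delta> by (simp add: field_simps power2_eq_square)
    qed
  qed
qed

end

section \<open>Dangerous sublattices\<close>

text \<open>Exponents of \<open>R\<close>: a sublattice of rank \<open>j\<close> is controlled at distance \<open>x\<close> (in levels)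
  through its volume, threshold \<open>- \<gamma> j * x\<close>, and through its largest form, threshold
  \<open>(\<theta> j - \<gamma> j) * x - \<theta> 0 * L\<close>. Concavity of \<open>\<gamma>\<close> and monotonicity of \<open>\<theta>\<close> make dangerous sublattices unique.\<close>

locale cantor_exponents = weighted_flow w R for w :: "real ^ 'd" and R :: real +
  fixes g \<nu> :: real and K L lf :: nat
  assumes g_pos: "0 < g" and g_le: "64 * g * (real (card supp) + 1)\<^sup>2 \<le> \<kappa> * (\<kappa> / 2)"
    and \<nu>_pos: "0 < \<nu>" and \<nu>_le: "32 * \<nu> * (real (card supp) + 1) \<le> g"
    and K_ge: "4 \<le> \<nu> * real K"
    and L_ge: "100 \<le> \<nu> * real L" "12 * real K \<le> \<kappa> / 2 * real L"
    and lf_bds: "g * real L / 4 \<le> real lf" "real lf \<le> g * real L / 2"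
    and R_ge: "4 * 9 ^ card supp \<le> R" "2 \<le> R powr \<kappa>"
begin

abbreviation "d \<equiv> card supp"
definition \<gamma> :: "nat \<Rightarrow> real" where "\<gamma> j = g * real j * (real d + 1 - real j)"
definition \<theta> :: "nat \<Rightarrow> real" where "\<theta> j = \<kappa> / 2 - \<nu> * real j"

section \<open>Inequalities between the exponents\<close>

lemma \<theta>_0: "\<theta> 0 = \<kappa> / 2" by (simp add: \<theta>_def)

lemma g_small: "g \<le> \<kappa> / 2 / 64" "g \<le> 1/256"
proof -
  have "64 * g * 1 \<le> 64 * g * (real d + 1)\<^sup>2" using g_pos by (intro mult_left_mono one_le_power) auto
  also have "\<dots> \<le> 1 * (\<kappa> / 2)" using g_le mult_right_mono[of \<kappa> 1 "\<kappa> / 2"] \<kappa>_pos \<kappa>_le by linarith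
  finally show "g \<le> \<kappa> / 2 / 64" by simp
  then show "g \<le> 1/256" using \<kappa>_le by simp
qed

lemma \<gamma>_nonneg: "j \<le> Suc d \<Longrightarrow> 0 \<le> \<gamma> j"
  using g_pos unfolding \<gamma>_def by (intro mult_nonneg_nonneg) auto

lemma \<gamma>_le: "j \<le> Suc d \<Longrightarrow> \<gamma> j \<le> \<kappa> * (\<kappa> / 2) / 64"
proof -
  assume "j \<le> Suc d"
  then have "real j * (real d + 1 - real j) \<le> (real d + 1) * (real d + 1)" by (intro mult_mono) auto
  then have "64 * g * (real j * (real d + 1 - real j)) \<le> 64 * g * (real d + 1)\<^sup>2"
    using g_pos unfolding power2_eq_square by (intro mult_left_mono) auto
  moreover have "64 * g * (real j * (real d + 1 - real j)) = 64 * \<gamma> j" by (simp add: \<gamma>_def)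
  ultimately show ?thesis using g_le by linarith
qed

lemma \<gamma>_le': "j \<le> Suc d \<Longrightarrow> \<gamma> j \<le> \<kappa> / 2 / 64" "j \<le> Suc d \<Longrightarrow> \<gamma> j \<le> 1/256"
proof -
  assume "j \<le> Suc d"
  then have "\<gamma> j \<le> \<kappa> * (\<kappa> / 2) / 64" by (rule \<gamma>_le)
  also have "\<dots> \<le> 1 * (\<kappa> / 2) / 64" using \<kappa>_pos \<kappa>_le by (intro divide_right_mono mult_right_mono) auto
  finally show "\<gamma> j \<le> \<kappa> / 2 / 64" by simp
  then show "\<gamma> j \<le> 1/256" using \<kappa>_le by simp
qed

lemma \<gamma>_ge: "1 \<le> j \<Longrightarrow> j \<le> d \<Longrightarrow> g \<le> \<gamma> j"
proof -
  assume "1 \<le> j" "j \<le> d"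
  then have "1 * 1 \<le> real j * (real d + 1 - real j)" by (intro mult_mono) auto
  then show ?thesis using mult_left_mono[of 1 _ g] g_pos by (simp add: \<gamma>_def mult.assoc)
qed

text \<open>The second difference of a quadratic polynomial; as the ranks are integers it is bounded
  below uniformly.\<close>

lemma \<gamma>_concave:
  assumes "a + b = 2 * j" "a < j"
  shows "2 * \<gamma> j - \<gamma> a - \<gamma> b = 2 * g * (real j - real a)\<^sup>2" "2 * g \<le> 2 * \<gamma> j - \<gamma> a - \<gamma> b"
proof -
  have b: "real b = 2 * real j - real a" using assms by linarith
  show eq: "2 * \<gamma> j - \<gamma> a - \<gamma> b = 2 * g * (real j - real a)\<^sup>2"
    unfolding \<gamma>_def b by (simp add: power2_eq_square algebra_simps)
  have "1 \<le> (real j - real a)\<^sup>2" using assms(2) by (intro one_le_power) auto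
  then show "2 * g \<le> 2 * \<gamma> j - \<gamma> a - \<gamma> b" unfolding eq using g_pos mult_left_mono[of 1 "(real j - real a)\<^sup>2" "2 * g"] by simp
qed

lemma \<nu>_j: "j \<le> Suc d \<Longrightarrow> \<nu> * real j \<le> g / 32"
proof -
  assume "j \<le> Suc d"
  then have "32 * \<nu> * real j \<le> 32 * \<nu> * (real d + 1)" using \<nu>_pos by (intro mult_left_mono) auto
  then show ?thesis using \<nu>_le by linarith
qed

lemma \<theta>_le: "\<theta> j \<le> \<kappa> / 2" using \<nu>_pos by (simp add: \<theta>_def)

lemma \<theta>_ge: "j \<le> Suc d \<Longrightarrow> \<kappa> / 4 + \<kappa> / 8 \<le> \<theta> j"
  using \<nu>_j[of j] g_small \<kappa>_pos by (simp add: \<theta>_def)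

lemma lf_le_L: "real lf \<le> real L / 2" "lf < L" "1 \<le> lf"
proof -
  have "100 \<le> 1 * real L" using L_ge(1) \<nu>_j[of 1] g_small(2) mult_right_mono[of \<nu> 1 "real L"] by simp
  moreover have "g * real L / 2 \<le> 1 * real L / 2" using g_small by (intro divide_right_mono mult_right_mono) auto
  moreover have "g * real L \<le> (1/256) * real L" using g_small by (intro mult_right_mono) auto
  ultimately show "real lf \<le> real L / 2" "lf < L" using lf_bds by linarith+
  have "32 * \<nu> * real L \<le> g * real L" using \<nu>_j[of 1] by (intro mult_right_mono) auto
  then show "1 \<le> lf" using L_ge(1) lf_bds by simp
qed

lemma R4: "4 \<le> R"
  using R_ge(1) one_le_power[of "9::real" d] by linarith

text \<open>A ball of level \<open>m\<close> is tested at time \<open>n\<close>, and the ancestor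
  \<open>h\<close> levels above it has distance \<open>x + h\<close>. Since \<open>h\<close> is
  about \<open>x / K\<close>, losses linear in \<open>h\<close> stay below the margins
  \<open>\<nu> x\<close> and \<open>g x\<close>.\<close>

context
  fixes m n x h :: nat
  assumes mn: "m \<le> n + lf" and x: "x = n + L - m" and h: "h = x div K + 1"
begin

lemma x_ge: "real L / 2 \<le> real x" "real x = real n + real L - real m" "real L - real lf \<le> real x"
  using mn x lf_le_L by auto

lemma h_bds: "real h + 10 \<le> \<nu> * real x / 2" "6 \<le> \<kappa> / 2 * real h" "real h \<le> real x / real K + 1" "1 \<le> h"
proof -
  have K: "0 < real K" using K_ge \<nu>_pos by (cases K) auto
  have "real (x div K) \<le> real x / real K" by (rule of_nat_div_le_of_nat)
  then show h1: "real h \<le> real x / real K + 1" using h by simp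
  have "1 / real K \<le> \<nu> / 4" using K_ge K by (simp add: field_simps)
  then have "real x / real K \<le> \<nu> * real x / 4" using mult_right_mono[of "1 / real K" "\<nu> / 4" "real x"] by simp
  moreover have "\<nu> * (real L / 2) \<le> \<nu> * real x" using x_ge(1) \<nu>_pos by (intro mult_left_mono) auto
  then have "50 \<le> \<nu> * real x" using L_ge(1) by simp
  ultimately show "real h + 10 \<le> \<nu> * real x / 2" using h1 by linarith
  have "x < K * h" using h K by (simp add: dividend_less_times_div)
  then have "real x \<le> real K * real h" by (metis less_imp_le of_nat_le_iff of_nat_mult)
  then have "real L / 2 \<le> real K * real h" using x_ge by linarith
  then have "\<kappa> / 2 * (real L / 2) \<le> \<kappa> / 2 * (real K * real h)" using \<kappa>_pos by (intro mult_left_mono) auto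
  then have "6 * real K \<le> (\<kappa> / 2 * real h) * real K" using L_ge(2) by (simp add: mult_ac)
  then show "6 \<le> \<kappa> / 2 * real h" using K by simp
  show "1 \<le> h" using h by simp
qed

lemma gx_ge: "64 * (real h + 10) \<le> g * real x"
  using \<nu>_j[of 1] mult_right_mono[of "32 * \<nu>" g "real x"] h_bds(1) by simp

text \<open>Strict monotonicity of \<open>\<theta>\<close> is used here: from rank \<open>a\<close>
  to rank \<open>j\<close> it drops by at least \<open>\<nu>\<close>, and \<open>\<nu> x\<close>
  exceeds the extrapolation loss \<open>h + 2\<close>.\<close>

lemma exponent_meet:
  assumes "a < j" "j \<le> d"
  shows "real h + 2 + \<theta> j * real x < \<theta> a * real (x + h)"
proof -
  have "\<nu> * real a + \<nu> \<le> \<nu> * real j"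
    using assms(1) \<nu>_pos mult_left_mono[of "real a + 1" "real j" \<nu>] by (simp add: algebra_simps)
  then have "\<nu> * real x \<le> (\<theta> a - \<theta> j) * real x" unfolding \<theta>_def by (intro mult_right_mono) auto
  moreover have "0 \<le> \<theta> a * real h" using \<theta>_ge[of a] \<kappa>_pos assms by simp
  ultimately show ?thesis using h_bds(1) by (simp add: algebra_simps)
qed

lemma \<gamma>h: "j \<le> Suc d \<Longrightarrow> \<gamma> j * real h \<le> real h / 256" "j \<le> Suc d \<Longrightarrow> 0 \<le> \<gamma> j * real h"
  using \<gamma>_le'(2)[of j] \<gamma>_nonneg[of j] mult_right_mono[of "\<gamma> j" "1/256" "real h"] by auto

context
  fixes a b j :: nat
  assumes abj: "a + b = 2 * j" "a < j" and b: "b \<le> Suc d"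
begin

lemma conc: "2 * (g * real x) \<le> (2 * \<gamma> j - \<gamma> a - \<gamma> b) * real x"
  using mult_right_mono[OF \<gamma>_concave(2)[OF abj], of "real x"] by (simp only: mult.assoc of_nat_0_le_iff)

lemma exponent_join_volume: "1 - 2 * (\<gamma> j * real x) + \<gamma> a * real (x + h) < - (\<gamma> b * real (x + h))"
  using conc gx_ge \<gamma>h[of a] \<gamma>h[of b] abj b by (simp add: algebra_simps)

text \<open>Passing from rank \<open>j\<close> up to rank \<open>b\<close> lowers
  \<open>\<theta>\<close> by \<open>\<nu> (j - a)\<close>, because \<open>b - j = j - a\<close>; the
  curvature \<open>2 g (j - a)^2\<close> pays for this and for the terms in
  \<open>h\<close>.\<close>

lemma exponent_join_form:
  "1 - 2 * (\<gamma> j * real x) + (real h + 2 + \<theta> j * real x) < (\<theta> b - \<gamma> b) * real (x + h) - \<gamma> a * real (x + h)"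
proof -
  let ?i = "real j - real a"
  have b: "real b = 2 * real j - real a" using abj by linarith
  have "1 \<le> ?i" using abj by simp
  have "\<nu> * ?i \<le> g * (?i * ?i)"
  proof (rule order_trans)
    show "\<nu> * ?i \<le> g * ?i" using \<nu>_j[of 1] g_pos \<open>1 \<le> ?i\<close> by (intro mult_right_mono) auto
    show "g * ?i \<le> g * (?i * ?i)" using \<open>1 \<le> ?i\<close> g_pos by (intro mult_left_mono) auto
  qed
  moreover have "g * 1 \<le> g * (?i * ?i)" using \<open>1 \<le> ?i\<close> g_pos mult_mono[of 1 ?i 1 ?i] by (intro mult_left_mono) auto
  moreover have "\<theta> b - \<theta> j = - (\<nu> * ?i)" by (simp add: \<theta>_def b algebra_simps)
  ultimately have "g \<le> \<theta> b - \<theta> j + (2 * \<gamma> j - \<gamma> a - \<gamma> b)"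
    unfolding \<gamma>_concave(1)[OF abj] power2_eq_square by linarith
  then have "g * real x \<le> (\<theta> b - \<theta> j + (2 * \<gamma> j - \<gamma> a - \<gamma> b)) * real x" by (intro mult_right_mono) auto
  moreover have "0 \<le> \<theta> b * real h" using \<theta>_ge[of b] \<kappa>_pos \<open>b \<le> Suc d\<close> by simp
  ultimately show ?thesis using gx_ge \<gamma>h[of a] \<gamma>h[of b] abj \<open>b \<le> Suc d\<close> by (simp add: algebra_simps)
qed

lemma two_\<gamma>: "2 * (g * real x) \<le> 2 * (\<gamma> j * real x) - \<gamma> a * real x"
proof -
  have "0 \<le> \<gamma> b * real x" using \<gamma>_nonneg[OF b] by simp
  then show ?thesis using conc by (simp add: algebra_simps)
qed

text \<open>The slope allowed at time \<open>n\<close> is at most about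
  \<open>R^(\<kappa> n / 2)\<close>, since \<open>\<theta> 0 * L\<close> cancels the shift in
  \<open>x\<close>, whereas \<open>e0\<close> supplies \<open>R^(\<kappa> n)\<close>.\<close>

lemma exponent_join_e0:
  "1 - 2 * (\<gamma> j * real x) + (real h + 2 + \<theta> j * real x - \<theta> 0 * real L) < \<kappa> * real n - \<gamma> a * real (x + h)"
proof -
  have "\<theta> j * real x \<le> \<kappa> / 2 * real x" using \<theta>_le by (intro mult_right_mono) auto
  also have "\<dots> \<le> \<kappa> / 2 * (real n + real L)" using x_ge \<kappa>_pos by (intro mult_left_mono) auto
  finally have "\<theta> j * real x - \<theta> 0 * real L \<le> \<kappa> / 2 * real n" by (simp add: \<theta>_0 algebra_simps)
  moreover have "\<kappa> / 2 * real n \<le> \<kappa> * real n" using \<kappa>_pos by (intro mult_right_mono) auto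
  ultimately show ?thesis using two_\<gamma> gx_ge \<gamma>h[of a] abj b by (simp add: algebra_simps)
qed

text \<open>The stretching supplies \<open>R^(n - m + h)\<close>. The number
  \<open>y = n - m\<close> can be negative, but not below \<open>- lf\<close>, and the upper bound
  on \<open>lf\<close> makes this at most \<open>g x\<close>, which the curvature covers. For
  \<open>y \<ge> 0\<close> it suffices that \<open>2 * \<theta> j\<close> is less than 1.\<close>

lemma exponent_join_full:
  "1 - 2 * (\<gamma> j * real x) + 2 * (real h + 2 + \<theta> j * real x - \<theta> 0 * real L)
    < real (x + h) - real L - \<gamma> a * real (x + h)"
proof -
  define y where "y = real x - real L"
  have t: "\<theta> j \<le> 1/4" "0 \<le> \<theta> j" using \<theta>_le[of j] \<kappa>_le \<theta>_ge[of j] \<kappa>_pos abj b by auto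
  have "- (g * real x) \<le> y * (1 - 2 * \<theta> j)"
  proof (cases "0 \<le> y")
    case True
    then have "0 \<le> y * (1 - 2 * \<theta> j)" using t by (intro mult_nonneg_nonneg) auto
    then show ?thesis using g_pos by (smt (verit) mult_nonneg_nonneg of_nat_0_le_iff)
  next
    case False
    then have "y * 1 \<le> y * (1 - 2 * \<theta> j)" using t by (intro mult_left_mono_neg) auto
    moreover have "g * (real L / 2) \<le> g * real x" using x_ge g_pos by (intro mult_left_mono) auto
    ultimately show ?thesis using x_ge lf_bds unfolding y_def by simp
  qed
  moreover have "\<theta> j * real L \<le> \<theta> 0 * real L" using \<theta>_le by (intro mult_right_mono) (auto simp: \<theta>_0)
  moreover have "y * (1 - 2 * \<theta> j) = real x - real L - 2 * (\<theta> j * real x) + 2 * (\<theta> j * real L)"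
    by (simp add: y_def algebra_simps)
  ultimately show ?thesis using two_\<gamma> gx_ge \<gamma>h[of a] abj b by (simp add: algebra_simps)
qed

end

end

text \<open>At the earliest controlled time, where \<open>x = L - lf\<close>, the variation
  \<open>R^-lf\<close> of the forms across the ball is smaller than the required slope by a factor
  \<open>R\<close>. This is the purpose of the lower bound on \<open>lf\<close>.\<close>

lemma exponent_floor:
  assumes "j \<le> d"
  shows "1 \<le> \<theta> j * (real L - real lf) - \<theta> 0 * real L + real lf"
proof -
  have "\<nu> * real j * real L \<le> g / 32 * real L" using \<nu>_j[of j] assms by (intro mult_right_mono) auto
  moreover have "\<kappa> / 2 * real lf \<le> 1/4 * real lf" using \<kappa>_le by (intro mult_right_mono) auto
  moreover have "0 \<le> \<nu> * real j * real lf" using \<nu>_pos by simp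
  moreover have "32 * \<nu> * real L \<le> g * real L" using \<nu>_j[of 1] by (intro mult_right_mono) auto
  moreover have "\<theta> j * (real L - real lf) - \<theta> 0 * real L + real lf
      = - (\<nu> * real j * real L) + \<nu> * real j * real lf - \<kappa> / 2 * real lf + real lf"
    by (simp add: \<theta>_def diff_divide_distrib algebra_simps)
  ultimately show ?thesis using lf_bds(1) L_ge(1) by linarith
qed

text \<open>The product of volume and form is used because it never decreases in time
  (\<open>vol_form_grow\<close>). In rank one the volume is \<open>norm (lin n v)\<close> up to
  scaling and cancels, leaving a plain lower bound for the form.\<close>

definition ctrl :: "nat \<Rightarrow> nat \<Rightarrow> ((real ^ 'd) \<times> real) list \<Rightarrow> real ^ 'd \<Rightarrow> bool" where
  "ctrl m n as c \<longleftrightarrow> (vol n as < R powr - (\<gamma> (length as) * real (n + L - m)) \<longrightarrow>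
     (\<exists>z\<in>cball c (R powr - real m). \<exists>v\<in>span (set as). v \<noteq> 0 \<and>
       R powr ((\<theta> (length as) - \<gamma> (length as)) * real (n + L - m) - \<theta> 0 * real L) * norm (lin n v)
         \<le> vol n as * \<bar>form n z v\<bar>))"

text \<open>Times before \<open>m - lf\<close> are dropped: control of rank one at time
  \<open>n\<close> on the ancestor of level \<open>n + lf\<close> already gives the bounds at all of
  its points (\<open>good_forms_bounded_below\<close>).\<close>

definition good :: "nat \<Rightarrow> real ^ 'd \<Rightarrow> bool" where
  "good m c \<longleftrightarrow> (\<forall>n as. m \<le> n + lf \<longrightarrow> prim as \<longrightarrow> e0 \<notin> span (set as) \<longrightarrow> ctrl m n as c)"

text \<open>Everything takes place on the ancestor of level \<open>\<mu>\<close>. The forms of the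
  meet inherit the slope bound, so control forbids a volume of the meet below its threshold. With
  this lower bound inserted, every case for the join contradicts one of the exponent
  inequalities.\<close>

lemma dangerous_unique:
  assumes good: "good \<mu> c" and mn: "\<mu> + h \<le> n + lf" and x: "x = n + L - (\<mu> + h)" and h: "h = x div K + 1"
    and as: "prim as" "e0 \<notin> span (set as)" "vol n as < R powr - (\<gamma> (length as) * real x)"
    and bs: "prim bs" "e0 \<notin> span (set bs)" "vol n bs < R powr - (\<gamma> (length bs) * real x)"
    and len: "length as = length bs"
    and slope: "\<And>z v. z \<in> cball c (R powr - real \<mu>) \<Longrightarrow> v \<in> span (set as) \<union> span (set bs) \<Longrightarrow>
      \<bar>form n z v\<bar> \<le> R powr (real h + 2 + \<theta> (length as) * real x - \<theta> 0 * real L) * norm (lin n v)"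
  shows "span (set as) = span (set bs)"
proof (rule ccontr)
  assume ne: "span (set as) \<noteq> span (set bs)"
  define j where "j = length as"
  define \<delta> where "\<delta> = real h + 2 + \<theta> j * real x - \<theta> 0 * real L"
  have jd: "j \<le> d" using length_prim_le[OF as(1,2)] by (simp add: j_def)
  have R0: "0 < R" using R1 by simp
  have xh: "n + L - \<mu> = x + h" using mn x lf_le_L by simp
  have mn': "\<mu> \<le> n + lf" using mn by simp
  have nine: "9 ^ j \<le> R powr 1" "2 * 9 ^ j \<le> R powr 1"
  proof -
    have "(9::real) ^ j \<le> 9 ^ d" using jd by (intro power_increasing) auto
    moreover have "(0::real) \<le> 9 ^ j" by simp
    moreover have "R powr 1 = R" using R1 by simp
    ultimately show "9 ^ j \<le> R powr 1" "2 * 9 ^ j \<le> R powr 1" using R_ge(1) by linarith+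
  qed
  have slope': "\<bar>form n z v\<bar> \<le> R powr \<delta> * norm (lin n v)"
    if "z \<in> cball c (R powr - real \<mu>)" "v \<in> span (set as) \<union> span (set bs)" for z v
    using slope[OF that] by (simp add: \<delta>_def j_def)
  let ?V = "R powr - (\<gamma> j * real x)" and ?r = "R powr - real \<mu>"
  have "vol n bs \<le> ?V" "vol n as \<le> ?V" using as(3) bs(3) len by (simp_all add: j_def)
  then obtain cs ps where cs: "prim cs" "set cs \<subseteq> span (set as)" and ps: "prim ps"
    and abj: "length cs + length ps = 2 * j" "length cs < j"
    and A: "vol n cs * vol n ps \<le> 9 ^ j * ?V\<^sup>2"
    and B: "e0 \<notin> span (set ps) \<longrightarrow> (\<forall>z\<in>cball c ?r. \<forall>v\<in>span (set ps). \<forall>E. v \<noteq> 0 \<longrightarrow>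
        E * norm (lin n v) \<le> vol n ps * \<bar>form n z v\<bar> \<longrightarrow> vol n cs * E \<le> 9 ^ j * ?V\<^sup>2 * R powr \<delta>)"
    and C': "e0 \<in> span (set ps) \<longrightarrow> length ps \<le> Suc d \<and>
      (length ps \<le> d \<longrightarrow> vol n cs * R powr (\<kappa> * real n) \<le> 9 ^ j * ?V\<^sup>2 * R powr \<delta>) \<and>
      (length ps = Suc d \<longrightarrow> vol n cs * (R powr real n * ?r) \<le> 2 * 9 ^ j * ?V\<^sup>2 * (R powr \<delta>)\<^sup>2)"
    using meet_join_bounds[OF as(1,2) _ bs(1,2) _ len ne, of n ?V ?r "R powr \<delta>" c] slope' R0
    unfolding j_def[symmetric] by (elim meta_impE) (auto simp del: mem_cball)
  note C = C'[rule_format]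
  define a where "a = length cs"
  define b where "b = length ps"
  have ab: "a + b = 2 * j" "a < j" using abj by (auto simp: a_def b_def)
  have e0c: "e0 \<notin> span (set cs)" using as(2) cs(2) span_minimal[of "set cs" "span (set as)"] by auto
  have sq: "(R powr - (\<gamma> j * real x))\<^sup>2 = R powr (- 2 * (\<gamma> j * real x))"
    by (simp add: power2_eq_square powr_add[symmetric] mult.commute)
  have sqd: "(R powr \<delta>)\<^sup>2 = R powr (2 * \<delta>)" by (simp add: power2_eq_square powr_add[symmetric])
  have mrg: "k * R powr e * R powr e' = k * R powr (e + e')" for k e e' by (simp add: powr_add)
  note ex = mn x h
  have vc: "R powr - (\<gamma> a * real (x + h)) \<le> vol n cs"
  proof (rule ccontr)
    assume "\<not> ?thesis"
    then have small: "vol n cs < R powr - (\<gamma> a * real (x + h))" by simp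
    have "ctrl \<mu> n cs c" using good mn' cs(1) e0c unfolding good_def by blast
    then obtain z v where zv: "z \<in> cball c (R powr - real \<mu>)" "v \<in> span (set cs)" "v \<noteq> 0"
      "R powr ((\<theta> a - \<gamma> a) * real (x + h) - \<theta> 0 * real L) * norm (lin n v) \<le> vol n cs * \<bar>form n z v\<bar>"
      using small unfolding ctrl_def xh a_def by blast
    have "v \<in> span (set as)" using zv(2) cs(2) span_minimal[of "set cs" "span (set as)"] by auto
    then have "vol n cs * \<bar>form n z v\<bar> \<le> vol n cs * (R powr \<delta> * norm (lin n v))"
      using slope'[OF zv(1)] by (intro mult_left_mono vol_nonneg) auto
    moreover have nv: "0 < norm (lin n v)" using span_lin_0[OF e0c zv(2)] zv(3) by auto
    ultimately have "R powr ((\<theta> a - \<gamma> a) * real (x + h) - \<theta> 0 * real L) \<le> vol n cs * R powr \<delta>"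
      using zv(4) by (smt (verit) mult.assoc mult_right_le_imp_le)
    also have "\<dots> < R powr - (\<gamma> a * real (x + h)) * R powr \<delta>" using small R0 by simp
    also have "\<dots> = R powr (\<delta> - \<gamma> a * real (x + h))" by (simp add: powr_add[symmetric])
    finally have "(\<theta> a - \<gamma> a) * real (x + h) - \<theta> 0 * real L < \<delta> - \<gamma> a * real (x + h)"
      using R1 by simp
    then show False using exponent_meet[OF ex ab(2) jd] by (simp add: \<delta>_def algebra_simps)
  qed
  \<comment> \<open>Inserts the lower bound for the meet and passes from volumes to exponents of
    \<open>R\<close>; \<open>pull\<close> lets the powers of 9 cost one factor
    \<open>R\<close>.\<close>
  have le_exp: "e \<le> e'" if "vol n cs * y \<le> k * R powr e'" "R powr (e + \<gamma> a * real (x + h)) \<le> y" "k \<le> 1" for y k e e'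
  proof -
    have "R powr e = R powr - (\<gamma> a * real (x + h)) * R powr (e + \<gamma> a * real (x + h))"
      by (simp add: powr_add[symmetric])
    also have "\<dots> \<le> vol n cs * y" using vc that(2) vol_nonneg by (intro mult_mono) auto
    also have "\<dots> \<le> k * R powr e'" by (rule that(1))
    also have "\<dots> \<le> 1 * R powr e'" by (intro mult_right_mono that(3)) simp
    finally show ?thesis using R1 by simp
  qed
  have pull: "k * R powr e \<le> 1 * R powr (1 + e)" if "k \<le> R powr 1" for k e
    using that mult_right_mono[of k "R powr 1" "R powr e"] R1 by (simp add: powr_add)
  show False
  proof (cases "e0 \<in> span (set ps)")
    case True
    have bd: "b \<le> Suc d" using C[OF True] by (simp add: b_def)
    consider "b \<le> d" | "b = Suc d" using bd by linarith
    then show False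
    proof cases
      case 1
      then have "vol n cs * R powr (\<kappa> * real n) \<le> 9 ^ j * R powr (- 2 * (\<gamma> j * real x) + \<delta>)"
        using C[OF True] unfolding sq mrg by (simp only: b_def)
      also have "\<dots> \<le> 1 * R powr (1 + (- 2 * (\<gamma> j * real x) + \<delta>))" by (rule pull[OF nine(1)])
      finally have "\<kappa> * real n - \<gamma> a * real (x + h) \<le> 1 + (- 2 * (\<gamma> j * real x) + \<delta>)"
        by (rule le_exp) auto
      then show False using exponent_join_e0[OF ex ab bd] by (simp add: \<delta>_def)
    next
      case 2
      then have "vol n cs * (R powr real n * R powr - real \<mu>) \<le> (2 * 9 ^ j) * R powr (- 2 * (\<gamma> j * real x) + 2 * \<delta>)"
        using C[OF True] unfolding sq sqd mrg by (simp only: b_def)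
      also have "\<dots> \<le> 1 * R powr (1 + (- 2 * (\<gamma> j * real x) + 2 * \<delta>))" by (rule pull[OF nine(2)])
      finally have "real n - real \<mu> - \<gamma> a * real (x + h) \<le> 1 + (- 2 * (\<gamma> j * real x) + 2 * \<delta>)"
        by (rule le_exp) (auto simp: powr_add[symmetric])
      moreover have "real n - real \<mu> = real (x + h) - real L" using xh mn lf_le_L by linarith
      ultimately show False using exponent_join_full[OF ex ab bd] by (simp add: \<delta>_def)
    qed
  next
    case False
    have bd: "b \<le> Suc d" using length_prim_le[OF ps False] by (simp add: b_def)
    have small: "vol n ps < R powr - (\<gamma> b * real (x + h))"
    proof (rule ccontr)
      assume "\<not> ?thesis"
      then have big: "R powr - (\<gamma> b * real (x + h)) \<le> vol n ps" by simp
      have "vol n cs * vol n ps \<le> 9 ^ j * R powr (- 2 * (\<gamma> j * real x))" using A unfolding sq .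
      also have "\<dots> \<le> 1 * R powr (1 + - 2 * (\<gamma> j * real x))" by (rule pull[OF nine(1)])
      finally have "- (\<gamma> b * real (x + h)) - \<gamma> a * real (x + h) \<le> 1 + - 2 * (\<gamma> j * real x)"
        by (rule le_exp) (use big in auto)
      then show False using exponent_join_volume[OF ex ab bd] by simp
    qed
    have "ctrl \<mu> n ps c" using good mn' ps False unfolding good_def by blast
    then obtain z v where zv: "z \<in> cball c (R powr - real \<mu>)" "v \<in> span (set ps)" "v \<noteq> 0"
      "R powr ((\<theta> b - \<gamma> b) * real (x + h) - \<theta> 0 * real L) * norm (lin n v) \<le> vol n ps * \<bar>form n z v\<bar>"
      using small unfolding ctrl_def xh b_def by blast
    have "vol n cs * R powr ((\<theta> b - \<gamma> b) * real (x + h) - \<theta> 0 * real L) \<le> 9 ^ j * R powr (- 2 * (\<gamma> j * real x) + \<delta>)"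
      using B[rule_format, OF False zv] unfolding sq mrg .
    also have "\<dots> \<le> 1 * R powr (1 + (- 2 * (\<gamma> j * real x) + \<delta>))" by (rule pull[OF nine(1)])
    finally have "(\<theta> b - \<gamma> b) * real (x + h) - \<theta> 0 * real L - \<gamma> a * real (x + h) \<le> 1 + (- 2 * (\<gamma> j * real x) + \<delta>)"
      by (rule le_exp) auto
    then show False using exponent_join_form[OF ex ab bd] by (simp add: \<delta>_def)
  qed
qed

section \<open>Evolution of control in time\<close>

lemma \<eta>_bds: "j \<le> Suc d \<Longrightarrow> \<kappa> / 4 \<le> \<theta> j - \<gamma> j" "j \<le> Suc d \<Longrightarrow> \<theta> j - \<gamma> j \<le> \<kappa> / 2"
  using \<theta>_ge[of j] \<theta>_le[of j] \<gamma>_le'(1)[of j] \<gamma>_nonneg[of j] \<kappa>_pos by auto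

lemma norm_lin_add_le_span:
  assumes "prim as" "v \<in> span (set as)"
  shows "norm (lin (n + p) v) \<le> R powr - (\<kappa> * real p) * norm (lin n v)"
proof -
  have "q powr - (real p * wmin) = R powr - (\<kappa> * real p)" by (simp add: q_powr \<kappa>_def mult.commute)
  then show ?thesis using norm_lin_add_le[of v n p] supported[of v as] assms by (simp add: prim_def)
qed

text \<open>The volume loses at most \<open>q^p\<close>, exactly what the form gains.\<close>

lemma vol_form_grow:
  assumes as: "prim as" "e0 \<notin> span (set as)"
  shows "vol n as * \<bar>form n z v\<bar> \<le> vol (n + p) as * \<bar>form (n + p) z v\<bar>"
proof -
  have "vol n as * \<bar>form n z v\<bar> \<le> (q powr real p * vol (n + p) as) * \<bar>form n z v\<bar>"
    using vol_le_add[OF as] by (intro mult_right_mono) auto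
  then show ?thesis by (simp add: form_add abs_mult mult_ac)
qed

text \<open>Going back in time costs at most \<open>q^(p wmax)\<close> in the linear part and
  \<open>q^p\<close> in the form, together \<open>R^p\<close>.\<close>

lemma vol_form_shrink:
  assumes as: "prim as" "as \<noteq> []" and E: "E * norm (lin (n + p) v) \<le> vol (n + p) as * \<bar>form (n + p) z v\<bar>" "0 \<le> E"
  shows "R powr - real p * E * norm (lin n v) \<le> vol n as * \<bar>form n z v\<bar>"
proof -
  have "R powr - (real p * \<kappa>) \<le> R powr 0" using R1 \<kappa>_pos by (intro powr_mono) auto
  then have v: "vol (n + p) as \<le> vol n as"
    using vol_add_le[OF as, of n p] mult_right_mono[of "R powr - (real p * \<kappa>)" 1 "vol n as"] vol_nonneg[of n as] R1 by simp
  have "E * norm (lin n v) \<le> E * (q powr (real p * wmax) * norm (lin (n + p) v))"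
    using E(2) by (intro mult_left_mono norm_lin_le_add)
  also have "\<dots> = q powr (real p * wmax) * (E * norm (lin (n + p) v))" by simp
  also have "\<dots> \<le> q powr (real p * wmax) * (vol (n + p) as * \<bar>form (n + p) z v\<bar>)"
    using E(1) by (intro mult_left_mono) auto
  also have "\<dots> \<le> q powr (real p * wmax) * (vol n as * \<bar>form (n + p) z v\<bar>)"
    using v by (intro mult_left_mono mult_right_mono) auto
  also have "\<dots> = (q powr (real p * wmax) * q powr real p) * (vol n as * \<bar>form n z v\<bar>)"
    by (simp add: form_add abs_mult)
  also have "q powr (real p * wmax) * q powr real p = R powr real p"
    by (simp add: powr_add[symmetric] q_powr_1_wmax[symmetric] algebra_simps)
  finally have "E * norm (lin n v) \<le> R powr real p * (vol n as * \<bar>form n z v\<bar>)" .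
  then have "R powr - real p * (E * norm (lin n v)) \<le> R powr - real p * (R powr real p * (vol n as * \<bar>form n z v\<bar>))"
    by (intro mult_left_mono) auto
  also have "\<dots> = vol n as * \<bar>form n z v\<bar>" using R1 by (simp add: powr_minus)
  finally show ?thesis by (simp add: mult.assoc)
qed

text \<open>This is why only the first time below the volume threshold matters: linear parts shrink
  at rate \<open>\<kappa>\<close>, while the required exponent grows by at most
  \<open>\<kappa> / 2\<close> per step.\<close>

lemma ctrl_mono:
  assumes as: "prim as" "e0 \<notin> span (set as)" and mn: "m \<le> n + lf"
    and less: "vol n as < R powr - (\<gamma> (length as) * real (n + L - m))" and "ctrl m n as c"
  shows "ctrl m (n + p) as c"
  unfolding ctrl_def
proof
  let ?j = "length as"
  let ?e = "\<lambda>n. (\<theta> ?j - \<gamma> ?j) * real (n + L - m) - \<theta> 0 * real L"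
  have j: "?j \<le> Suc d" using length_prim_le[OF as] by simp
  obtain z v where zv: "z \<in> cball c (R powr - real m)" "v \<in> span (set as)" "v \<noteq> 0"
    "R powr ?e n * norm (lin n v) \<le> vol n as * \<bar>form n z v\<bar>"
    using assms(5) less unfolding ctrl_def by blast
  have ex: "?e (n + p) \<le> ?e n + \<kappa> * real p"
  proof -
    have "real (n + p + L - m) = real (n + L - m) + real p" using mn lf_le_L by simp
    moreover have "(\<theta> ?j - \<gamma> ?j) * real p \<le> \<kappa> * real p" using \<eta>_bds[OF j] \<kappa>_pos by (intro mult_right_mono) auto
    ultimately show ?thesis by (simp add: algebra_simps)
  qed
  have "R powr ?e (n + p) * norm (lin (n + p) v) \<le> R powr ?e (n + p) * (R powr - (\<kappa> * real p) * norm (lin n v))"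
    using norm_lin_add_le_span[OF as(1) zv(2)] by (intro mult_left_mono) auto
  also have "\<dots> = R powr (?e (n + p) - \<kappa> * real p) * norm (lin n v)" by (simp add: powr_add[symmetric] mult.assoc[symmetric])
  also have "\<dots> \<le> R powr ?e n * norm (lin n v)" using ex R1 by (intro mult_right_mono powr_mono) auto
  also have "\<dots> \<le> vol (n + p) as * \<bar>form (n + p) z v\<bar>"
    using zv(4) vol_form_grow[OF as, of n z v p] by linarith
  finally show "\<exists>z\<in>cball c (R powr - real m). \<exists>v\<in>span (set as). v \<noteq> 0 \<and>
     R powr ?e (n + p) * norm (lin (n + p) v) \<le> vol (n + p) as * \<bar>form (n + p) z v\<bar>"
    using zv by blast
qed

text \<open>The values at the two antipodal points in the direction of the gradient differ by twice
  the claimed bound.\<close>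

lemma form_large_somewhere:
  assumes "fst v \<noteq> 0" "0 < r"
  shows "\<exists>z\<in>cball c r. r * norm (lin 0 v) \<le> \<bar>form 0 z v\<bar>"
proof -
  define u where "u = (r / norm (fst v)) *\<^sub>R fst v"
  have u: "norm u = r" using assms by (simp add: u_def)
  have "fst v \<bullet> u = r * norm (fst v)"
    using assms by (simp add: u_def power2_norm_eq_inner[symmetric] power2_eq_square)
  then have "form 0 (c + u) v - form 0 (c - u) v = 2 * (r * norm (lin 0 v))"
    using q1 by (simp add: form_def lin_0 inner_add_right inner_diff_right)
  then have "r * norm (lin 0 v) \<le> \<bar>form 0 (c + u) v\<bar> \<or> r * norm (lin 0 v) \<le> \<bar>form 0 (c - u) v\<bar>" by linarith
  moreover have "c + u \<in> cball c r" "c - u \<in> cball c r" using u by (auto simp: dist_norm)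
  ultimately show ?thesis by blast
qed

text \<open>At time 0 the volume is at least 1, and a form reaches \<open>R^-m\<close> times its
  linear part on the ball. Until time \<open>n\<close> the linear part shrinks by
  \<open>R^(-\<kappa> n)\<close>, which suffices as long as \<open>m\<close> is at most about
  \<open>\<kappa> n / 2\<close>.\<close>

lemma ctrl_initial:
  assumes as: "prim as" "e0 \<notin> span (set as)" "as \<noteq> []" and mn: "m \<le> n + lf"
    and m: "real m \<le> \<kappa> / 2 * real n + g * real L"
  shows "ctrl m n as c"
  unfolding ctrl_def
proof
  let ?j = "length as"
  let ?\<eta> = "\<theta> ?j - \<gamma> ?j"
  have j: "1 \<le> ?j" "?j \<le> d" using length_prim_le[OF as(1,2)] as(3) by (auto simp: Suc_le_eq)
  obtain v where v: "v \<in> set as" using as(3) by (cases as) auto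
  have "v \<noteq> 0"
  proof
    assume "v = 0"
    then have "dependent (set as)" using v by (metis dependent_zero)
    then show False using as(1) by (simp add: prim_def gram_pos_iff)
  qed
  then have "lin 0 v \<noteq> 0" using span_lin_0[OF as(2) span_base[OF v]] by blast
  then have "fst v \<noteq> 0" by (simp add: lin_eq_0_iff)
  then obtain z where z: "z \<in> cball c (R powr - real m)" "R powr - real m * norm (lin 0 v) \<le> \<bar>form 0 z v\<bar>"
    using form_large_somewhere[of v "R powr - real m" c] R1 by auto
  have x: "real (n + L - m) = real n + real L - real m" using mn lf_le_L by simp
  have "?\<eta> * real (n + L - m) - \<theta> 0 * real L \<le> \<kappa> * real n - real m"
  proof -
    have "0 \<le> ?\<eta> * real m" "?\<eta> * real n \<le> \<kappa> / 2 * real n" "\<theta> ?j * real L \<le> \<theta> 0 * real L" "g * real L \<le> \<gamma> ?j * real L"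
      using \<eta>_bds[of ?j] \<kappa>_pos j \<theta>_le[of ?j] \<theta>_0 \<gamma>_ge[of ?j]
      by (intro mult_right_mono mult_nonneg_nonneg; linarith | simp)+
    then show ?thesis using m unfolding x by (simp add: algebra_simps)
  qed
  then have "R powr (?\<eta> * real (n + L - m) - \<theta> 0 * real L) \<le> R powr (\<kappa> * real n - real m)"
    using R1 by (intro powr_mono) auto
  moreover have "norm (lin n v) \<le> R powr - (\<kappa> * real n) * norm (lin 0 v)"
    using norm_lin_add_le_span[OF as(1) span_base[OF v], of 0 n] by simp
  ultimately have "R powr (?\<eta> * real (n + L - m) - \<theta> 0 * real L) * norm (lin n v)
      \<le> R powr (\<kappa> * real n - real m) * (R powr - (\<kappa> * real n) * norm (lin 0 v))"
    by (intro mult_mono) auto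
  also have "\<dots> = R powr - real m * norm (lin 0 v)" by (simp add: powr_add[symmetric] mult.assoc[symmetric])
  also have "\<dots> \<le> 1 * \<bar>form 0 z v\<bar>" using z(2) by simp
  also have "\<dots> \<le> vol 0 as * \<bar>form 0 z v\<bar>" using vol_0_ge_1[OF as(1,2)] by (intro mult_right_mono) auto
  also have "\<dots> \<le> vol n as * \<bar>form n z v\<bar>" using vol_form_grow[OF as(1,2), of 0 z v n] by simp
  finally show "\<exists>z\<in>cball c (R powr - real m). \<exists>v\<in>span (set as). v \<noteq> 0 \<and>
     R powr (?\<eta> * real (n + L - m) - \<theta> 0 * real L) * norm (lin n v) \<le> vol n as * \<bar>form n z v\<bar>"
    using z(1) span_base[OF v] \<open>v \<noteq> 0\<close> by blast
qed

lemma ctrl_Nil: "ctrl m n [] c"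
  by (simp add: ctrl_def vol_def \<gamma>_def)

lemma good_1: "good 1 c"
  unfolding good_def
proof (intro allI impI)
  fix n as assume "1 \<le> n + lf" "prim as" "e0 \<notin> span (set as)"
  moreover have "real 1 \<le> \<kappa> / 2 * real n + g * real L"
  proof -
    have "32 * \<nu> * real L \<le> g * real L" using \<nu>_j[of 1] by (intro mult_right_mono) auto
    moreover have "0 \<le> \<kappa> / 2 * real n" using \<kappa>_pos by simp
    ultimately show ?thesis using L_ge(1) by simp
  qed
  ultimately show "ctrl 1 n as c" using ctrl_initial ctrl_Nil by (cases "as = []") blast+
qed

text \<open>A time \<open>n = m - lf\<close> at which the volume was small already one step earlier is
  controlled by the parent ball, on which the forms hardly vary.\<close>

lemma ctrl_floor:
  assumes good: "good m c'" and y: "c \<in> cball c' (R powr - real m)" and n: "m = n + lf"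
    and as: "prim as" "e0 \<notin> span (set as)"
    and less: "vol n as < R powr - (\<gamma> (length as) * real (L - lf))"
  shows "ctrl (Suc m) (Suc n) as c"
  unfolding ctrl_def
proof
  let ?j = "length as"
  let ?e = "(\<theta> ?j - \<gamma> ?j) * real (L - lf) - \<theta> 0 * real L"
  have x: "n + L - m = L - lf" "Suc n + L - Suc m = L - lf" using n lf_le_L by auto
  have jd: "?j \<le> d" using length_prim_le[OF as] .
  have "ctrl m n as c'" using good as n unfolding good_def by blast
  then obtain z v where zv: "z \<in> cball c' (R powr - real m)" "v \<in> span (set as)" "v \<noteq> 0"
    "R powr ?e * norm (lin n v) \<le> vol n as * \<bar>form n z v\<bar>"
    using less unfolding ctrl_def x by blast
  have nv: "0 < norm (lin n v)" using span_lin_0[OF as(2) zv(2)] zv(3) by auto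
  have big: "R powr (\<theta> ?j * real (L - lf) - \<theta> 0 * real L) * norm (lin n v) \<le> \<bar>form n z v\<bar>"
  proof -
    have "vol n as * \<bar>form n z v\<bar> \<le> R powr - (\<gamma> ?j * real (L - lf)) * \<bar>form n z v\<bar>"
      using less by (intro mult_right_mono) auto
    then have "R powr ?e * norm (lin n v) \<le> R powr - (\<gamma> ?j * real (L - lf)) * \<bar>form n z v\<bar>" using zv(4) by linarith
    then have "R powr (\<gamma> ?j * real (L - lf)) * (R powr ?e * norm (lin n v))
        \<le> R powr (\<gamma> ?j * real (L - lf)) * (R powr - (\<gamma> ?j * real (L - lf)) * \<bar>form n z v\<bar>)"
      by (intro mult_left_mono) auto
    moreover have "R powr (\<gamma> ?j * real (L - lf)) * R powr ?e = R powr (\<theta> ?j * real (L - lf) - \<theta> 0 * real L)"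
      by (simp add: powr_add[symmetric] left_diff_distrib)
    moreover have "R powr (\<gamma> ?j * real (L - lf)) * R powr - (\<gamma> ?j * real (L - lf)) = 1"
      using R1 by (simp add: powr_add[symmetric])
    ultimately show ?thesis by (simp only: mult.assoc[symmetric] mult_1_left)
  qed
  have "dist z c \<le> 2 * R powr - real m"
    using zv(1) y dist_triangle[of z c c'] by (simp add: dist_commute)
  then have "\<bar>form n z v - form n c v\<bar> \<le> R powr real n * (2 * R powr - real m) * norm (lin n v)"
    by (rule form_diff_le)
  also have "R powr real n * (2 * R powr - real m) = 2 * R powr - real lf"
    by (simp add: n powr_add[symmetric])
  \<comment> \<open>By \<open>exponent_floor\<close> and \<open>4 \<le> R\<close> the variation is
    at most half of the required slope, so the new centre \<open>c\<close> can serve as the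
    witness.\<close>
  also have "2 * R powr - real lf \<le> R powr (\<theta> ?j * real (L - lf) - \<theta> 0 * real L) / 2"
  proof -
    have "4 * R powr - real lf \<le> R powr 1 * R powr - real lf" using R4 by (intro mult_right_mono) auto
    also have "\<dots> = R powr (1 - real lf)" by (simp only: powr_add[symmetric] add_uminus_conv_diff)
    also have "\<dots> \<le> R powr (\<theta> ?j * real (L - lf) - \<theta> 0 * real L)"
      using exponent_floor[OF jd] R1 lf_le_L by (intro powr_mono) (auto simp: of_nat_diff)
    finally show ?thesis by simp
  qed
  finally have "\<bar>form n z v - form n c v\<bar> \<le> R powr (\<theta> ?j * real (L - lf) - \<theta> 0 * real L) / 2 * norm (lin n v)"
    using nv by simp
  then have half: "\<bar>form n z v\<bar> \<le> 2 * \<bar>form n c v\<bar>" using big by linarith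
  have "R powr ?e * norm (lin (Suc n) v) \<le> R powr ?e * (R powr - \<kappa> * norm (lin n v))"
    using norm_lin_add_le_span[OF as(1) zv(2), of n 1] by (intro mult_left_mono) auto
  also have "\<dots> = R powr - \<kappa> * (R powr ?e * norm (lin n v))" by simp
  \<comment> \<open>The distance \<open>x\<close> is the same for \<open>(m, n)\<close> and
    \<open>(m + 1, n + 1)\<close>, so the threshold does not move, and the contraction of the linear
    part makes up for the lost factor 2.\<close>
  also have "\<dots> \<le> (1/2) * (R powr ?e * norm (lin n v))"
    using R_ge(2) R1 by (intro mult_right_mono) (auto simp: powr_minus field_simps)
  also have "(1/2) * (R powr ?e * norm (lin n v)) \<le> (1/2) * (vol n as * \<bar>form n z v\<bar>)"
    using zv(4) by simp
  also have "\<dots> \<le> (1/2) * (vol n as * (2 * \<bar>form n c v\<bar>))"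
    using half by (intro mult_left_mono vol_nonneg) auto
  also have "\<dots> \<le> vol (Suc n) as * \<bar>form (Suc n) c v\<bar>" using vol_form_grow[OF as, of n c v 1] by simp
  finally show "\<exists>z\<in>cball c (R powr - real (Suc m)). \<exists>v\<in>span (set as). v \<noteq> 0 \<and>
     R powr ((\<theta> ?j - \<gamma> ?j) * real (Suc n + L - Suc m) - \<theta> 0 * real L) * norm (lin (Suc n) v)
      \<le> vol (Suc n) as * \<bar>form (Suc n) z v\<bar>"
    using zv(2,3) R1 unfolding x by (intro bexI[of _ c] bexI[of _ v]) auto
qed

text \<open>What a failure leaves behind. The window for the volume turns small products into small
  slopes (\<open>fails_slope\<close>), and the gap \<open>R^(\<kappa> h / 8)\<close> between the
  last two clauses becomes the relative width of the slab in \<open>card_fails_le\<close>.\<close>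

definition fails :: "nat \<Rightarrow> nat \<Rightarrow> nat \<Rightarrow> real ^ 'd \<Rightarrow> real ^ 'd \<Rightarrow> ((real ^ 'd) \<times> real) list \<Rightarrow> bool" where
  "fails m h n c y as \<longleftrightarrow> m \<le> n + lf \<and> h = (n + L - m) div K + 1 \<and> prim as \<and> e0 \<notin> span (set as) \<and> as \<noteq> [] \<and>
     R powr (- 1 - \<gamma> (length as) * real (n + L - m)) \<le> vol n as \<and>
     vol n as < R powr - (\<gamma> (length as) * real (n + L - m)) \<and>
     (\<forall>z\<in>cball y (R powr - real m). \<forall>v\<in>span (set as). v \<noteq> 0 \<longrightarrow>
       vol n as * \<bar>form n z v\<bar> < R powr ((\<theta> (length as) - \<gamma> (length as)) * real (n + L - m) - \<theta> 0 * real L) * norm (lin n v)) \<and>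
     (\<exists>z\<in>cball c (R powr - real (m - h)). \<exists>v\<in>span (set as). v \<noteq> 0 \<and>
       R powr ((\<theta> (length as) - \<gamma> (length as)) * real (n + L - m) + \<kappa> / 8 * real h - \<theta> 0 * real L) * norm (lin n v)
         \<le> vol n as * \<bar>form n z v\<bar>)"

text \<open>By \<open>ctrl_mono\<close> the failure can be moved to the first time the volume is
  below the threshold. One step earlier it was not, which gives the window; the gap comes from the
  control that the ancestor provides at a slightly later time.\<close>

lemma not_good_imp_fails:
  assumes m: "1 \<le> m" and hist: "\<And>k. 1 \<le> k \<Longrightarrow> k < m \<Longrightarrow> good k (ctr k)"
    and y: "2 \<le> m \<Longrightarrow> y \<in> cball (ctr (m - 1)) (R powr - real (m - 1))" and bad: "\<not> good m y"
  shows "\<exists>h n as. 1 \<le> h \<and> h < m \<and> fails m h n (ctr (m - h)) y as"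
proof -
  obtain n0 as where n0: "m \<le> n0 + lf" and as: "prim as" "e0 \<notin> span (set as)" and nc0: "\<not> ctrl m n0 as y"
    using bad unfolding good_def by blast
  have ne: "as \<noteq> []" using nc0 ctrl_Nil by blast
  define j where "j = length as"
  have jd: "1 \<le> j" "j \<le> d" using length_prim_le[OF as] ne by (auto simp: j_def Suc_le_eq)
  define Q where "Q n \<longleftrightarrow> m \<le> n + lf \<and> vol n as < R powr - (\<gamma> j * real (n + L - m))" for n
  have "Q n0" using nc0 n0 unfolding Q_def ctrl_def j_def by blast
  define n where "n = (LEAST n. Q n)"
  have Qn: "Q n" unfolding n_def using \<open>Q n0\<close> by (rule LeastI)
  have least: "\<not> Q k" if "k < n" for k using that not_less_Least unfolding n_def by blast
  have "n \<le> n0" unfolding n_def using \<open>Q n0\<close> by (rule Least_le)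
  define x where "x = n + L - m"
  have mn: "m \<le> n + lf" and less: "vol n as < R powr - (\<gamma> j * real x)" using Qn by (auto simp: Q_def x_def)
  have nc: "\<not> ctrl m n as y"
    using ctrl_mono[OF as mn, of y "n0 - n"] less nc0 \<open>n \<le> n0\<close> by (auto simp: j_def x_def)
  define h where "h = x div K + 1"
  note ex = mn x_def h_def
  have n1: "1 \<le> n"
  proof (rule ccontr)
    assume "\<not> 1 \<le> n"
    then have "1 \<le> vol n as" using vol_0_ge_1[OF as] by (simp add: not_le)
    moreover have "R powr - (\<gamma> j * real x) \<le> R powr 0"
      using \<gamma>_nonneg[of j] jd R1 by (intro powr_mono) auto
    ultimately show False using less R1 by simp
  qed
  have lower: "R powr (- 1 - \<gamma> j * real x) \<le> vol n as"
  proof -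
    have prev: "R powr - (\<gamma> j * real x) \<le> vol (n - 1) as"
    proof (cases "m \<le> n - 1 + lf")
      case True
      then have "R powr - (\<gamma> j * real (n - 1 + L - m)) \<le> vol (n - 1) as"
        using least[of "n - 1"] n1 by (auto simp: Q_def not_less)
      moreover have "\<gamma> j * real (n - 1 + L - m) \<le> \<gamma> j * real x"
        using \<gamma>_nonneg[of j] jd by (intro mult_left_mono) (auto simp: x_def)
      then have "R powr - (\<gamma> j * real x) \<le> R powr - (\<gamma> j * real (n - 1 + L - m))" using R1 by (intro powr_mono) auto
      ultimately show ?thesis by linarith
    next
      \<comment> \<open>Here \<open>n = m - lf\<close> is the first admissible time and its
        minimality says nothing about \<open>n - 1\<close>. A small volume at \<open>n - 1\<close>
        is excluded by \<open>ctrl_floor\<close> on the parent ball.\<close>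
      case False
      then have m': "m = n + lf" using mn n1 by simp
      then have x': "x = L - lf" by (simp add: x_def)
      show ?thesis
      proof (rule ccontr)
        assume "\<not> ?thesis"
        then have "vol (n - 1) as < R powr - (\<gamma> (length as) * real (L - lf))" by (simp add: j_def x')
        moreover have m2: "2 \<le> m" using m' n1 lf_le_L by simp
        ultimately have "ctrl (Suc (m - 1)) (Suc (n - 1)) as y"
          using hist[of "m - 1"] y m' n1 by (intro ctrl_floor as) auto
        then show False using nc n1 m2 by simp
      qed
    qed
    have "R powr (- 1 - \<gamma> j * real x) = R powr - 1 * R powr - (\<gamma> j * real x)"
      by (simp only: powr_add[symmetric] add_uminus_conv_diff)
    also have "\<dots> \<le> R powr - 1 * vol (n - 1) as" using prev by (intro mult_left_mono) auto
    also have "\<dots> \<le> R powr - 1 * (q * vol n as)"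
      using vol_le_add[OF as, of "n - 1" 1] n1 q1 by (intro mult_left_mono) auto
    also have "\<dots> = (q / R) * vol n as" using R1 by (simp add: powr_minus field_simps)
    also have "\<dots> \<le> 1 * vol n as" using q_le_R R1 by (intro mult_right_mono vol_nonneg) auto
    finally show ?thesis by simp
  qed
  \<comment> \<open>Failure is possible only when \<open>m\<close> is large compared with
    \<open>n\<close>; this guarantees that the ancestor \<open>h\<close> levels up exists.\<close>
  have late: "\<kappa> / 2 * real n + g * real L < real m"
    using ctrl_initial[OF as ne mn] nc by force
  have h: "1 \<le> h" "h < m"
  proof -
    show "1 \<le> h" by (simp add: h_def)
    have K: "0 < real K" using K_ge \<nu>_pos by (cases K) auto
    have xx: "real x \<le> real n + real L" using x_ge(2)[OF ex] by simp
    have \<nu>\<kappa>: "\<nu> \<le> \<kappa>" "32 * \<nu> \<le> g" using \<nu>_j[of 1] g_small \<kappa>_pos by auto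
    have "real h + 10 \<le> \<nu> * real x / 2" by (rule h_bds(1)[OF ex])
    also have "\<nu> * real x / 2 \<le> \<nu> * (real n + real L) / 2" using xx \<nu>_pos by (intro divide_right_mono mult_left_mono) auto
    also have "\<dots> \<le> \<kappa> / 2 * real n + g * real L"
    proof -
      have "\<nu> * real n \<le> \<kappa> * real n" using \<nu>\<kappa> by (intro mult_right_mono) auto
      moreover have "\<nu> * real L \<le> 2 * g * real L" using \<nu>\<kappa> \<nu>_pos by (intro mult_right_mono) auto
      ultimately show ?thesis by (simp add: algebra_simps)
    qed
    finally show "h < m" using late by simp
  qed
  have fail: "\<forall>z\<in>cball y (R powr - real m). \<forall>v\<in>span (set as). v \<noteq> 0 \<longrightarrow>
       vol n as * \<bar>form n z v\<bar> < R powr ((\<theta> j - \<gamma> j) * real x - \<theta> 0 * real L) * norm (lin n v)"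
    using nc unfolding ctrl_def by (auto simp: j_def x_def not_le)
  have "\<exists>z\<in>cball (ctr (m - h)) (R powr - real (m - h)). \<exists>v\<in>span (set as). v \<noteq> 0 \<and>
       R powr ((\<theta> j - \<gamma> j) * real x + \<kappa> / 8 * real h - \<theta> 0 * real L) * norm (lin n v)
         \<le> vol n as * \<bar>form n z v\<bar>"
  proof -
    \<comment> \<open>After the delay \<open>p\<close> the volume has also dropped below the
      threshold of the ancestor, which is lower by about \<open>\<gamma> j * h\<close>. Returning to
      time \<open>n\<close> costs \<open>R^-p\<close>, a small part of the gain
      \<open>R^(\<kappa> h / 4)\<close>.\<close>
    define p where "p = nat \<lceil>\<kappa> / 64 * real h\<rceil>"
    have p: "\<kappa> / 64 * real h \<le> real p" "real p \<le> \<kappa> / 64 * real h + 1"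
    proof -
      have "0 \<le> \<kappa> / 64 * real h" using \<kappa>_pos by simp
      then show "\<kappa> / 64 * real h \<le> real p" "real p \<le> \<kappa> / 64 * real h + 1" unfolding p_def by linarith+
    qed
    let ?\<mu> = "m - h"
    have xp: "n + p + L - ?\<mu> = x + h + p" using h mn lf_le_L by (simp add: x_def)
    have "vol (n + p) as \<le> R powr - (real p * \<kappa>) * vol n as" by (rule vol_add_le[OF as(1) ne])
    also have "\<dots> < R powr - (real p * \<kappa>) * R powr - (\<gamma> j * real x)" using less R1 by (intro mult_strict_left_mono) auto
    also have "\<dots> = R powr - (real p * \<kappa> + \<gamma> j * real x)" by (simp add: powr_add[symmetric])
    also have "\<dots> \<le> R powr - (\<gamma> j * real (x + h + p))"
    proof -
      have "\<gamma> j * real h \<le> \<kappa> * (\<kappa> / 2) / 64 * real h" using \<gamma>_le[of j] jd by (intro mult_right_mono) auto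
      also have "\<dots> = \<kappa> / 2 * (\<kappa> / 64 * real h)" by simp
      also have "\<dots> \<le> \<kappa> / 2 * real p" using p \<kappa>_pos by (intro mult_left_mono) auto
      finally have "\<gamma> j * real h \<le> \<kappa> / 2 * real p" .
      moreover have "\<gamma> j * real p \<le> \<kappa> / 2 * real p" using \<gamma>_le'(1)[of j] jd \<kappa>_pos by (intro mult_right_mono) auto
      ultimately have "\<gamma> j * real (x + h + p) \<le> real p * \<kappa> + \<gamma> j * real x" by (simp add: algebra_simps)
      then show ?thesis using R1 by (intro powr_mono) auto
    qed
    finally have "vol (n + p) as < R powr - (\<gamma> j * real (n + p + L - ?\<mu>))" by (simp add: xp)
    moreover have "ctrl ?\<mu> (n + p) as (ctr ?\<mu>)"
      using hist[of ?\<mu>] h mn as unfolding good_def by force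
    ultimately obtain z v where zv: "z \<in> cball (ctr ?\<mu>) (R powr - real ?\<mu>)" "v \<in> span (set as)" "v \<noteq> 0"
      "R powr ((\<theta> j - \<gamma> j) * real (x + h + p) - \<theta> 0 * real L) * norm (lin (n + p) v) \<le> vol (n + p) as * \<bar>form (n + p) z v\<bar>"
      unfolding ctrl_def j_def xp by blast
    have "R powr ((\<theta> j - \<gamma> j) * real x + \<kappa> / 8 * real h - \<theta> 0 * real L) * norm (lin n v)
       \<le> R powr (- real p + ((\<theta> j - \<gamma> j) * real (x + h + p) - \<theta> 0 * real L)) * norm (lin n v)"
    proof -
      have "\<kappa> / 4 * real h \<le> (\<theta> j - \<gamma> j) * real h" "0 \<le> (\<theta> j - \<gamma> j) * real p"
        using \<eta>_bds(1)[of j] jd \<kappa>_pos by (intro mult_right_mono mult_nonneg_nonneg; linarith | simp)+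
      moreover have "6 \<le> \<kappa> / 2 * real h" by (rule h_bds(2)[OF ex])
      ultimately have "\<kappa> / 8 * real h + real p \<le> (\<theta> j - \<gamma> j) * real h + (\<theta> j - \<gamma> j) * real p" using p(2) by linarith
      then show ?thesis using R1 by (intro mult_right_mono powr_mono) (auto simp: algebra_simps)
    qed
    also have "\<dots> = R powr - real p * R powr ((\<theta> j - \<gamma> j) * real (x + h + p) - \<theta> 0 * real L) * norm (lin n v)"
      by (simp only: powr_add)
    also have "\<dots> \<le> vol n as * \<bar>form n z v\<bar>" using vol_form_shrink[OF as(1) ne zv(4)] by simp
    finally show ?thesis using zv by blast
  qed
  then have "fails m h n (ctr (m - h)) y as"
    unfolding fails_def using mn as ne lower less fail by (simp add: j_def x_def h_def)
  then show ?thesis using h by blast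
qed

text \<open>Affine functions extrapolate: pulling \<open>z\<close> towards \<open>y\<close> with
  ratio \<open>t = R^-h / 2\<close> lands in the failing ball. Undoing this costs
  \<open>4 R^h\<close>, and dividing by the volume, known up to a factor \<open>R\<close>, costs one
  more \<open>R\<close>; this is the origin of \<open>h + 2\<close>.\<close>

lemma fails_slope:
  assumes f: "fails (\<mu> + h) h n c y as" and sub: "cball y (R powr - real (\<mu> + h)) \<subseteq> cball c (R powr - real \<mu>)"
    and z: "z \<in> cball c (R powr - real \<mu>)" and v: "v \<in> span (set as)"
  shows "\<bar>form n z v\<bar> \<le> R powr (real h + 2 + \<theta> (length as) * real (n + L - (\<mu> + h)) - \<theta> 0 * real L) * norm (lin n v)"
proof (cases "v = 0")
  case False
  define j where "j = length as"
  define x where "x = n + L - (\<mu> + h)"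
  define r where "r = R powr - real (\<mu> + h)"
  define t where "t = R powr - real h / 2"
  define E where "E = R powr ((\<theta> j - \<gamma> j) * real x - \<theta> 0 * real L)"
  have r: "0 < r" using R1 by (simp add: r_def)
  have t: "0 < t" "t \<le> 1"
    using R1 powr_mono[of "- real h" 0 R] by (auto simp: t_def)
  have as: "prim as" "e0 \<notin> span (set as)" using f by (auto simp: fails_def)
  have V: "R powr (- 1 - \<gamma> j * real x) \<le> vol n as" "0 < vol n as"
    using f vol_pos[OF as] by (auto simp: fails_def j_def x_def)
  have small: "vol n as * \<bar>form n z' v\<bar> < E * norm (lin n v)" if "z' \<in> cball y r" for z'
    using f that v False unfolding fails_def E_def j_def x_def r_def by blast
  have "y \<in> cball y r" using r by simp
  then have "y \<in> cball c (R powr - real \<mu>)" using sub unfolding r_def by blast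
  then have "norm (z - y) \<le> 2 * R powr - real \<mu>"
    using z dist_triangle[of z y c] by (simp add: dist_commute dist_norm[symmetric])
  then have "t * norm (z - y) \<le> t * (2 * R powr - real \<mu>)" using t by (intro mult_left_mono) auto
  also have "\<dots> = r" by (simp add: t_def r_def powr_add[symmetric] add.commute)
  finally have mem: "y + t *\<^sub>R (z - y) \<in> cball y r" using t by (simp add: dist_norm)
  have "form n (y + t *\<^sub>R (z - y)) v = (1 - t) * form n y v + t * form n z v"
    by (simp add: form_def inner_add_right inner_diff_right algebra_simps)
  then have "t * form n z v = form n (y + t *\<^sub>R (z - y)) v - (1 - t) * form n y v" by simp
  then have "t * \<bar>form n z v\<bar> = \<bar>form n (y + t *\<^sub>R (z - y)) v - (1 - t) * form n y v\<bar>"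
    using t by (metis abs_mult abs_of_pos)
  also have "\<dots> \<le> \<bar>form n (y + t *\<^sub>R (z - y)) v\<bar> + \<bar>(1 - t) * form n y v\<bar>" by (rule abs_triangle_ineq4)
  also have "\<bar>(1 - t) * form n y v\<bar> \<le> 1 * \<bar>form n y v\<bar>"
    using t unfolding abs_mult by (intro mult_right_mono) auto
  finally have "vol n as * (t * \<bar>form n z v\<bar>) \<le> vol n as * (\<bar>form n (y + t *\<^sub>R (z - y)) v\<bar> + 1 * \<bar>form n y v\<bar>)"
    using V by (intro mult_left_mono) auto
  also have "\<dots> \<le> 2 * (E * norm (lin n v))"
    using small[OF mem] small[OF \<open>y \<in> cball y r\<close>] by (simp add: algebra_simps)
  finally have le: "vol n as * (t * \<bar>form n z v\<bar>) \<le> 2 * (E * norm (lin n v))" .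
  have "R powr (- 1 - \<gamma> j * real x) * (t * \<bar>form n z v\<bar>) \<le> vol n as * (t * \<bar>form n z v\<bar>)"
    using V t by (intro mult_right_mono) auto
  with le have "R powr (- 1 - \<gamma> j * real x) * (R powr - real h * \<bar>form n z v\<bar>) \<le> 4 * (E * norm (lin n v))"
    by (simp add: t_def)
  also have "\<dots> \<le> R powr 1 * (E * norm (lin n v))"
    using R4 by (intro mult_right_mono) (auto simp: E_def)
  finally have "R powr (1 + \<gamma> j * real x + real h) * (R powr (- 1 - \<gamma> j * real x) * (R powr - real h * \<bar>form n z v\<bar>))
     \<le> R powr (1 + \<gamma> j * real x + real h) * (R powr 1 * (E * norm (lin n v)))"
    by (intro mult_left_mono) auto
  moreover have "R powr (1 + \<gamma> j * real x + real h) * R powr (- 1 - \<gamma> j * real x) * R powr - real h = 1"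
    using R1 by (simp add: powr_add[symmetric])
  moreover have "R powr (1 + \<gamma> j * real x + real h) * R powr 1 * E = R powr (real h + 2 + \<theta> j * real x - \<theta> 0 * real L)"
    unfolding E_def powr_add[symmetric] by (rule arg_cong[of _ _ "(powr) R"]) (simp add: algebra_simps)
  ultimately have "\<bar>form n z v\<bar> \<le> R powr (real h + 2 + \<theta> j * real x - \<theta> 0 * real L) * norm (lin n v)"
    by (simp only: mult.assoc[symmetric] mult_1_left)
  then show ?thesis by (simp add: j_def x_def)
qed (simp add: linear_0[OF linear_form])

lemma fails_unique:
  assumes good: "good \<mu> c" and a: "fails (\<mu> + h) h n c y as" and b: "fails (\<mu> + h) h n c y' bs"
    and len: "length as = length bs"
    and sub: "cball y (R powr - real (\<mu> + h)) \<subseteq> cball c (R powr - real \<mu>)"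
      "cball y' (R powr - real (\<mu> + h)) \<subseteq> cball c (R powr - real \<mu>)"
  shows "span (set as) = span (set bs)"
proof (rule dangerous_unique[OF good _ refl])
  fix z v assume "z \<in> cball c (R powr - real \<mu>)" "v \<in> span (set as) \<union> span (set bs)"
  then show "\<bar>form n z v\<bar> \<le> R powr (real h + 2 + \<theta> (length as) * real (n + L - (\<mu> + h)) - \<theta> 0 * real L) * norm (lin n v)"
    using fails_slope[OF a sub(1), of z v] fails_slope[OF b sub(2), of z v] len by fastforce
qed (use a b len in \<open>auto simp: fails_def\<close>)

end

section \<open>The Cantor construction\<close>

context cantor_exponents
begin

text \<open>The thresholds of rank one at \<open>x = L - lf\<close>; the half allows for the
  variation of a form across the ball.\<close>

definition form_floor :: real where
  "form_floor = min 1 (min (R powr - (\<gamma> 1 * real (L - lf)))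
     (R powr ((\<theta> 1 - \<gamma> 1) * real (L - lf) - \<theta> 0 * real L) / 2))"

lemma form_floor_pos: "0 < form_floor"
  using R1 by (simp add: form_floor_def)

lemma form_floor_le:
  "form_floor \<le> 1" "form_floor \<le> R powr - (\<gamma> 1 * real (L - lf))"
  "form_floor \<le> R powr ((\<theta> 1 - \<gamma> 1) * real (L - lf) - \<theta> 0 * real L) / 2"
  by (simp_all add: form_floor_def min_le_iff_disj)

text \<open>Control is used at the last level at which time \<open>n\<close> is still watched. There
  the ball is so small that a form large somewhere on it is large everywhere, and passing from
  \<open>v\<close> to the primitive vector \<open>b\<close> on its line only shrinks both
  quantities.\<close>

lemma good_forms_bounded_below:
  assumes good: "good (n + lf) c" and x: "x \<in> cball c (R powr - real (n + lf))"
    and v: "v \<in> lat" "v \<noteq> 0"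
  shows "form_floor \<le> norm (lin n v) \<or> form_floor \<le> \<bar>form n x v\<bar>"
proof (cases "fst v = 0")
  case True
  then have "snd v \<noteq> 0" using v(2) by (simp add: prod_eq_iff)
  moreover have "snd v \<in> \<int>" using v(1) by (simp add: lat_def)
  ultimately have "1 \<le> \<bar>snd v\<bar>" by (auto elim!: Ints_cases)
  moreover have "1 \<le> q powr real n" using q1 by (simp add: ge_one_powr_ge_zero)
  ultimately have "1 * 1 \<le> q powr real n * \<bar>snd v\<bar>" by (intro mult_mono) auto
  then have "1 \<le> \<bar>form n x v\<bar>" using True by (simp add: form_def abs_mult)
  then show ?thesis using form_floor_le(1) by linarith
next
  case False
  let ?e = "(\<theta> 1 - \<gamma> 1) * real (L - lf) - \<theta> 0 * real L"
  obtain b where b: "prim [b]" "span {b} = span {v}"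
    using prim_extend[OF prim_Nil v(1)] v(2) by auto
  have "v \<in> lat \<inter> span (set [b])" using v(1) b(2) span_base[of v "{v}"] by simp
  then obtain t where t: "v = real_of_int t *\<^sub>R b" using b(1) unfolding prim_def by fastforce
  then have t1: "1 \<le> \<bar>real_of_int t\<bar>" using v(2) by auto
  have e0: "e0 \<notin> span (set [b])"
  proof
    assume "e0 \<in> span (set [b])"
    then obtain k where k: "e0 = k *\<^sub>R b" by (auto simp: span_singleton)
    then have "k *\<^sub>R fst b = 0" by (metis e0_def fst_conv fst_scaleR)
    moreover have "k \<noteq> 0" using k by (auto simp: e0_def zero_prod_def)
    ultimately show False using False t by simp
  qed
  have vb: "vol n [b] = norm (lin n b)" by (simp add: vol_def gram_singleton)
  have nb: "0 < norm (lin n b)" using vol_pos[OF b(1) e0, of n] by (simp only: vb)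
  have L: "n + L - (n + lf) = L - lf" by simp
  have "form_floor \<le> norm (lin n b) \<or> form_floor \<le> \<bar>form n x b\<bar>"
  proof (cases "R powr - (\<gamma> 1 * real (L - lf)) \<le> norm (lin n b)")
    case True
    then show ?thesis using form_floor_le(2) by linarith
  next
    case small: False
    have "ctrl (n + lf) n [b] c" using good b(1) e0 unfolding good_def by blast
    then obtain z u where zu: "z \<in> cball c (R powr - real (n + lf))" "u \<in> span (set [b])" "u \<noteq> 0"
      "R powr ?e * norm (lin n u) \<le> vol n [b] * \<bar>form n z u\<bar>"
      using small unfolding ctrl_def L vb by auto
    then obtain k where k: "u = k *\<^sub>R b" by (auto simp: span_singleton)
    have "\<bar>k\<bar> * norm (lin n b) * R powr ?e \<le> \<bar>k\<bar> * norm (lin n b) * \<bar>form n z b\<bar>"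
      using zu(4) by (simp add: k vb linear_scale[OF linear_lin] linear_scale[OF linear_form] abs_mult mult_ac)
    moreover have "0 < \<bar>k\<bar> * norm (lin n b)" using zu(3) k nb by simp
    ultimately have big: "R powr ?e \<le> \<bar>form n z b\<bar>" by (rule mult_left_le_imp_le)
    have "dist z x \<le> 2 * R powr - real (n + lf)"
      using zu(1) x dist_triangle[of z x c] by (simp add: dist_commute)
    then have "\<bar>form n z b - form n x b\<bar> \<le> R powr real n * (2 * R powr - real (n + lf)) * norm (lin n b)"
      by (rule form_diff_le)
    also have "R powr real n * (2 * R powr - real (n + lf)) = 2 * R powr - real lf"
      by (simp add: powr_add[symmetric])
    also have "2 * R powr - real lf * norm (lin n b) \<le> 2 * R powr - real lf * R powr - (\<gamma> 1 * real (L - lf))"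
      using small by (intro mult_left_mono) auto
    also have "\<dots> \<le> R powr ?e / 2"
    proof -
      have "4 * R powr (- real lf - \<gamma> 1 * real (L - lf)) \<le> R powr 1 * R powr (- real lf - \<gamma> 1 * real (L - lf))"
        using R4 by (intro mult_right_mono) auto
      also have "\<dots> = R powr (1 + (- real lf - \<gamma> 1 * real (L - lf)))" by (simp only: powr_add)
      also have "\<dots> \<le> R powr ?e"
        using exponent_floor[of 1] card_supp R1 lf_le_L by (intro powr_mono) (auto simp: of_nat_diff algebra_simps)
      finally show ?thesis by (simp add: powr_add[symmetric])
    qed
    finally show ?thesis using big form_floor_le(3) by linarith
  qed
  moreover have "norm (lin n b) \<le> norm (lin n v)" "\<bar>form n x b\<bar> \<le> \<bar>form n x v\<bar>"
    using t1 mult_right_mono[OF t1, of "norm (lin n b)"] mult_right_mono[OF t1, of "\<bar>form n x b\<bar>"]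
    by (simp_all add: t linear_scale[OF linear_lin] linear_scale[OF linear_form] abs_mult)
  ultimately show ?thesis by linarith
qed

end

text \<open>\<open>R_children\<close> provides at least one child, \<open>R_gap\<close> makes the
  slab gap at least 2, and \<open>R_count\<close> pushes the proportion of charged descendants below
  \<open>8^-h\<close>.\<close>

locale cantor_construction = cantor_exponents w R g \<nu> K L lf + regular_decaying_measure \<mu> \<alpha> A \<rho> D \<delta>
  for w :: "real ^ 'd" and R g \<nu> :: real and K L lf :: nat
    and \<mu> :: "(real ^ 'd) measure" and \<alpha> A \<rho> D \<delta> :: real +
  assumes R\<rho>: "inverse R \<le> \<rho>" and R_children: "1 \<le> inverse (A\<^sup>2) * (R / 4) powr \<alpha>"
    and R_gap: "2 \<le> R powr (\<kappa> / 8)"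
    and R_count: "max 1 (real K * real (card supp) * (D * A\<^sup>2 * 4 powr \<delta>)) * (16 * A\<^sup>2 * 4 powr \<alpha>) \<le> R powr (\<kappa> * \<delta> / 8)"
begin

text \<open>The number supplied by \<open>separated_points\<close>: half a radius is
  \<open>R / 4\<close> times twice the next radius.\<close>

definition N :: nat where "N = nat \<lfloor>inverse (A\<^sup>2) * (R / 4) powr \<alpha>\<rfloor>"

lemma N_bds: "real N \<le> inverse (A\<^sup>2) * (R / 4) powr \<alpha>" "inverse (A\<^sup>2) * (R / 4) powr \<alpha> / 2 \<le> real N" "0 < N"
proof -
  define t where "t = inverse (A\<^sup>2) * (R / 4) powr \<alpha>"
  have t: "1 \<le> t" using R_children by (simp add: t_def)
  then have "1 \<le> \<lfloor>t\<rfloor>" by simp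
  then have N: "real N = real_of_int \<lfloor>t\<rfloor>" "1 \<le> real_of_int \<lfloor>t\<rfloor>" by (simp_all add: N_def t_def)
  then have "real N \<le> t" "t / 2 \<le> real N" "0 < real N" by linarith+
  then show "real N \<le> inverse (A\<^sup>2) * (R / 4) powr \<alpha>" "inverse (A\<^sup>2) * (R / 4) powr \<alpha> / 2 \<le> real N" "0 < N"
    by (simp_all add: t_def)
qed

definition rad :: "nat \<Rightarrow> real" where "rad m = R powr - real m"

lemma rad_pos: "0 < rad m" using R1 by (simp add: rad_def)

lemma rad_Suc: "rad (Suc m) = rad m / R"
proof -
  have "rad (Suc m) = R powr (- real m - 1)" unfolding rad_def by (rule arg_cong[of _ _ "(powr) R"]) simp
  also have "\<dots> = rad m / R powr 1" by (simp only: powr_diff rad_def)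
  finally show ?thesis using R1 by simp
qed

lemma rad_Suc_le: "rad (Suc m) \<le> rad m / 4"
  unfolding rad_Suc using R4 rad_pos[of m] by (intro divide_left_mono) auto

lemma rad_le_\<rho>: "1 \<le> m \<Longrightarrow> rad m \<le> \<rho>"
proof -
  assume "1 \<le> m"
  then have "rad m \<le> R powr - 1" unfolding rad_def using R1 by (intro powr_mono) auto
  also have "\<dots> = inverse R" using R1 by (simp add: powr_minus)
  finally show ?thesis using R\<rho> by simp
qed

text \<open>The level of a node is the length of its history, so the root ball has radius
  \<open>R^-1\<close>. Centres in the inner half keep the child balls inside the parent, and the
  separation keeps them disjoint.\<close>

definition children :: "(real ^ 'd) list \<Rightarrow> (real ^ 'd) set" where
  "children xs = (SOME T. finite T \<and> card T = N \<and> T \<subseteq> msupp \<mu> \<inter> cball (hd xs) (rad (length xs) / 2) \<and>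
     (\<forall>y\<in>T. \<forall>z\<in>T. y \<noteq> z \<longrightarrow> 2 * rad (Suc (length xs)) < dist y z))"

lemma children:
  assumes "hd xs \<in> msupp \<mu>" "xs \<noteq> []"
  shows "finite (children xs)" "card (children xs) = N" "children xs \<subseteq> msupp \<mu> \<inter> cball (hd xs) (rad (length xs) / 2)"
    "\<And>y z. y \<in> children xs \<Longrightarrow> z \<in> children xs \<Longrightarrow> y \<noteq> z \<Longrightarrow> 2 * rad (Suc (length xs)) < dist y z"
proof -
  have l: "1 \<le> length xs" using assms(2) by (simp add: Suc_le_eq)
  have "rad (length xs) / 2 / (2 * rad (Suc (length xs))) = R / 4"
    unfolding rad_Suc using rad_pos[of "length xs"] R1 by simp
  then have "\<exists>T. finite T \<and> card T = N \<and> T \<subseteq> msupp \<mu> \<inter> cball (hd xs) (rad (length xs) / 2) \<and>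
     (\<forall>y\<in>T. \<forall>z\<in>T. y \<noteq> z \<longrightarrow> 2 * rad (Suc (length xs)) < dist y z)"
  proof (intro separated_points assms(1))
    show "0 < rad (length xs) / 2" "rad (length xs) / 2 \<le> \<rho>"
      "0 < 2 * rad (Suc (length xs))" "2 * rad (Suc (length xs)) \<le> \<rho>"
      using rad_le_\<rho>[OF l] rad_pos[of "length xs"] rad_pos[of "Suc (length xs)"] rad_Suc_le[of "length xs"] by linarith+
  qed (simp only: N_bds(1))
  from someI_ex[OF this, folded children_def]
  show "finite (children xs)" "card (children xs) = N" "children xs \<subseteq> msupp \<mu> \<inter> cball (hd xs) (rad (length xs) / 2)"
    "\<And>y z. y \<in> children xs \<Longrightarrow> z \<in> children xs \<Longrightarrow> y \<noteq> z \<Longrightarrow> 2 * rad (Suc (length xs)) < dist y z"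
    by blast+
qed

lemma child_ball:
  assumes "hd xs \<in> msupp \<mu>" "xs \<noteq> []" "y \<in> children xs"
  shows "cball y (rad (Suc (length xs))) \<subseteq> cball (hd xs) (rad (length xs))"
proof
  fix z assume "z \<in> cball y (rad (Suc (length xs)))"
  moreover have "dist (hd xs) y \<le> rad (length xs) / 2" using children(3)[OF assms(1,2)] assms(3) by auto
  ultimately show "z \<in> cball (hd xs) (rad (length xs))"
    using dist_triangle[of "hd xs" z y] rad_Suc_le[of "length xs"] rad_pos[of "length xs"] by simp
qed

text \<open>Goodness is ignored: bad nodes are counted among all descendants of an ancestor that is
  itself good.\<close>

primrec desc :: "(real ^ 'd) list \<Rightarrow> nat \<Rightarrow> (real ^ 'd) list set" where
  "desc ys 0 = {ys}"
| "desc ys (Suc h) = {y # xs | xs y. xs \<in> desc ys h \<and> y \<in> children xs}"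

lemma desc_props:
  assumes "hd ys \<in> msupp \<mu>" "ys \<noteq> []" "zs \<in> desc ys h"
  shows "length zs = length ys + h" "hd zs \<in> msupp \<mu>" "zs \<noteq> []"
    "cball (hd zs) (rad (length zs)) \<subseteq> cball (hd ys) (rad (length ys))"
proof -
  have "length zs = length ys + h \<and> hd zs \<in> msupp \<mu> \<and> zs \<noteq> [] \<and>
    cball (hd zs) (rad (length zs)) \<subseteq> cball (hd ys) (rad (length ys))"
    using assms(3)
  proof (induction h arbitrary: zs)
    case (Suc h)
    then obtain xs y where xs: "xs \<in> desc ys h" "y \<in> children xs" "zs = y # xs" by auto
    note IH = Suc.IH[OF xs(1)]
    then have "cball y (rad (Suc (length xs))) \<subseteq> cball (hd ys) (rad (length ys))"
      using child_ball[of xs y] xs(2) by blast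
    then show ?case using IH children(3)[of xs] xs by auto
  qed (use assms in auto)
  then show "length zs = length ys + h" "hd zs \<in> msupp \<mu>" "zs \<noteq> []"
    "cball (hd zs) (rad (length zs)) \<subseteq> cball (hd ys) (rad (length ys))" by auto
qed

lemma finite_desc:
  assumes "hd ys \<in> msupp \<mu>" "ys \<noteq> []"
  shows "finite (desc ys h)"
proof (induction h)
  case (Suc h)
  have "desc ys (Suc h) = (\<Union>xs\<in>desc ys h. (\<lambda>y. y # xs) ` children xs)" by auto
  then show ?case using Suc children(1) desc_props[OF assms] by simp
qed simp

lemma desc_disjoint:
  assumes ys: "hd ys \<in> msupp \<mu>" "ys \<noteq> []" and "zs \<in> desc ys h" "zs' \<in> desc ys h" "zs \<noteq> zs'"
  shows "cball (hd zs) (rad (length ys + h)) \<inter> cball (hd zs') (rad (length ys + h)) = {}"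
  using assms(3-5)
proof (induction h arbitrary: zs zs')
  case (Suc h)
  then obtain xs y xs' y' where xs: "xs \<in> desc ys h" "y \<in> children xs" "zs = y # xs"
    and xs': "xs' \<in> desc ys h" "y' \<in> children xs'" "zs' = y' # xs'" by auto
  note p = desc_props[OF ys xs(1)] and p' = desc_props[OF ys xs'(1)]
  show ?case
  proof (cases "xs = xs'")
    case True
    then have "2 * rad (Suc (length xs)) < dist y y'" using children(4)[OF p(2,3)] xs xs' Suc.prems by auto
    then have "z \<notin> cball y (rad (length ys + Suc h)) \<inter> cball y' (rad (length ys + Suc h))" for z
      using dist_triangle[of y y' z] p(1) by (auto simp: dist_commute)
    then show ?thesis using xs xs' by auto
  next
    case False
    have "cball y (rad (length ys + Suc h)) \<subseteq> cball (hd xs) (rad (length ys + h))"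
      "cball y' (rad (length ys + Suc h)) \<subseteq> cball (hd xs') (rad (length ys + h))"
      using child_ball[OF p(2,3) xs(2)] child_ball[OF p'(2,3) xs'(2)] p(1) p'(1) by simp_all
    then show ?thesis using Suc.IH[OF xs(1) xs'(1) False] xs xs' by auto
  qed
qed simp

section \<open>Counting the descendants charged to a ball\<close>

definition bad :: "nat \<Rightarrow> (real ^ 'd) list \<Rightarrow> (real ^ 'd) list set" where
  "bad h ys = {zs \<in> desc ys h. \<exists>n as. fails (length ys + h) h n (hd ys) (hd zs) as}"

text \<open>One failing descendant determines the sublattice for all of them by
  \<open>fails_unique\<close>. A vector \<open>v0\<close> that is large somewhere on the ancestor is
  small on all failing balls, so these lie in one slab; decay bounds its measure, and lower
  regularity turns measure into a number of disjoint balls.\<close>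

lemma card_fails_le:
  assumes ys: "hd ys \<in> msupp \<mu>" "ys \<noteq> []" and good: "good (length ys) (hd ys)"
  shows "real (card {zs \<in> desc ys h. \<exists>as. length as = j \<and> fails (length ys + h) h n (hd ys) (hd zs) as})
    \<le> D * A\<^sup>2 * 4 powr \<delta> * R powr (- (\<kappa> * \<delta> / 8) * real h) * R powr (\<alpha> * real h)"
    (is "real (card ?Y) \<le> ?B")
proof (cases "?Y = {}")
  case True
  have "0 \<le> ?B" using D\<delta> pos by simp
  then show ?thesis by (simp only: True card.empty of_nat_0)
next
  case False
  let ?c = "hd ys" and ?m = "length ys"
  let ?x = "n + L - (?m + h)"
  define X where "X = R powr ((\<theta> j - \<gamma> j) * real ?x - \<theta> 0 * real L)"
  define M where "M = R powr (\<kappa> / 8 * real h)"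
  obtain zs0 as0 where zs0: "zs0 \<in> desc ys h" "length as0 = j" "fails (?m + h) h n ?c (hd zs0) as0"
    using False by auto
  have prim0: "prim as0" "e0 \<notin> span (set as0)" using zs0(3) by (auto simp: fails_def)
  have h1: "1 \<le> h" using zs0(3) by (simp add: fails_def)
  obtain z0 v0 where z0: "z0 \<in> cball ?c (rad ?m)" and v0: "v0 \<in> span (set as0)" "v0 \<noteq> 0"
    and big: "R powr ((\<theta> j - \<gamma> j) * real ?x + \<kappa> / 8 * real h - \<theta> 0 * real L) * norm (lin n v0) \<le> vol n as0 * \<bar>form n z0 v0\<bar>"
    using zs0(2,3) unfolding fails_def rad_def[symmetric] by auto
  have vp: "0 < vol n as0" using vol_pos[OF prim0] .
  have lp: "0 < norm (lin n v0)" using span_lin_0[OF prim0(2) v0(1)] v0(2) by auto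
  have a0: "fst v0 \<noteq> 0" using lp by (auto simp: lin_eq_0_iff)
  have qp: "0 < q powr real n" using q1 by simp
  have X0: "0 < X" using R1 by (simp add: X_def)
  define \<tau> where "\<tau> = X * norm (lin n v0) / (vol n as0 * q powr real n)"
  have \<tau>: "0 < \<tau>" using X0 lp vp qp by (simp add: \<tau>_def)
  have M2: "2 \<le> M"
  proof -
    have "R powr (\<kappa> / 8) \<le> M" unfolding M_def using R1 \<kappa>_pos h1 by (intro powr_mono) auto
    then show ?thesis using R_gap by simp
  qed
  let ?W = "{z. \<bar>fst v0 \<bullet> z - (- snd v0)\<bar> \<le> \<tau>} \<inter> cball ?c (rad ?m)"
  have m1: "1 \<le> ?m" using ys(2) by (simp add: Suc_le_eq)
  have formeq: "\<bar>form n z v0\<bar> = q powr real n * \<bar>fst v0 \<bullet> z - (- snd v0)\<bar>" for z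
    using qp by (simp add: form_def abs_mult add.commute)
  have slab: "emeasure \<mu> ?W \<le> ennreal (D * (4 / M) powr \<delta> * (A * rad ?m powr \<alpha>))"
  proof (rule emeasure_slab_le[OF ys(1) rad_pos rad_le_\<rho>[OF m1] a0 \<tau> M2 z0])
    have "M * X = R powr (\<kappa> / 8 * real h + ((\<theta> j - \<gamma> j) * real ?x - \<theta> 0 * real L))"
      unfolding M_def X_def by (simp only: powr_add)
    also have "\<dots> = R powr ((\<theta> j - \<gamma> j) * real ?x + \<kappa> / 8 * real h - \<theta> 0 * real L)"
      by (rule arg_cong[of _ _ "(powr) R"]) simp
    finally have "M * X * norm (lin n v0) \<le> vol n as0 * (q powr real n * \<bar>fst v0 \<bullet> z0 - (- snd v0)\<bar>)"
      using big unfolding formeq by simp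
    then show "M * \<tau> \<le> \<bar>fst v0 \<bullet> z0 - (- snd v0)\<bar>"
      using vp qp by (simp add: \<tau>_def field_simps)
  qed
  have inW: "cball (hd zs) (rad (?m + h)) \<subseteq> ?W" if zs: "zs \<in> ?Y" for zs
  proof
    fix z assume z: "z \<in> cball (hd zs) (rad (?m + h))"
    obtain as where as: "length as = j" "fails (?m + h) h n ?c (hd zs) as" and zd: "zs \<in> desc ys h" using zs by auto
    have sub: "cball (hd zs') (rad (?m + h)) \<subseteq> cball ?c (rad ?m)" if "zs' \<in> desc ys h" for zs'
      using desc_props(1,4)[OF ys that] by simp
    have span: "span (set as) = span (set as0)"
      using fails_unique[OF good as(2) zs0(3) _ sub[OF zd, unfolded rad_def] sub[OF zs0(1), unfolded rad_def]]
        as(1) zs0(2) by simp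
    have "prim as" using as(2) by (simp add: fails_def)
    \<comment> \<open>Equal spans give equal volumes, so one \<open>\<tau>\<close> serves all
      failing descendants.\<close>
    then have vol: "vol n as = vol n as0"
      unfolding vol_def using prim_gram_eq[OF _ prim0(1) span linear_lin] by simp
    have "vol n as * \<bar>form n z v0\<bar> < X * norm (lin n v0)"
      using as z v0 unfolding fails_def X_def span rad_def by blast
    then have "\<bar>fst v0 \<bullet> z - (- snd v0)\<bar> < \<tau>"
      unfolding vol formeq \<tau>_def using vp qp by (simp add: field_simps)
    then show "z \<in> ?W" using z sub[OF zd] by auto
  qed
  have fin: "finite ?Y" using finite_desc[OF ys] by simp
  have disj: "cball (hd zs) (rad (?m + h)) \<inter> cball (hd zs') (rad (?m + h)) = {}"
    if "zs \<in> ?Y" "zs' \<in> ?Y" "zs \<noteq> zs'" for zs zs'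
    using desc_disjoint[OF ys, of zs h zs'] that by auto
  have inj: "inj_on hd ?Y"
  proof (rule inj_onI, rule ccontr)
    fix zs zs' assume z: "zs \<in> ?Y" "zs' \<in> ?Y" "hd zs = hd zs'" "zs \<noteq> zs'"
    then have "hd zs \<in> cball (hd zs) (rad (?m + h)) \<inter> cball (hd zs') (rad (?m + h))" using rad_pos[of "?m + h"] by simp
    then show False using disj[OF z(1,2,4)] by blast
  qed
  have "real (card (hd ` ?Y)) * (inverse A * rad (?m + h) powr \<alpha>) \<le> D * (4 / M) powr \<delta> * (A * rad ?m powr \<alpha>)"
  proof (rule card_disjoint_balls_le[where W = ?W])
    show "finite (hd ` ?Y)" using fin by simp
    show "hd ` ?Y \<subseteq> msupp \<mu>" using desc_props(2)[OF ys] by auto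
    show "rad (?m + h) \<le> \<rho>" using m1 by (intro rad_le_\<rho>) simp
    show "cball y (rad (?m + h)) \<inter> cball z (rad (?m + h)) = {}"
      if yz: "y \<in> hd ` ?Y" "z \<in> hd ` ?Y" "y \<noteq> z" for y z
    proof -
      obtain zs where "zs \<in> ?Y" "y = hd zs" using yz(1) by blast
      moreover obtain zs' where "zs' \<in> ?Y" "z = hd zs'" using yz(2) by blast
      ultimately show ?thesis using disj[of zs zs'] yz(3) by blast
    qed
    have "closed {z. \<bar>fst v0 \<bullet> z - (- snd v0)\<bar> \<le> \<tau>}" by (intro closed_Collect_le continuous_intros)
    then show "?W \<in> sets borel" by auto
    show "cball y (rad (?m + h)) \<subseteq> ?W" if "y \<in> hd ` ?Y" for y
      using inW that by blast
    show "0 \<le> D * (4 / M) powr \<delta> * (A * rad ?m powr \<alpha>)" using D\<delta> pos by simp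
  qed (use slab rad_pos in auto)
  moreover have "card (hd ` ?Y) = card ?Y" by (rule card_image[OF inj])
  ultimately have "real (card ?Y) * (inverse A * rad (?m + h) powr \<alpha>) \<le> D * (4 / M) powr \<delta> * (A * rad ?m powr \<alpha>)" by simp
  then have "real (card ?Y) * (inverse A * rad (?m + h) powr \<alpha>) * (A * R powr (\<alpha> * real (?m + h)))
     \<le> D * (4 / M) powr \<delta> * (A * rad ?m powr \<alpha>) * (A * R powr (\<alpha> * real (?m + h)))"
    using pos by (intro mult_right_mono) auto
  moreover have "inverse A * rad (?m + h) powr \<alpha> * (A * R powr (\<alpha> * real (?m + h))) = 1"
  proof -
    have "rad (?m + h) powr \<alpha> * R powr (\<alpha> * real (?m + h)) = 1"
      using R1 by (simp add: rad_def powr_powr powr_add[symmetric] algebra_simps)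
    then show ?thesis using pos by (simp add: field_simps)
  qed
  moreover have "D * (4 / M) powr \<delta> * (A * rad ?m powr \<alpha>) * (A * R powr (\<alpha> * real (?m + h))) = ?B"
  proof -
    have "rad ?m powr \<alpha> * R powr (\<alpha> * real (?m + h)) = R powr (\<alpha> * real h)"
      using R1 by (simp add: rad_def powr_powr powr_add[symmetric] algebra_simps)
    moreover have "(4 / M) powr \<delta> = 4 powr \<delta> * R powr (- (\<kappa> * \<delta> / 8) * real h)"
    proof -
      have "M powr \<delta> = R powr (\<kappa> * \<delta> / 8 * real h)"
        unfolding M_def powr_powr by (rule arg_cong[of _ _ "(powr) R"]) simp
      moreover have "- (\<kappa> * \<delta> / 8) * real h = - (\<kappa> * \<delta> / 8 * real h)" by (rule mult_minus_left)
      moreover have "(4 / M) powr \<delta> = 4 powr \<delta> / M powr \<delta>" by (rule powr_divide)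
      ultimately show ?thesis by (simp only: powr_minus divide_inverse)
    qed
    moreover have "u * v * (A * y) * (A * z) = u * A\<^sup>2 * v * (y * z)" for u v y z :: real
      by (simp add: power2_eq_square)
    ultimately have "D * (4 / M) powr \<delta> * (A * rad ?m powr \<alpha>) * (A * R powr (\<alpha> * real (?m + h)))
        = D * A\<^sup>2 * (4 powr \<delta> * R powr (- (\<kappa> * \<delta> / 8) * real h)) * R powr (\<alpha> * real h)"
      by (simp only:)
    then show ?thesis by (simp only: mult.assoc)
  qed
  ultimately show ?thesis by (simp only: mult.assoc mult_1_right)
qed

text \<open>The lookback \<open>h\<close> leaves at most \<open>K\<close> possible times
  \<open>n\<close>, because \<open>x div K = h - 1\<close>, and \<open>d\<close> possible
  ranks.\<close>

lemma card_bad_le: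
  assumes ys: "hd ys \<in> msupp \<mu>" "ys \<noteq> []" and good: "good (length ys) (hd ys)" and h: "1 \<le> h"
  shows "finite (bad h ys)" "real (card (bad h ys)) * 8 ^ h \<le> real N ^ h"
proof -
  show fin: "finite (bad h ys)" unfolding bad_def using finite_desc[OF ys] by simp
  let ?m = "length ys"
  let ?Y = "\<lambda>(n, j). {zs \<in> desc ys h. \<exists>as. length as = j \<and> fails (?m + h) h n (hd ys) (hd zs) as}"
  define S where "S = {n. ?m + h \<le> n + lf \<and> h = (n + L - (?m + h)) div K + 1}"
  have K: "0 < K" using K_ge \<nu>_pos by (cases K) auto
  have S: "finite S" "card S \<le> K"
  proof -
    let ?f = "\<lambda>n. n + L - (?m + h)"
    have img: "?f ` S \<subseteq> {K * (h - 1)..<K * (h - 1) + K}"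
    proof
      fix x assume "x \<in> ?f ` S"
      then have "x div K = h - 1" by (auto simp: S_def)
      then show "x \<in> {K * (h - 1)..<K * (h - 1) + K}"
        using K div_mult_mod_eq[of x K] mod_less_divisor[OF K, of x] by (auto simp: mult.commute)
    qed
    have inj: "inj_on ?f S"
      using lf_le_L by (intro inj_onI) (auto simp: S_def)
    show "finite S" using finite_imageD[OF finite_subset[OF img] inj] by simp
    have "card S = card (?f ` S)" using card_image[OF inj] by simp
    also have "\<dots> \<le> card {K * (h - 1)..<K * (h - 1) + K}" by (intro card_mono img) auto
    finally show "card S \<le> K" by simp
  qed
  let ?B = "D * A\<^sup>2 * 4 powr \<delta> * R powr (- (\<kappa> * \<delta> / 8) * real h) * R powr (\<alpha> * real h)"
  have B0: "0 \<le> ?B" using D\<delta> pos by simp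
  have "bad h ys \<subseteq> (\<Union>p\<in>S \<times> {1..d}. ?Y p)"
  proof
    fix zs assume "zs \<in> bad h ys"
    then obtain n as where f: "zs \<in> desc ys h" "fails (?m + h) h n (hd ys) (hd zs) as" by (auto simp: bad_def)
    then have "n \<in> S" "length as \<in> {1..d}"
      using length_prim_le[of as] by (auto simp: fails_def S_def Suc_le_eq)
    then show "zs \<in> (\<Union>p\<in>S \<times> {1..d}. ?Y p)" using f by (intro UN_I[of "(n, length as)"]) auto
  qed
  then have "card (bad h ys) \<le> card (\<Union>p\<in>S \<times> {1..d}. ?Y p)"
    using S(1) finite_desc[OF ys] by (intro card_mono) auto
  also have "\<dots> \<le> (\<Sum>p\<in>S \<times> {1..d}. card (?Y p))" using S(1) by (intro card_UN_le) auto
  finally have "real (card (bad h ys)) \<le> (\<Sum>p\<in>S \<times> {1..d}. real (card (?Y p)))" by (simp flip: of_nat_sum)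
  also have "\<dots> \<le> (\<Sum>p\<in>S \<times> {1..d}. ?B)"
    using card_fails_le[OF ys good] by (intro sum_mono) auto
  also have "\<dots> = real (card S) * real d * ?B" by (simp add: card_cartesian_product)
  also have "\<dots> \<le> real K * real d * ?B" using S(2) B0 by (intro mult_right_mono) auto
  finally have c1: "real (card (bad h ys)) \<le> real K * real d * ?B" .
  \<comment> \<open>At least 1, so that it may be raised to the power \<open>h\<close> together with
    the other factors.\<close>
  define C where "C = max 1 (real K * real d * (D * A\<^sup>2 * 4 powr \<delta>))"
  define G where "G = R powr - (\<kappa> * \<delta> / 8)"
  define b where "b = inverse (A\<^sup>2) * (R / 4) powr \<alpha> / 2"
  have b: "0 < b" "b \<le> real N" "R powr \<alpha> = 2 * A\<^sup>2 * 4 powr \<alpha> * b"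
    using N_bds(2) R_children pos R1 by (auto simp: b_def powr_divide field_simps)
  have CG: "C * (16 * A\<^sup>2 * 4 powr \<alpha>) * G \<le> 1"
    using R_count R1 unfolding C_def G_def by (simp add: powr_minus field_simps)
  have C1: "1 \<le> C" "real K * real d * (D * A\<^sup>2 * 4 powr \<delta>) \<le> C" by (auto simp: C_def)
  have pw: "R powr (e * real h) = (R powr e) ^ h" for e
    using R1 by (simp add: powr_powr[symmetric] powr_realpow)
  have "real (card (bad h ys)) * 8 ^ h \<le> (C * (G ^ h * (R powr \<alpha>) ^ h)) * 8 ^ h"
  proof (rule mult_right_mono)
    have "real K * real d * ?B = (real K * real d * (D * A\<^sup>2 * 4 powr \<delta>)) * (G ^ h * (R powr \<alpha>) ^ h)"
      unfolding pw G_def by simp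
    also have "\<dots> \<le> C * (G ^ h * (R powr \<alpha>) ^ h)"
      using C1(2) by (intro mult_right_mono) (auto simp: G_def)
    finally show "real (card (bad h ys)) \<le> C * (G ^ h * (R powr \<alpha>) ^ h)" using c1 by linarith
  qed simp
  also have "\<dots> \<le> (C ^ h * (G ^ h * (R powr \<alpha>) ^ h)) * 8 ^ h"
    using C1(1) h power_increasing[of 1 h C] by (intro mult_right_mono) (auto simp: G_def)
  \<comment> \<open>The 16 is the 8 of the claim times the 2 lost in rounding \<open>N\<close>
    down.\<close>
  also have "\<dots> = (C * (16 * A\<^sup>2 * 4 powr \<alpha>) * G * b) ^ h"
    unfolding b(3) by (simp add: power_mult_distrib[symmetric] mult_ac)
  also have "\<dots> \<le> (1 * b) ^ h"
    using CG b(1) C1(1) by (intro power_mono mult_right_mono) (auto simp: G_def)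
  also have "\<dots> \<le> real N ^ h" using b by (intro power_mono) auto
  finally show "real (card (bad h ys)) * 8 ^ h \<le> real N ^ h" .
qed

abbreviation "good_node xs \<equiv> good (length xs) (hd xs)"

lemma survivors_props:
  assumes "x0 \<in> msupp \<mu>" "xs \<in> survivors children good_node x0 m"
  shows "hd xs \<in> msupp \<mu>" "xs \<noteq> []" "good_node xs"
proof -
  have "hd xs \<in> msupp \<mu> \<and> xs \<noteq> [] \<and> good_node xs"
    using assms(2)
  proof (induction m arbitrary: xs)
    case 0
    then show ?case using assms(1) good_1[of x0] by simp
  next
    case (Suc m)
    then obtain zs y where zs: "zs \<in> survivors children good_node x0 m" "y \<in> children zs" "good_node (y # zs)" "xs = y # zs"
      by auto
    then show ?case using children(3)[of zs] Suc.IH[OF zs(1)] by auto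
  qed
  then show "hd xs \<in> msupp \<mu>" "xs \<noteq> []" "good_node xs" by auto
qed

lemma survivors_desc: "xs \<in> survivors children good_node x0 (m + h) \<Longrightarrow> xs \<in> desc (drop h xs) h"
  by (induction h arbitrary: xs) auto

lemma survivors_children_desc:
  assumes "xs \<in> survivors children good_node x0 m" "y \<in> children xs" "1 \<le> h" "h \<le> Suc m"
  shows "y # xs \<in> desc (drop h (y # xs)) h"
proof -
  obtain k where k: "h = Suc k" using assms(3) by (cases h) auto
  have "xs \<in> survivors children good_node x0 ((m - k) + k)" using assms k by simp
  from survivors_desc[OF this] show ?thesis using k assms(2) by auto
qed

lemma survivors_exist:
  assumes x0: "x0 \<in> msupp \<mu>"
  shows "survivors children good_node x0 m \<noteq> {}"
proof (rule survivors_nonempty[where X = bad and N = N])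
  fix m xs assume xs: "xs \<in> survivors children good_node x0 m"
  note p = survivors_props[OF x0 xs]
  show "finite (children xs) \<and> card (children xs) = N" using children[OF p(1,2)] by blast
  show "finite (bad h xs) \<and> real (card (bad h xs)) * 8 ^ h \<le> real N ^ h" if "1 \<le> h" for h
    using card_bad_le[OF p that] by blast
  fix y assume y: "y \<in> children xs" and ng: "\<not> good_node (y # xs)"
  let ?zs = "y # xs"
  have len: "length xs = Suc m" using length_survivors[OF xs] .
  define M where "M = length ?zs"
  \<comment> \<open>Centre of the ancestor of level \<open>k\<close>: dropping \<open>M - k\<close>
    entries leaves a history of length \<open>k\<close>.\<close>
  define ctr where "ctr k = hd (drop (M - k) ?zs)" for k
  have "\<exists>h n as. 1 \<le> h \<and> h < M \<and> fails M h n (ctr (M - h)) y as"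
  proof (rule not_good_imp_fails)
    show "1 \<le> M" by (simp add: M_def)
    show "\<not> good M y" using ng by (simp add: M_def)
    show "good k (ctr k)" if k: "1 \<le> k" "k < M" for k
    proof -
      have "drop (M - k) ?zs \<in> survivors children good_node x0 (Suc m - (M - k))"
        using k len by (intro drop_Cons_survivors[OF xs]) (auto simp: M_def)
      from survivors_props(3)[OF x0 this] show ?thesis using k by (simp add: ctr_def M_def)
    qed
    show "y \<in> cball (ctr (M - 1)) (R powr - real (M - 1))" if "2 \<le> M"
    proof -
      have "y \<in> cball y (rad (Suc (length xs)))" using rad_pos[of "Suc (length xs)"] by simp
      then have "y \<in> cball (hd xs) (rad (length xs))" using child_ball[OF p(1,2) y] by blast
      then show ?thesis by (simp add: ctr_def M_def rad_def)
    qed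
  qed
  then obtain h n as where h: "1 \<le> h" "h < M" "fails M h n (ctr (M - h)) y as" by blast
  have hm: "h \<le> Suc m" using h(2) len by (simp add: M_def)
  have "fails (length (drop h ?zs) + h) h n (hd (drop h ?zs)) (hd ?zs) as"
    using h by (simp add: ctr_def M_def)
  then have "?zs \<in> bad h (drop h ?zs)"
    unfolding bad_def using survivors_children_desc[OF xs y h(1) hm] by blast
  then show "\<exists>h\<in>{1..Suc m}. ?zs \<in> bad h (drop h ?zs)" using h(1) hm by auto
qed (use N_bds in auto)

text \<open>Centres of arbitrarily deep survivors play the part of an infinite branch: the bound at
  time \<open>n\<close> holds for all sufficiently deep ones, and by compactness and continuity it
  passes to a limit point in the support.\<close>

lemma Bad_meets_msupp:
  assumes "compact (msupp \<mu>)" "msupp \<mu> \<noteq> {}"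
  shows "Bad w \<inter> msupp \<mu> \<noteq> {}"
proof -
  obtain x0 where x0: "x0 \<in> msupp \<mu>" using assms(2) by blast
  have "\<exists>xs. xs \<in> survivors children good_node x0 m" for m using survivors_exist[OF x0] by blast
  then obtain z where z: "\<And>m. z m \<in> survivors children good_node x0 m" by metis
  define y where "y m = hd (z m)" for m
  have ys: "y m \<in> msupp \<mu>" for m using survivors_props(1)[OF x0 z] by (simp add: y_def)
  have key: "form_floor \<le> norm (lin n v) \<or> form_floor \<le> \<bar>form n (y m) v\<bar>"
    if "n + lf \<le> m" "v \<in> lat" "v \<noteq> 0" for n m v
  proof -
    \<comment> \<open>Survivors with index \<open>k\<close> have level \<open>k + 1\<close>, so
      level \<open>n + lf\<close> has index \<open>n + lf - 1\<close>.\<close>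
    define k where "k = n + lf - 1"
    have k: "k \<le> m" "n + lf = Suc k" using that(1) lf_le_L by (auto simp: k_def)
    have zm: "z m \<in> survivors children good_node x0 (k + (m - k))" using z[of m] k by simp
    define us where "us = drop (m - k) (z m)"
    have us: "us \<in> survivors children good_node x0 k" unfolding us_def by (rule drop_survivors[OF zm])
    note p = survivors_props[OF x0 us]
    have lu: "length us = n + lf" using length_survivors[OF us] k by simp
    have "z m \<in> desc us (m - k)" using survivors_desc[OF zm] by (simp add: us_def)
    from desc_props(4)[OF p(1,2) this] have "cball (y m) (rad (length (z m))) \<subseteq> cball (hd us) (rad (n + lf))"
      by (simp add: y_def lu)
    moreover have "y m \<in> cball (y m) (rad (length (z m)))" using rad_pos[of "length (z m)"] by simp
    ultimately have "y m \<in> cball (hd us) (R powr - real (n + lf))" unfolding rad_def by blast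
    then show ?thesis using p(3) lu that(2,3) good_forms_bounded_below[of n "hd us" "y m" v] by simp
  qed
  obtain x f where x: "x \<in> msupp \<mu>" and f: "strict_mono (f :: nat \<Rightarrow> nat)" "(y \<circ> f) \<longlonglongrightarrow> x"
    using assms(1) ys unfolding compact_def by blast
  have "x \<in> Bad w"
  proof (rule Bad_if_forms_bounded_below[OF form_floor_pos])
    fix n v assume v: "v \<in> lat" "v \<noteq> 0"
    show "form_floor \<le> norm (lin n v) \<or> form_floor \<le> \<bar>form n x v\<bar>"
    proof (cases "form_floor \<le> norm (lin n v)")
      case False
      have "(\<lambda>i. \<bar>form n ((y \<circ> f) i) v\<bar>) \<longlonglongrightarrow> \<bar>form n x v\<bar>"
        unfolding form_def using f(2) by (intro tendsto_intros)
      moreover have "\<forall>i\<ge>n + lf. form_floor \<le> \<bar>form n ((y \<circ> f) i) v\<bar>"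
      proof (intro allI impI)
        fix i assume "n + lf \<le> i"
        then have "n + lf \<le> f i" using seq_suble[OF f(1), of i] by simp
        then show "form_floor \<le> \<bar>form n ((y \<circ> f) i) v\<bar>" using key[of n "f i" v] v False by simp
      qed
      ultimately show ?thesis by (intro disjI2 LIMSEQ_le_const) auto
    qed blast
  qed
  then show ?thesis using x by blast
qed

end

section \<open>Choice of the constants\<close>

lemma powr_ge_ex:
  assumes "0 < (c::real)"
  shows "\<exists>R0. \<forall>R\<ge>R0. B \<le> R powr c"
proof (intro exI allI impI)
  fix R assume R: "(max 1 B) powr (1 / c) \<le> R"
  have "B \<le> ((max 1 B) powr (1 / c)) powr c" using assms by (simp add: powr_powr)
  also have "\<dots> \<le> R powr c" using R assms by (intro powr_mono2) auto
  finally show "B \<le> R powr c" .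
qed

theorem theorem1p5:
  fixes w :: "real ^ 'd" and \<mu> :: "(real ^ 'd) measure"
  assumes "\<And>i. w $ i \<ge> 0" and "(\<Sum>i\<in>UNIV. w $ i) = 1"
    and "sets \<mu> = sets borel" and "emeasure \<mu> UNIV \<noteq> 0"
    and "compact (msupp \<mu>)"
    and "ahlfors_regular \<mu>" and "absolutely_decaying \<mu>"
  shows "Bad w \<inter> msupp \<mu> \<noteq> {}"
proof -
  obtain \<alpha> A \<rho>\<^sub>0 where a: "0 < \<alpha>" "0 < A" "0 < \<rho>\<^sub>0"
    and reg: "\<forall>x\<in>msupp \<mu>. \<forall>r. 0 < r \<and> r \<le> \<rho>\<^sub>0 \<longrightarrow>
      ennreal (inverse A * r powr \<alpha>) \<le> emeasure \<mu> (cball x r) \<and> emeasure \<mu> (cball x r) \<le> ennreal (A * r powr \<alpha>)"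
    using assms(6) unfolding ahlfors_regular_def by blast
  obtain D \<delta> r\<^sub>0 where d: "0 < D" "0 < \<delta>" "0 < r\<^sub>0"
    and dec: "\<forall>x\<in>msupp \<mu>. \<forall>r. 0 < r \<and> r \<le> r\<^sub>0 \<longrightarrow> (\<forall>H r'. hyperplane H \<and> 0 < r' \<longrightarrow>
      emeasure \<mu> (closed_nbhd H r' \<inter> cball x r) \<le> ennreal (D * (r' / r) powr \<delta>) * emeasure \<mu> (cball x r))"
    using assms(7) unfolding absolutely_decaying_def by blast
  define \<rho> where "\<rho> = min \<rho>\<^sub>0 r\<^sub>0"
  have \<rho>: "0 < \<rho>" using a d by (simp add: \<rho>_def)
  \<comment> \<open>The base 2 is a placeholder: \<open>\<kappa>\<close> and \<open>supp\<close>
    depend on \<open>w\<close> alone and must be available before \<open>R\<close> is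
    chosen.\<close>
  interpret W: weighted_flow w 2 using assms(1,2) by unfold_locales auto
  define \<kappa> where "\<kappa> = W.\<kappa>"
  define dd where "dd = card W.supp"
  have \<kappa>: "0 < \<kappa>" using W.\<kappa>_pos by (simp add: \<kappa>_def)
  \<comment> \<open>Gives equality in the bound \<open>g_le\<close>, namely
    \<open>64 g (d + 1)^2 = \<kappa>^2 / 2\<close>.\<close>
  define g where "g = \<kappa>\<^sup>2 / (128 * (real dd + 1)\<^sup>2)"
  define \<nu> where "\<nu> = g / (32 * (real dd + 1))"
  have g: "0 < g" using \<kappa> by (simp add: g_def)
  have \<nu>: "0 < \<nu>" using g by (simp add: \<nu>_def)
  define K where "K = nat \<lceil>4 / \<nu>\<rceil>"
  have K: "4 / \<nu> \<le> real K" unfolding K_def by linarith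
  define L where "L = nat \<lceil>max (100 / \<nu>) (24 * real K / \<kappa>)\<rceil>"
  have "max (100 / \<nu>) (24 * real K / \<kappa>) \<le> real L" unfolding L_def by linarith
  then have L: "100 / \<nu> \<le> real L" "24 * real K / \<kappa> \<le> real L" by auto
  define lf where "lf = nat \<lceil>g * real L / 4\<rceil>"
  have "\<nu> * (32 * (real dd + 1)) = g"
    using nonzero_eq_divide_eq[of "32 * (real dd + 1)" \<nu> g] by (simp add: \<nu>_def)
  then have \<nu>g: "32 * \<nu> * (real dd + 1) = g" by (simp only: mult_ac)
  have \<nu>g': "32 * \<nu> \<le> g" using \<nu>g \<nu> mult_left_mono[of 1 "real dd + 1" "32 * \<nu>"] by simp
  have L100: "100 \<le> \<nu> * real L" using L(1) \<nu> by (simp add: field_simps)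
  have "32 * \<nu> * real L \<le> g * real L" using \<nu>g' by (intro mult_right_mono) auto
  then have gL: "4 \<le> g * real L" using L100 by simp
  \<comment> \<open>Because \<open>g L\<close> is at least 4, rounding \<open>g L / 4\<close> up
    stays below \<open>g L / 2\<close>.\<close>
  then have lf: "g * real L / 4 \<le> real lf" "real lf \<le> g * real L / 2" unfolding lf_def by linarith+
  obtain R1 where R1: "\<And>R. R1 \<le> R \<Longrightarrow> 2 \<le> R powr (\<kappa> / 8)" using powr_ge_ex[of "\<kappa> / 8" 2] \<kappa> by auto
  obtain R2 where R2: "\<And>R. R2 \<le> R \<Longrightarrow> max 1 (real K * real dd * (D * A\<^sup>2 * 4 powr \<delta>)) * (16 * A\<^sup>2 * 4 powr \<alpha>) \<le> R powr (\<kappa> * \<delta> / 8)"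
    using powr_ge_ex[of "\<kappa> * \<delta> / 8"] \<kappa> d by force
  obtain R3 where R3: "\<And>R. R3 \<le> R \<Longrightarrow> A\<^sup>2 * 4 powr \<alpha> \<le> R powr \<alpha>" using powr_ge_ex[OF a(1)] by blast
  define R where "R = max (max R1 R2) (max R3 (max (4 * 9 ^ dd) (inverse \<rho>)))"
  have Rge: "R1 \<le> R" "R2 \<le> R" "R3 \<le> R" "4 * 9 ^ dd \<le> R" "inverse \<rho> \<le> R" by (auto simp: R_def)
  have "1 \<le> (9::real) ^ dd" by simp
  then have Rgt: "1 < R" using Rge(4) by linarith
  interpret C: cantor_construction w R g \<nu> K L lf \<mu> \<alpha> A \<rho> D \<delta>
  proof unfold_locales
    show "0 \<le> w $ i" for i by (rule assms)
    show "(\<Sum>i\<in>UNIV. w $ i) = 1" by (rule assms)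
    show "1 < R" by (rule Rgt)
    show "0 < g" by (rule g)
    show "64 * g * (real (card (weighted_flow.supp w)) + 1)\<^sup>2 \<le> weighted_flow.\<kappa> w * (weighted_flow.\<kappa> w / 2)"
      by (simp add: g_def \<kappa>_def[symmetric] dd_def[symmetric] power2_eq_square)
    show "0 < \<nu>" by (rule \<nu>)
    show "32 * \<nu> * (real (card (weighted_flow.supp w)) + 1) \<le> g" using \<nu>g by (simp add: dd_def[symmetric])
    show "4 \<le> \<nu> * real K" using K \<nu> by (simp add: field_simps)
    show "100 \<le> \<nu> * real L" by (rule L100)
    show "12 * real K \<le> weighted_flow.\<kappa> w / 2 * real L"
      using L(2) \<kappa> by (simp add: \<kappa>_def[symmetric] field_simps)
    show "g * real L / 4 \<le> real lf" "real lf \<le> g * real L / 2" by (rule lf)+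
    show "4 * 9 ^ card (weighted_flow.supp w) \<le> R" using Rge(4) by (simp add: dd_def)
    have "R powr (\<kappa> / 8) \<le> R powr \<kappa>" using Rgt \<kappa> by (intro powr_mono) auto
    then show "2 \<le> R powr weighted_flow.\<kappa> w" using R1[OF Rge(1)] by (simp add: \<kappa>_def[symmetric])
    show "sets \<mu> = sets borel" by (rule assms)
    show "0 < \<alpha>" "0 < A" "0 < \<rho>" "0 < D" "0 < \<delta>" by (rule a \<rho> d)+
    show "ennreal (inverse A * r powr \<alpha>) \<le> emeasure \<mu> (cball x r)"
      "emeasure \<mu> (cball x r) \<le> ennreal (A * r powr \<alpha>)" if "x \<in> msupp \<mu>" "0 < r" "r \<le> \<rho>" for x r
      using reg[rule_format, OF that(1), of r] that by (auto simp: \<rho>_def)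
    show "emeasure \<mu> (closed_nbhd H r' \<inter> cball x r) \<le> ennreal (D * (r' / r) powr \<delta>) * emeasure \<mu> (cball x r)"
      if "x \<in> msupp \<mu>" "0 < r" "r \<le> \<rho>" "hyperplane H" "0 < r'" for x r H r'
      using dec[rule_format, OF that(1), of r H r'] that by (auto simp: \<rho>_def)
    show "inverse R \<le> \<rho>" using Rge(5) \<rho> Rgt by (simp add: field_simps)
    show "1 \<le> inverse (A\<^sup>2) * (R / 4) powr \<alpha>"
      using R3[OF Rge(3)] a(2) Rgt by (simp add: powr_divide field_simps)
    show "2 \<le> R powr (weighted_flow.\<kappa> w / 8)" using R1[OF Rge(1)] by (simp add: \<kappa>_def)
    show "max 1 (real K * real (card (weighted_flow.supp w)) * (D * A\<^sup>2 * 4 powr \<delta>)) * (16 * A\<^sup>2 * 4 powr \<alpha>)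
        \<le> R powr (weighted_flow.\<kappa> w * \<delta> / 8)"
      using R2[OF Rge(2)] by (simp only: \<kappa>_def dd_def)
  qed
  show ?thesis using C.Bad_meets_msupp[OF assms(5) msupp_nonempty[OF assms(3,4)]] .
qed

end
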